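(* Let $k>1$ be a fixed integer, and let the parameters $\alpha,\beta\in[0,\infty)$ satisfy $(\alpha,\beta)\neq(0,0)$ (infinite parameters are also allowed, by limits, as described in the context). Let $A_n$ and $B_n$ be the numbers of symbols $\alpha$ and $\beta$, respectively, on the $k$-th diagonal of a random $\alpha/\beta$-staircase tableau of size $n$ distributed according to $\mathbb{P}_{n,\alpha,\beta}$. Then, as $n\to\infty$, $$(A_n,B_n)\ \stackrel{d}{\longrightarrow}\ (Z_1,Z_2),$$ where $Z_1$ and $Z_2$ are independent random variables, each Poisson distributed with parameter $\tfrac12$, and $\stackrel{d}{\to}$ is (joint) convergence in distribution.
   Context: An $\alpha/\beta$-staircase tableau of size $n$ is a Young diagram of shape $(n,n-1,\dots,1)$ (rows and columns numbered from the NW corner; box $(i,j)$ is in row $i$, column $j$, with $i,j\ge1$, $i+j\le n+1$) whose boxes are each either empty or filled with one symbol $\alpha$ or $\beta$, such that: (1) every box with $i+j=n+1$ (the first diagonal) contains a symbol; (2) all boxes in the same column as and north of (above) an $\alpha$ are empty; (3) all boxes in the same row as and west of (to the left of) a $\beta$ are empty. $\mathcal{S}_n$ is the set of all such tableaux. For $1\le k\le n$, the $k$-th diagonal is the set of boxes $(i,j)$ with $i+j=n-k+2$; it has $n-k+1$ boxes. The letters $\alpha,\beta$ are also used as numerical weights. For $n\ge1$ and $\alpha,\beta\in[0,\infty)$ with $(\alpha,\beta)\neq(0,0)$, the weight $wt(S)$ of $S\in\mathcal{S}_n$ is the product of all its symbols, i.e. $\alpha^{\#\alpha(S)}\beta^{\#\beta(S)}$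 (with $0^0=1$), where $\#\alpha(S)$ and $\#\beta(S)$ are the numbers of $\alpha$'s and $\beta$'s in $S$, and $\mathbb{P}_{n,\alpha,\beta}(S)=wt(S)/Z_n(\alpha,\beta)$ with $Z_n(\alpha,\beta)=\sum_{S\in\mathcal{S}_n}wt(S)$. Infinite parameters are allowed by taking limits of $\mathbb{P}_{n,\alpha,\beta}$: $\alpha\to\infty$ with $\beta$ fixed, $\beta\to\infty$ with $\alpha$ fixed, or $\alpha=\beta\to\infty$.
   Formalization: Both parameters are assumed positive (finite or infinite): if exactly one of α, β is 0, every tableau of positive weight is empty off the first diagonal, so A_n = B_n = 0 for k > 1 and the Poisson limit fails. *)

theory Defs
  imports "HOL-Probability.Probability"
begin

datatype symbol = Alpha | Beta

type_synonym tableau = "nat \<times> nat \<Rightarrow> symbol option"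

definition staircase :: "nat \<Rightarrow> (nat \<times> nat) set" where
  "staircase n = {(i, j). 1 \<le> i \<and> 1 \<le> j \<and> i + j \<le> n + 1}"

text \<open>The value \<^term>\<open>None\<close> encodes an empty box. Rows are numbered downwards, so the boxes
  north of \<^term>\<open>(i, j)\<close> are those \<^term>\<open>(i', j)\<close> with \<^term>\<open>i' < i\<close>.\<close>

definition stair_tableaux :: "nat \<Rightarrow> tableau set" where
  "stair_tableaux n = {S. dom S \<subseteq> staircase n \<and>
     (\<forall>i j. (i, j) \<in> staircase n \<and> i + j = n + 1 \<longrightarrow> S (i, j) \<noteq> None) \<and>
     (\<forall>i j. S (i, j) = Some Alpha \<longrightarrow> (\<forall>i' < i. S (i', j) = None)) \<and>
     (\<forall>i j. S (i, j) = Some Beta \<longrightarrow> (\<forall>j' < j. S (i, j') = None))}"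

text \<open>The condition \<^term>\<open>i + j + k = n + (2::nat)\<close> is \<open>i + j = n - k + 2\<close> without truncated
  subtraction; the diagonal is empty when \<^term>\<open>k > n\<close>.\<close>

definition diagonal :: "nat \<Rightarrow> nat \<Rightarrow> (nat \<times> nat) set" where
  "diagonal n k = {(i, j) \<in> staircase n. i + j + k = n + 2}"

definition symbol_count :: "symbol \<Rightarrow> tableau \<Rightarrow> nat" where
  "symbol_count s S = card {x. S x = Some s}"

definition diagonal_count :: "nat \<Rightarrow> nat \<Rightarrow> symbol \<Rightarrow> tableau \<Rightarrow> nat" where
  "diagonal_count n k s S = card {x \<in> diagonal n k. S x = Some s}"

definition stair_weight :: "real \<Rightarrow> real \<Rightarrow> tableau \<Rightarrow> real" where
  "stair_weight \<alpha> \<beta> S = \<alpha> ^ symbol_count Alpha S * \<beta> ^ symbol_count Beta S"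

definition stair_Z :: "nat \<Rightarrow> real \<Rightarrow> real \<Rightarrow> real" where
  "stair_Z n \<alpha> \<beta> = (\<Sum>S\<in>stair_tableaux n. stair_weight \<alpha> \<beta> S)"

definition stair_prob_fin :: "nat \<Rightarrow> real \<Rightarrow> real \<Rightarrow> tableau \<Rightarrow> real" where
  "stair_prob_fin n \<alpha> \<beta> S = stair_weight \<alpha> \<beta> S / stair_Z n \<alpha> \<beta>"

text \<open>If both parameters are infinite, the limit is taken along the diagonal
  \<open>\<alpha> = \<beta> \<longrightarrow> \<infinity>\<close>, since it depends on the path in general.\<close>

definition stair_prob :: "nat \<Rightarrow> ennreal \<Rightarrow> ennreal \<Rightarrow> tableau \<Rightarrow> real" where
  "stair_prob n \<alpha> \<beta> S =
     (if \<alpha> = \<top> \<and> \<beta> = \<top> then Lim at_top (\<lambda>x. stair_prob_fin n x x S)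
      else if \<alpha> = \<top> then Lim at_top (\<lambda>x. stair_prob_fin n x (enn2real \<beta>) S)
      else if \<beta> = \<top> then Lim at_top (\<lambda>x. stair_prob_fin n (enn2real \<alpha>) x S)
      else stair_prob_fin n (enn2real \<alpha>) (enn2real \<beta>) S)"

definition stair_measure :: "nat \<Rightarrow> ennreal \<Rightarrow> ennreal \<Rightarrow> tableau measure" where
  "stair_measure n \<alpha> \<beta> =
     point_measure (stair_tableaux n) (\<lambda>S. ennreal (stair_prob n \<alpha> \<beta> S))"

text \<open>The library's \<^const>\<open>weak_conv_m\<close> covers only measures on the real line. The following is
  meant for probability measures on the Borel sets.\<close>

definition converges_in_distribution ::
    "(nat \<Rightarrow> 'a::topological_space measure) \<Rightarrow> 'a measure \<Rightarrow> bool" where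
  "converges_in_distribution \<mu> \<nu> \<longleftrightarrow>
     (\<forall>f :: 'a \<Rightarrow> real. continuous_on UNIV f \<and> bounded (range f) \<longrightarrow>
        (\<lambda>n. \<integral>x. f x \<partial>\<mu> n) \<longlonglongrightarrow> (\<integral>x. f x \<partial>\<nu>))"

text \<open>Both parameters have to be positive in the limit theorem: if one of them vanishes, every
  tableau of positive weight is empty off the first diagonal, so the counts on the \<open>k\<close>-th diagonal
  vanish identically for \<open>k > 1\<close> and have no Poisson limit. The case \<open>\<beta> = 0\<close> is recorded here;
  \<open>\<alpha> = 0\<close> is its transpose.\<close>

lemma diagonal_count_eq_0_of_beta_eq_0:
  assumes S: "S \<in> stair_tableaux n" and w: "stair_weight \<alpha> 0 S \<noteq> 0" and k: "k > 1"
  shows "diagonal_count n k s S = 0"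
proof -
  have "staircase n \<subseteq> {..n + 1} \<times> {..n + 1}"
    by (auto simp: staircase_def)
  then have "finite (staircase n)"
    by (rule finite_subset) simp
  moreover have "{x. S x = Some Beta} \<subseteq> staircase n"
    using S unfolding stair_tableaux_def by blast
  ultimately have "finite {x. S x = Some Beta}"
    by (rule finite_subset[rotated])
  moreover have "card {x. S x = Some Beta} = 0"
  proof (rule ccontr)
    assume "card {x. S x = Some Beta} \<noteq> 0"
    then have "stair_weight \<alpha> 0 S = 0"
      unfolding stair_weight_def symbol_count_def by (simp only: power_0_left if_False mult_zero_right)
    with w show False ..
  qed
  ultimately have "{x. S x = Some Beta} = {}"
    by simp
  then have no_beta: "S x \<noteq> Some Beta" for x
    by blast
  have "S (i, j) = None" if "(i, j) \<in> diagonal n k" for i j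
  proof -
    have box: "(n + 1 - j, j) \<in> staircase n" "n + 1 - j + j = n + 1" and less: "i < n + 1 - j"
      using that k by (auto simp: diagonal_def staircase_def)
    have "S (n + 1 - j, j) \<noteq> None"
      using S box unfolding stair_tableaux_def by blast
    then obtain t where t: "S (n + 1 - j, j) = Some t"
      by blast
    with no_beta have "t = Alpha"
      by (cases t) auto
    with t have "S (n + 1 - j, j) = Some Alpha"
      by simp
    then show ?thesis
      using S less unfolding stair_tableaux_def by blast
  qed
  then have empty: "{x \<in> diagonal n k. S x = Some s} = {}"
    by auto
  show ?thesis
    unfolding diagonal_count_def empty by simp
qed

end

theory Submission
  imports Defs "HOL-Real_Asymp.Real_Asymp"
begin

text \<open>
  Removing the first column of a tableau of size \<open>n + 1\<close> leaves a tableau \<open>S\<close> of size \<open>n\<close>. Call a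
  row free if it contains no \<^const>\<open>Beta\<close>. The first column may be refilled by choosing any set \<open>M\<close>
  of free rows of \<open>S\<close> and any symbol for the topmost box of \<open>M \<union> {n + 1}\<close>; the other boxes of that
  set receive \<^const>\<open>Beta\<close>. Let the variable \<open>x\<close> mark free rows and let \<open>u\<close>, \<open>v\<close> mark the
  symbols on the \<open>k\<close>-th diagonal. Summing over \<open>M\<close> replaces \<open>x\<close> by \<open>x + \<beta>\<close>, up to a correction
  that comes from the one box of the new column on the \<open>k\<close>-th diagonal.

  Put \<open>x = \<beta> c\<close>, \<open>a = 1 / \<alpha>\<close>, and let \<open>E\<^sub>n(c)\<close> be the generating function divided by its value at
  \<open>u = v = 1\<close>. With \<open>N = a + c + n + 1\<close>, the recurrence is
  \<open>E\<^sub>n\<^sub>+\<^sub>1(c) = E\<^sub>n(c + 1) + (v - 1) X + (u - v) Y\<close> where, up to relative errors of order \<open>1 / c\<close>, \<open>X\<close> and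
  \<open>Y\<close> are \<open>1 / N\<close> and \<open>c / N\<^sup>2\<close> times values of \<open>E\<close> at nearby points. As \<open>N\<close> is unchanged by
  \<open>(n + 1, c) \<mapsto> (n, c + 1)\<close>, this is an Euler scheme in \<open>s = c / N\<close> for the equation
  \<open>f'(s) = ((1 - v) - (u - v) s) f(s)\<close> with \<open>f(1) = 1\<close>. Hence \<open>E\<^sub>n(1 / \<beta>)\<close>, the probability
  generating function of the two counts, tends to \<open>f(0) = exp ((u - 1) / 2 + (v - 1) / 2)\<close>, uniformly
  for bounded \<open>1 / \<alpha>\<close> and \<open>1 / \<beta>\<close>, which covers infinite parameters.
\<close>

section \<open>Decomposition by the first column\<close>

definition free_rows :: "nat \<Rightarrow> tableau \<Rightarrow> nat set" where
  "free_rows n S = {i \<in> {1..n}. \<forall>j. S (i, j) \<noteq> Some Beta}"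

text \<open>An \<open>Alpha\<close> needs empty boxes above it, so below the topmost symbol of a
  column only \<open>Beta\<close> can stand: the set of filled boxes and the topmost symbol
  determine the column. Row \<open>m\<close> is the row of the first-diagonal box, which is always
  filled.\<close>

definition stair_column :: "nat \<Rightarrow> symbol \<Rightarrow> nat set \<Rightarrow> nat \<Rightarrow> symbol option" where
  "stair_column m T M i =
     (if i \<in> insert m M then Some (if i = Min (insert m M) then T else Beta) else None)"

definition add_column :: "nat \<Rightarrow> tableau \<Rightarrow> symbol \<Rightarrow> nat set \<Rightarrow> tableau" where
  "add_column n S T M = (\<lambda>(i, j). if j = 0 then None
     else if j = 1 then stair_column (Suc n) T M i else S (i, j - 1))"

lemma free_rows_subset: "free_rows n S \<subseteq> {1..n}"
  by (auto simp: free_rows_def)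

lemma finite_free_rows [simp]: "finite (free_rows n S)"
  using finite_subset[OF free_rows_subset] by blast

lemma finite_staircase [simp]: "finite (staircase n)"
  by (rule finite_subset[of _ "{..n + 1} \<times> {..n + 1}"]) (auto simp: staircase_def)

lemma stair_tableaux_dom: "S \<in> stair_tableaux n \<Longrightarrow> S x \<noteq> None \<Longrightarrow> x \<in> staircase n"
  unfolding stair_tableaux_def by blast

lemma stair_tableauxI:
  assumes "\<And>i j. S (i, j) \<noteq> None \<Longrightarrow> (i, j) \<in> staircase n"
    and "\<And>i j. (i, j) \<in> staircase n \<Longrightarrow> i + j = n + 1 \<Longrightarrow> S (i, j) \<noteq> None"
    and "\<And>i j i'. S (i, j) = Some Alpha \<Longrightarrow> i' < i \<Longrightarrow> S (i', j) = None"
    and "\<And>i j j'. S (i, j) = Some Beta \<Longrightarrow> j' < j \<Longrightarrow> S (i, j') = None"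
  shows "S \<in> stair_tableaux n"
proof -
  have "dom S \<subseteq> staircase n"
    using assms(1) by (auto simp: dom_def)
  then show ?thesis
    unfolding stair_tableaux_def mem_Collect_eq using assms(2-4) by blast
qed

lemma finite_stair_tableaux [simp]: "finite (stair_tableaux n)"
proof (rule finite_subset)
  show "stair_tableaux n \<subseteq> {S. dom S \<subseteq> staircase n \<and> ran S \<subseteq> {Alpha, Beta}}"
  proof -
    have "s \<in> {Alpha, Beta}" for s by (cases s) auto
    then show ?thesis by (auto simp: stair_tableaux_def)
  qed
  show "finite {S. dom S \<subseteq> staircase n \<and> ran S \<subseteq> {Alpha, Beta}}"
  proof -
    have "{S. dom S \<subseteq> staircase n \<and> ran S \<subseteq> {Alpha, Beta}} = (\<Union>D\<in>Pow (staircase n). {S. dom S = D \<and> ran S \<subseteq> {Alpha, Beta}})"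
      by auto
    moreover have "finite \<dots>"
      by (intro finite_UN_I) (auto intro: finite_set_of_finite_maps finite_subset[OF _ finite_staircase])
    ultimately show ?thesis by simp
  qed
qed

lemma stair_column_bounds:
  assumes "M \<subseteq> free_rows n S"
  shows "finite (insert (Suc n) M)" "Min (insert (Suc n) M) \<in> insert (Suc n) M"
    "i \<in> M \<Longrightarrow> 1 \<le> i \<and> i \<le> n"
proof -
  show fin: "finite (insert (Suc n) M)"
    using finite_subset[OF assms] by simp
  show "Min (insert (Suc n) M) \<in> insert (Suc n) M"
    using fin by (intro Min_in) auto
  show "i \<in> M \<Longrightarrow> 1 \<le> i \<and> i \<le> n"
    using assms by (auto simp: free_rows_def)
qed

section \<open>Adding and removing the first column\<close>

text \<open>An \<open>Alpha\<close> in the new column can only be the topmost symbol there. A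
  \<open>Beta\<close> of \<open>S\<close> gets no symbol to its west, because its row is neither in
  \<open>M\<close>, which consists of free rows, nor the new row \<open>Suc n\<close>, which is
  empty in \<open>S\<close>.\<close>

lemma add_column_in_stair_tableaux:
  assumes S: "S \<in> stair_tableaux n" and M: "M \<subseteq> free_rows n S"
  shows "add_column n S T M \<in> stair_tableaux (Suc n)"
proof -
  note b = stair_column_bounds[OF M]
  define N where "N = insert (Suc n) M"
  have Nb: "1 \<le> i \<and> i \<le> Suc n" if "i \<in> N" for i
    using that b(3)[of i] by (auto simp: N_def)
  have dom: "(i, j) \<in> staircase (Suc n)" if "add_column n S T M (i, j) \<noteq> None" for i j
  proof (cases "j = 1")
    case True
    then show ?thesis using that Nb[of i]
      by (auto simp: add_column_def stair_column_def N_def staircase_def split: if_splits)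
  next
    case False
    then have "j \<ge> 2" "S (i, j - 1) \<noteq> None"
      using that by (auto simp: add_column_def split: if_splits)
    then show ?thesis
      using stair_tableaux_dom[OF S, of "(i, j - 1)"] by (auto simp: staircase_def)
  qed
  have diag: "add_column n S T M (i, j) \<noteq> None" if "(i, j) \<in> staircase (Suc n)" "i + j = Suc n + 1" for i j
  proof (cases "j = 1")
    case True
    then show ?thesis using that by (auto simp: add_column_def stair_column_def)
  next
    case False
    then have j: "j \<ge> 2" using that by (auto simp: staircase_def)
    then have "(i, j - 1) \<in> staircase n" "i + (j - 1) = n + 1"
      using that by (auto simp: staircase_def)
    then have "S (i, j - 1) \<noteq> None"
      using S unfolding stair_tableaux_def by blast
    then show ?thesis using j by (auto simp: add_column_def)
  qed
  have al: "add_column n S T M (i', j) = None" if "add_column n S T M (i, j) = Some Alpha" "i' < i" for i j i'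
  proof (cases "j = 1")
    case True
    then have "i \<in> N" "i = Min N"
      using that by (auto simp: add_column_def stair_column_def N_def split: if_splits)
    then have "i' \<notin> N"
      using that(2) b(1) Min_le[of N i'] unfolding N_def by linarith
    then show ?thesis using True by (auto simp: add_column_def stair_column_def N_def)
  next
    case False
    then have "j \<ge> 2" "S (i, j - 1) = Some Alpha"
      using that by (auto simp: add_column_def split: if_splits)
    then have "S (i', j - 1) = None"
      using S that(2) unfolding stair_tableaux_def by blast
    then show ?thesis using False by (simp add: add_column_def)
  qed
  have be: "add_column n S T M (i, j') = None" if "add_column n S T M (i, j) = Some Beta" "j' < j" for i j j'
  proof (cases "j \<le> 1")
    case True
    then show ?thesis using that(2) by (auto simp: add_column_def)
  next
    case False
    then have SB: "S (i, j - 1) = Some Beta"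
      using that by (auto simp: add_column_def split: if_splits)
    then have "i \<notin> M" using M by (auto simp: free_rows_def)
    moreover have "i \<noteq> Suc n"
      using stair_tableaux_dom[OF S, of "(i, j - 1)"] SB by (auto simp: staircase_def)
    ultimately have "stair_column (Suc n) T M i = None"
      by (auto simp: stair_column_def)
    moreover have "S (i, j' - 1) = None" if "j' \<ge> 2"
    proof -
      have "j' - 1 < j - 1" using that \<open>j' < j\<close> by simp
      then show ?thesis using S SB unfolding stair_tableaux_def by blast
    qed
    ultimately show ?thesis by (auto simp: add_column_def)
  qed
  show ?thesis
    using dom diag al be by (rule stair_tableauxI)
qed

text \<open>The new column can be read off: its filled rows give \<open>insert (Suc n) M\<close>,
  hence \<open>M\<close>, as \<open>Suc n\<close> is not in \<open>M\<close>, and the symbol in the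
  topmost of them is \<open>T\<close>.\<close>

lemma inj_add_column:
  "inj_on (\<lambda>(S, T, M). add_column n S T M)
     (SIGMA S : stair_tableaux n. UNIV \<times> Pow (free_rows n S))"
proof (rule inj_onI, clarsimp)
  fix S T M S' T' M'
  assume S: "S \<in> stair_tableaux n" "S' \<in> stair_tableaux n"
    and M: "M \<subseteq> free_rows n S" "M' \<subseteq> free_rows n S'"
    and eq: "add_column n S T M = add_column n S' T' M'"
  have col: "stair_column (Suc n) T M i = stair_column (Suc n) T' M' i" for i
    using fun_cong[OF eq, of "(i, 1)"] by (simp add: add_column_def)
  have "i \<in> insert (Suc n) M \<longleftrightarrow> i \<in> insert (Suc n) M'" for i
    using col[of i] by (auto simp: stair_column_def split: if_splits)
  then have N: "insert (Suc n) M = insert (Suc n) M'" by blast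
  moreover have "Suc n \<notin> M" "Suc n \<notin> M'"
    using M by (auto simp: free_rows_def)
  ultimately have MM: "M = M'" by (metis insert_ident)
  have "T = T'"
    using col[of "Min (insert (Suc n) M)"] stair_column_bounds(2)[OF M(1)] N
    by (auto simp: stair_column_def MM)
  moreover have "S (i, j) = S' (i, j)" for i j
  proof (cases "j = 0")
    case True
    then show ?thesis
      using stair_tableaux_dom[OF S(1), of "(i, j)"] stair_tableaux_dom[OF S(2), of "(i, j)"]
      by (force simp: staircase_def)
  next
    case False
    then show ?thesis using fun_cong[OF eq, of "(i, Suc j)"] by (simp add: add_column_def)
  qed
  then have "S = S'" by auto
  ultimately show "S = S' \<and> T = T' \<and> M = M'" using MM by simp
qed

text \<open>A row with a symbol in the first column has no \<open>Beta\<close> further east, hence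
  is free once that column is removed. In the column itself, an \<open>Alpha\<close> below the
  topmost symbol would force the topmost filled box to be empty.\<close>

lemma stair_tableaux_Suc_cases:
  assumes S: "S \<in> stair_tableaux (Suc n)"
  obtains S' T M where "S' \<in> stair_tableaux n" "M \<subseteq> free_rows n S'" "S = add_column n S' T M"
proof -
  define S' where "S' = (\<lambda>(i, j). if j = 0 then None else S (i, Suc j))"
  define N where "N = {i. S (i, 1) \<noteq> None}"
  define M where "M = N - {Suc n}"
  define T where "T = the (S (Min N, 1))"
  have S_al: "\<And>i j i'. S (i, j) = Some Alpha \<Longrightarrow> i' < i \<Longrightarrow> S (i', j) = None"
    and S_be: "\<And>i j j'. S (i, j) = Some Beta \<Longrightarrow> j' < j \<Longrightarrow> S (i, j') = None"
    and S_di: "\<And>i j. (i, j) \<in> staircase (Suc n) \<Longrightarrow> i + j = Suc n + 1 \<Longrightarrow> S (i, j) \<noteq> None"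
    using S unfolding stair_tableaux_def by blast+
  have NS: "Suc n \<in> N"
    using S_di[of "Suc n" 1] by (auto simp: N_def staircase_def)
  have Nb: "1 \<le> i \<and> i \<le> Suc n" if "i \<in> N" for i
    using stair_tableaux_dom[OF S, of "(i, 1)"] that by (auto simp: N_def staircase_def)
  have fin: "finite N"
    using Nb by (intro finite_subset[of N "{1..Suc n}"]) auto
  have ins: "insert (Suc n) M = N" using NS by (auto simp: M_def)
  have "S' \<in> stair_tableaux n"
  proof -
    have "(i, j) \<in> staircase n" if "S' (i, j) \<noteq> None" for i j
      using that stair_tableaux_dom[OF S, of "(i, Suc j)"]
      by (auto simp: S'_def staircase_def split: if_splits)
    moreover have "S' (i, j) \<noteq> None" if "(i, j) \<in> staircase n" "i + j = n + 1" for i j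
      using that S_di[of i "Suc j"] by (auto simp: S'_def staircase_def)
    moreover have "S' (i', j) = None" if "S' (i, j) = Some Alpha" "i' < i" for i j i'
      using that S_al[of i "Suc j" i'] by (auto simp: S'_def split: if_splits)
    moreover have "S' (i, j') = None" if "S' (i, j) = Some Beta" "j' < j" for i j j'
      using that S_be[of i "Suc j" "Suc j'"] by (auto simp: S'_def split: if_splits)
    ultimately show ?thesis by (rule stair_tableauxI)
  qed
  moreover have "M \<subseteq> free_rows n S'"
  proof
    fix i assume i: "i \<in> M"
    then have "1 \<le> i" "i \<le> n" using Nb[of i] by (auto simp: M_def)
    moreover have "S' (i, j) \<noteq> Some Beta" for j
      using S_be[of i "Suc j" 1] i by (auto simp: S'_def M_def N_def)
    ultimately show "i \<in> free_rows n S'" by (auto simp: free_rows_def)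
  qed
  moreover have "S (i, j) = add_column n S' T M (i, j)" for i j
  proof -
    consider "j = 0" | "j = 1" | "j \<ge> 2" by linarith
    then show ?thesis
    proof cases
      case 1
      then show ?thesis
        using stair_tableaux_dom[OF S, of "(i, j)"] by (force simp: add_column_def staircase_def)
    next
      case 2
      show ?thesis
      proof (cases "i \<in> N")
        case False
        then show ?thesis using 2 by (simp add: add_column_def stair_column_def ins) (simp add: N_def)
      next
        case True
        then obtain s where s: "S (i, 1) = Some s" by (auto simp: N_def)
        have "s = Beta" if "i \<noteq> Min N"
        proof (rule ccontr)
          assume "s \<noteq> Beta"
          then have "S (i, 1) = Some Alpha" using s by (cases s) auto
          moreover have "Min N < i" using that True fin Min_le[of N i] by linarith
          ultimately have "S (Min N, 1) = None" using S_al by blast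
          moreover have "Min N \<in> N" using True fin by (intro Min_in) auto
          ultimately show False by (simp add: N_def)
        qed
        then show ?thesis using 2 True s by (auto simp: add_column_def stair_column_def ins T_def)
      qed
    next
      case 3
      then show ?thesis by (auto simp: add_column_def S'_def)
    qed
  qed
  then have "S = add_column n S' T M" by auto
  ultimately show ?thesis using that by blast
qed

lemma sum_stair_tableaux_Suc:
  "(\<Sum>S\<in>stair_tableaux (Suc n). g S) =
   (\<Sum>S\<in>stair_tableaux n. \<Sum>T\<in>{Alpha, Beta}. \<Sum>M\<in>Pow (free_rows n S). g (add_column n S T M))"
proof -
  have UN: "(UNIV :: symbol set) = {Alpha, Beta}"
    using symbol.exhaust by blast
  have img: "(\<lambda>(S, T, M). add_column n S T M) ` (SIGMA S : stair_tableaux n. UNIV \<times> Pow (free_rows n S))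
      = stair_tableaux (Suc n)"
  proof (intro equalityI subsetI)
    fix S assume "S \<in> stair_tableaux (Suc n)"
    then obtain S' T M where "S' \<in> stair_tableaux n" "M \<subseteq> free_rows n S'" "S = add_column n S' T M"
      by (rule stair_tableaux_Suc_cases)
    then show "S \<in> (\<lambda>(S, T, M). add_column n S T M) ` (SIGMA S : stair_tableaux n. UNIV \<times> Pow (free_rows n S))"
      by (intro image_eqI[of _ _ "(S', T, M)"]) auto
  qed (use add_column_in_stair_tableaux in auto)
  have "(\<Sum>S\<in>stair_tableaux (Suc n). g S) =
    (\<Sum>(S, T, M)\<in>(SIGMA S : stair_tableaux n. UNIV \<times> Pow (free_rows n S)). g (add_column n S T M))"
    unfolding img[symmetric] by (subst sum.reindex[OF inj_add_column]) (simp add: case_prod_unfold)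
  also have "\<dots> = (\<Sum>S\<in>stair_tableaux n. \<Sum>(T, M)\<in>UNIV \<times> Pow (free_rows n S). g (add_column n S T M))"
    by (subst sum.Sigma) (auto simp: UN case_prod_unfold)
  also have "\<dots> = (\<Sum>S\<in>stair_tableaux n. \<Sum>T\<in>{Alpha, Beta}. \<Sum>M\<in>Pow (free_rows n S). g (add_column n S T M))"
    unfolding UN by (simp only: sum.cartesian_product)
  finally show ?thesis .
qed

lemma stair_tableaux_0: "stair_tableaux 0 = {\<lambda>_. None}"
proof (intro equalityI subsetI)
  fix S assume "S \<in> stair_tableaux 0"
  then have "S x = None" for x
    using stair_tableaux_dom[of S 0 x] by (cases "S x"; cases x) (auto simp: staircase_def)
  then show "S \<in> {\<lambda>_. None}" by auto
qed (auto intro!: stair_tableauxI simp: staircase_def)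

section \<open>How a new column changes the statistics\<close>

lemma card_stair_column:
  assumes "M \<subseteq> free_rows n S"
  shows "card {i. stair_column (Suc n) T M i = Some s} =
    (if s = Beta then card M + (if T = Beta then 1 else 0) else if T = Alpha then 1 else 0)"
proof -
  define N where "N = insert (Suc n) M"
  have N: "finite N" "Min N \<in> N" "Suc n \<notin> M" "finite M"
    using stair_column_bounds(1,2)[OF assms] assms by (auto simp: N_def free_rows_def)
  have cN: "card N = Suc (card M)" "card (N - {Min N}) = card M"
    using N by (auto simp: N_def)
  have "{i. stair_column (Suc n) T M i = Some s} =
      (if s = T then if s = Beta then N else {Min N} else if s = Beta then N - {Min N} else {})"
    using N(2) by (auto simp: stair_column_def N_def[symmetric] split: if_splits)
  then show ?thesis
    using cN by (cases s; cases T) auto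
qed

lemma Collect_add_column:
  assumes S: "S \<in> stair_tableaux n"
  shows "{x \<in> X. add_column n S T M x = Some s} =
     {(i, Suc j) | i j. (i, Suc j) \<in> X \<and> S (i, j) = Some s} \<union>
     {(i, 1) | i. (i, 1) \<in> X \<and> stair_column (Suc n) T M i = Some s}"
    (is "?L = ?A \<union> ?B")
    and "{(i, Suc j) | i j. (i, Suc j) \<in> X \<and> S (i, j) = Some s} \<inter>
     {(i, 1) | i. (i, 1) \<in> X \<and> stair_column (Suc n) T M i = Some s} = {}"
proof -
  have *: "S (i, 0) = None" for i
    using stair_tableaux_dom[OF S, of "(i, 0)"] by (cases "S (i, 0)") (auto simp: staircase_def)
  show "?L = ?A \<union> ?B"
  proof (intro equalityI subsetI)
    fix x assume x: "x \<in> ?L"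
    obtain i j where ij: "x = (i, j)" by fastforce
    show "x \<in> ?A \<union> ?B"
      using x ij * by (cases j; cases "j = 1") (auto simp: add_column_def)
  next
    fix x assume "x \<in> ?A \<union> ?B"
    then show "x \<in> ?L"
      using * by (auto simp: add_column_def)
  qed
  show "?A \<inter> ?B = {}"
    using * by auto
qed

text \<open>The set \<open>X\<close> is a parameter so that \<open>UNIV\<close> yields the symbol
  counts and \<open>diagonal (Suc n) k\<close> the diagonal counts.\<close>

lemma card_add_column:
  assumes S: "S \<in> stair_tableaux n" and M: "M \<subseteq> free_rows n S"
  shows "card {x \<in> X. add_column n S T M x = Some s} =
    card {(i, j). (i, Suc j) \<in> X \<and> S (i, j) = Some s} +
    card {i. (i, 1) \<in> X \<and> stair_column (Suc n) T M i = Some s}"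
proof -
  let ?A = "{(i, j). (i, Suc j) \<in> X \<and> S (i, j) = Some s}"
  let ?B = "{i. (i, 1) \<in> X \<and> stair_column (Suc n) T M i = Some s}"
  have "?A \<subseteq> staircase n"
    using stair_tableaux_dom[OF S] by auto
  then have finA: "finite ?A" by (rule finite_subset) simp
  have "?B \<subseteq> insert (Suc n) M" by (auto simp: stair_column_def split: if_splits)
  then have finB: "finite ?B"
    using stair_column_bounds(1)[OF M] by (rule finite_subset)
  have A: "{(i, Suc j) | i j. (i, Suc j) \<in> X \<and> S (i, j) = Some s} = (\<lambda>(i, j). (i, Suc j)) ` ?A"
    by auto
  have B: "{(i, 1) | i. (i, 1) \<in> X \<and> stair_column (Suc n) T M i = Some s} = (\<lambda>i. (i, 1)) ` ?B"
    by auto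
  have "card {x \<in> X. add_column n S T M x = Some s} =
      card ((\<lambda>(i, j). (i, Suc j)) ` ?A) + card ((\<lambda>i. (i, 1::nat)) ` ?B)"
    unfolding Collect_add_column(1)[OF S] A[symmetric] B[symmetric]
    by (rule card_Un_disjoint)
       (use finA finB Collect_add_column(2)[OF S, of X s T M] in \<open>simp_all only: A B finite_imageI\<close>)
  also have "\<dots> = card ?A + card ?B"
    by (subst (1 2) card_image) (auto simp: inj_on_def)
  finally show ?thesis .
qed

lemma symbol_count_add_column:
  assumes "S \<in> stair_tableaux n" "M \<subseteq> free_rows n S"
  shows "symbol_count Alpha (add_column n S T M) =
      symbol_count Alpha S + (if T = Alpha then 1 else 0)"
    and "symbol_count Beta (add_column n S T M) =
      symbol_count Beta S + card M + (if T = Beta then 1 else 0)"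
proof -
  have [simp]: "{(i, j). S (i, j) = Some s} = {x. S x = Some s}" for s
    by auto
  show "symbol_count Alpha (add_column n S T M) =
      symbol_count Alpha S + (if T = Alpha then 1 else 0)"
    "symbol_count Beta (add_column n S T M) =
      symbol_count Beta S + card M + (if T = Beta then 1 else 0)"
    using card_add_column[OF assms, of UNIV T Alpha] card_add_column[OF assms, of UNIV T Beta]
    by (simp_all add: symbol_count_def card_stair_column[OF assms(2)])
qed

text \<open>Shifting by one column carries the \<open>k\<close>-th diagonal of size \<open>n\<close>
  into that of size \<open>Suc n\<close>, whose one further box lies in the first column, in row
  \<open>n + 2 - k\<close>. If the diagonal is empty, truncation makes this row 0, where the new
  column has no symbol.\<close>

lemma diagonal_count_add_column:
  assumes "S \<in> stair_tableaux n" "M \<subseteq> free_rows n S" "k > 1"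
  shows "diagonal_count (Suc n) k s (add_column n S T M) =
    diagonal_count n k s S + (if stair_column (Suc n) T M (n + 2 - k) = Some s then 1 else 0)"
proof -
  have "{(i, j). (i, Suc j) \<in> diagonal (Suc n) k \<and> S (i, j) = Some s} = {x \<in> diagonal n k. S x = Some s}"
    using stair_tableaux_dom[OF assms(1)]
    by (force simp: diagonal_def staircase_def)
  moreover have "{i. (i, 1) \<in> diagonal (Suc n) k \<and> stair_column (Suc n) T M i = Some s} =
      (if stair_column (Suc n) T M (n + 2 - k) = Some s then {n + 2 - k} else {})"
  proof -
    have "(i, 1) \<in> diagonal (Suc n) k \<longleftrightarrow> i = n + 2 - k \<and> 1 \<le> i" for i
      using assms(3) by (auto simp: diagonal_def staircase_def)
    moreover have "1 \<le> i" if "stair_column (Suc n) T M i = Some s" for i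
      using that stair_column_bounds(3)[OF assms(2), of i] by (auto simp: stair_column_def split: if_splits)
    ultimately show ?thesis by auto
  qed
  ultimately show ?thesis
    unfolding diagonal_count_def card_add_column[OF assms(1,2)] by simp
qed

lemma free_rows_add_column:
  assumes S: "S \<in> stair_tableaux n" and M: "M \<subseteq> free_rows n S"
  shows "free_rows (Suc n) (add_column n S T M) =
    (if T = Alpha then insert (Min (insert (Suc n) M)) (free_rows n S - M) else free_rows n S - M)"
proof -
  define m where "m = Min (insert (Suc n) M)"
  have m: "m \<in> insert (Suc n) M" using stair_column_bounds(2)[OF M] by (simp add: m_def)
  have S0: "S (i, 0) = None" for i
    using stair_tableaux_dom[OF S, of "(i, 0)"] by (cases "S (i, 0)") (auto simp: staircase_def)
  have Sn: "S (Suc n, j) = None" for j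
    using stair_tableaux_dom[OF S, of "(Suc n, j)"] by (cases "S (Suc n, j)") (auto simp: staircase_def)
  have "(\<forall>j. add_column n S T M (i, j) \<noteq> Some Beta) \<longleftrightarrow>
      stair_column (Suc n) T M i \<noteq> Some Beta \<and> (\<forall>j. S (i, j) \<noteq> Some Beta)" (is "?l \<longleftrightarrow> ?c \<and> ?r") for i
  proof (intro iffI conjI allI)
    assume l: ?l
    show ?c using l[rule_format, of 1] by (simp add: add_column_def)
    show "S (i, j) \<noteq> Some Beta" for j
      using l[rule_format, of "Suc j"] S0[of i] by (cases j) (simp_all add: add_column_def)
  qed (auto simp: add_column_def)
  then have "i \<in> free_rows (Suc n) (add_column n S T M) \<longleftrightarrow>
      (i \<in> free_rows n S \<or> i = Suc n) \<and> stair_column (Suc n) T M i \<noteq> Some Beta" for i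
    using Sn by (cases "i = Suc n") (auto simp: free_rows_def)
  moreover have "stair_column (Suc n) T M i \<noteq> Some Beta \<longleftrightarrow> i \<notin> insert (Suc n) M \<or> (i = m \<and> T = Alpha)" for i
    by (cases T) (auto simp: stair_column_def m_def[symmetric])
  ultimately have *: "i \<in> free_rows (Suc n) (add_column n S T M) \<longleftrightarrow>
      (i \<in> free_rows n S \<or> i = Suc n) \<and> (i \<notin> insert (Suc n) M \<or> (i = m \<and> T = Alpha))" for i
    by blast
  have "Suc n \<notin> free_rows n S" by (auto simp: free_rows_def)
  moreover have "m \<in> free_rows n S \<or> m = Suc n" using m M by blast
  ultimately show ?thesis
    unfolding m_def[symmetric] set_eq_iff using * by (cases T) auto
qed

lemma card_free_rows_add_column:
  assumes S: "S \<in> stair_tableaux n" and M: "M \<subseteq> free_rows n S"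
  shows "card (free_rows (Suc n) (add_column n S T M)) =
    card (free_rows n S - M) + (if T = Alpha then 1 else 0)"
proof -
  have "Suc n \<notin> free_rows n S" by (auto simp: free_rows_def)
  then have "Min (insert (Suc n) M) \<notin> free_rows n S - M"
    using stair_column_bounds(2)[OF M] by auto
  then show ?thesis
    by (simp add: free_rows_add_column[OF assms])
qed

text \<open>The binomial theorem over subsets: elements of \<open>P\<close> are forced into
  \<open>M\<close>, those of \<open>Q\<close> are kept out, and each element of \<open>F\<close>
  contributes \<open>b\<close> or \<open>x\<close> independently.\<close>

lemma sum_Pow_between:
  fixes x b :: "'a :: comm_ring_1"
  assumes fin: "finite R" and R: "R = P \<union> Q \<union> F" "P \<inter> Q = {}" "P \<inter> F = {}" "Q \<inter> F = {}"
  shows "(\<Sum>M | P \<subseteq> M \<and> M \<subseteq> P \<union> F. b ^ card M * x ^ card (R - M)) =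
    b ^ card P * x ^ card Q * (x + b) ^ card F"
proof -
  have f: "finite P" "finite Q" "finite F" using fin R(1) by auto
  have img: "{M. P \<subseteq> M \<and> M \<subseteq> P \<union> F} = (\<lambda>M. P \<union> M) ` Pow F"
    using R(3) by (auto intro!: image_eqI[of _ _ "_ - P"])
  have inj: "inj_on (\<lambda>M. P \<union> M) (Pow F)"
    using R(3) by (auto simp: inj_on_def)
  have "(\<Sum>M | P \<subseteq> M \<and> M \<subseteq> P \<union> F. b ^ card M * x ^ card (R - M)) =
     (\<Sum>M\<in>Pow F. b ^ card (P \<union> M) * x ^ card (R - (P \<union> M)))"
    unfolding img by (subst sum.reindex[OF inj]) simp
  also have "\<dots> = (\<Sum>M\<in>Pow F. b ^ card P * x ^ card Q * (b ^ card M * x ^ card (F - M)))"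
  proof (rule sum.cong[OF refl])
    fix M assume "M \<in> Pow F"
    then have M: "M \<subseteq> F" "finite M" using f finite_subset by auto
    have "card (P \<union> M) = card P + card M"
      using f M R by (intro card_Un_disjoint) auto
    moreover have "R - (P \<union> M) = Q \<union> (F - M)" using M R by auto
    moreover have "card (Q \<union> (F - M)) = card Q + card (F - M)"
      using f M R by (intro card_Un_disjoint) auto
    ultimately show "b ^ card (P \<union> M) * x ^ card (R - (P \<union> M)) =
        b ^ card P * x ^ card Q * (b ^ card M * x ^ card (F - M))"
      by (simp add: power_add mult_ac)
  qed
  also have "\<dots> = b ^ card P * x ^ card Q * (x + b) ^ card F"
    using prod_add[OF f(3), of "\<lambda>_. b" "\<lambda>_. x"] by (simp add: sum_distrib_left add.commute)
  finally show ?thesis .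
qed

section \<open>Generating functions\<close>

locale tableau_pgf =
  fixes \<alpha> \<beta> u v :: real and k :: nat
  assumes pos: "\<alpha> > 0" "\<beta> > 0"
    and unit: "0 \<le> u" "u \<le> 1" "0 \<le> v" "v \<le> 1"
    and k: "k > 1"
begin

definition marked_weight :: "nat \<Rightarrow> tableau \<Rightarrow> real" where
  "marked_weight n S = stair_weight \<alpha> \<beta> S *
     (u ^ diagonal_count n k Alpha S * v ^ diagonal_count n k Beta S)"

definition gen :: "nat \<Rightarrow> real \<Rightarrow> real" where
  "gen n x = (\<Sum>S\<in>stair_tableaux n. marked_weight n S * x ^ card (free_rows n S))"

text \<open>Needed because the new column can fill its box in row \<open>r \<le> n\<close> only if
  that row is free.\<close>

definition gen_free :: "nat \<Rightarrow> nat \<Rightarrow> real \<Rightarrow> real" where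
  "gen_free n r x = (\<Sum>S\<in>stair_tableaux n.
     if r \<in> free_rows n S then marked_weight n S * x ^ card (free_rows n S) else 0)"

text \<open>Up to the factor \<^term>\<open>\<alpha> * \<beta>\<close>, this counts the columns that place \<^term>\<open>Alpha\<close> on
  the \<open>k\<close>-th diagonal.\<close>

definition gen_split :: "nat \<Rightarrow> real \<Rightarrow> real" where
  "gen_split n x = (\<Sum>S\<in>stair_tableaux n.
     if n + 2 - k \<in> free_rows n S then marked_weight n S *
       (x * x ^ card {i \<in> free_rows n S. i < n + 2 - k} *
        (x + \<beta>) ^ card {i \<in> free_rows n S. n + 2 - k < i}) else 0)"

text \<open>An \<open>Alpha\<close> at the top of the new column leaves its row free, hence the
  factor \<open>x\<close>; a \<open>Beta\<close> does not.\<close>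

definition symbol_factor :: "real \<Rightarrow> symbol \<Rightarrow> real" where
  "symbol_factor x T = (if T = Alpha then \<alpha> * x else \<beta>)"

text \<open>The factor contributed by the new box in row \<open>r\<close>; an \<open>Alpha\<close>
  can stand there only if the box is the topmost one. The comparison runs over \<open>M\<close>
  alone, as the bottom row \<open>Suc n\<close> lies below the row \<open>n + 2 - k\<close> for
  which \<open>mark\<close> is used.\<close>

definition mark :: "nat \<Rightarrow> symbol \<Rightarrow> nat set \<Rightarrow> real" where
  "mark r T M = (if r \<notin> M then 1 else if T = Alpha \<and> (\<forall>i\<in>M. r \<le> i) then u else v)"

lemma marked_weight_nonneg: "marked_weight n S \<ge> 0"
  using pos unit by (simp add: marked_weight_def stair_weight_def)

lemma mark_bounds: "0 \<le> mark r T M" "mark r T M \<le> 1"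
  using unit by (auto simp: mark_def)

lemma symbol_factor_nonneg: "x \<ge> 0 \<Longrightarrow> symbol_factor x T \<ge> 0"
  using pos by (simp add: symbol_factor_def)

text \<open>Of the \<open>card M + 1\<close> new symbols all but the topmost are
  \<open>Beta\<close>, which gives \<open>\<beta> ^ card M\<close>; the topmost one accounts for
  \<open>symbol_factor\<close>.\<close>

lemma marked_weight_add_column:
  assumes S: "S \<in> stair_tableaux n" and M: "M \<subseteq> free_rows n S"
  shows "marked_weight (Suc n) (add_column n S T M) * x ^ card (free_rows (Suc n) (add_column n S T M)) =
    marked_weight n S * (symbol_factor x T * (\<beta> ^ card M * x ^ card (free_rows n S - M)) *
      mark (n + 2 - k) T M)"
proof -
  have *: "n + 2 - k \<noteq> Suc n" using k by simp
  have fin: "finite M" using stair_column_bounds(1)[OF M] by simp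
  have "m = Min (insert (Suc n) M) \<longleftrightarrow> (\<forall>i\<in>M. m \<le> i)" if "m \<in> M" for m
  proof -
    have "m \<le> n" using stair_column_bounds(3)[OF M that] by simp
    then show ?thesis
      using that fin by (subst eq_Min_iff) auto
  qed
  then have col: "stair_column (Suc n) T M (n + 2 - k) =
      (if n + 2 - k \<notin> M then None else if T = Alpha \<and> (\<forall>i\<in>M. n + 2 - k \<le> i) then Some Alpha else Some Beta)"
    using * by (cases T) (auto simp: stair_column_def)
  show ?thesis
    unfolding marked_weight_def stair_weight_def
      symbol_count_add_column[OF assms] diagonal_count_add_column[OF assms k]
      card_free_rows_add_column[OF assms] col
    by (cases T) (auto simp: mark_def symbol_factor_def power_add)
qed

lemma sum_Pow_subset:
  fixes x b :: real
  assumes "finite R" "F \<subseteq> R"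
  shows "(\<Sum>M\<in>Pow F. b ^ card M * x ^ card (R - M)) = x ^ card (R - F) * (x + b) ^ card F"
proof -
  have "Pow F = {M. {} \<subseteq> M \<and> M \<subseteq> {} \<union> F}" by auto
  then show ?thesis
    using sum_Pow_between[of R "{}" "R - F" F b x] assms by simp blast
qed

lemma sum_columns:
  assumes "finite R" "F \<subseteq> R"
  shows "(\<Sum>T\<in>{Alpha, Beta}. \<Sum>M\<in>Pow F.
      if c then w * (symbol_factor x T * (\<beta> ^ card M * x ^ card (R - M))) else 0) =
    (\<alpha> * x + \<beta>) * (if c then w * (x ^ card (R - F) * (x + \<beta>) ^ card F) else 0)"
  unfolding sum_Pow_subset[OF assms, symmetric]
  by (cases c) (simp_all add: sum_distrib_left[symmetric] symbol_factor_def ring_distribs)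

section \<open>Recurrences for the generating functions\<close>

text \<open>\<open>mark r T M\<close> is 1, plus \<open>v - 1\<close> if \<open>r\<close> is in
  \<open>M\<close>, plus \<open>u - v\<close> if moreover \<open>T\<close> is \<open>Alpha\<close>
  and \<open>r\<close> is the least element of \<open>M\<close>. Each of the three summands leads to
  a subset sum that the binomial theorem evaluates.\<close>

lemma gen_Suc:
  assumes x: "x > 0"
  shows "gen (Suc n) x = (\<alpha> * x + \<beta>) *
      (gen n (x + \<beta>) + (v - 1) * \<beta> / (x + \<beta>) * gen_free n (n + 2 - k) (x + \<beta>)) +
      (u - v) * \<alpha> * \<beta> * gen_split n x"
proof -
  define r where "r = n + 2 - k"
  have inner: "(\<Sum>T\<in>{Alpha, Beta}. \<Sum>M\<in>Pow R. symbol_factor x T * (\<beta> ^ card M * x ^ card (R - M)) * mark r T M)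
     = (\<alpha> * x + \<beta>) * ((x + \<beta>) ^ card R +
         (v - 1) * \<beta> / (x + \<beta>) * (if r \<in> R then (x + \<beta>) ^ card R else 0)) +
       (u - v) * \<alpha> * \<beta> *
         (if r \<in> R then x * x ^ card {i \<in> R. i < r} * (x + \<beta>) ^ card {i \<in> R. r < i} else 0)"
    if R: "finite R" for R
  proof -
    define \<kappa> where "\<kappa> = (\<lambda>M. \<beta> ^ card M * x ^ card (R - M))"
    have all: "(\<Sum>M\<in>Pow R. \<kappa> M) = (x + \<beta>) ^ card R"
      unfolding \<kappa>_def using sum_Pow_subset[OF R, of R \<beta> x] by simp
    have r1: "(\<Sum>M\<in>Pow R. if r \<in> M then \<kappa> M else 0) =
        (if r \<in> R then \<beta> / (x + \<beta>) * (x + \<beta>) ^ card R else 0)"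
    proof (cases "r \<in> R")
      case True
      have "(\<Sum>M\<in>Pow R. if r \<in> M then \<kappa> M else 0) = (\<Sum>M | {r} \<subseteq> M \<and> M \<subseteq> {r} \<union> (R - {r}). \<kappa> M)"
        using R True by (intro sum.mono_neutral_cong_right) auto
      also have "\<dots> = \<beta> * (x + \<beta>) ^ card (R - {r})"
        unfolding \<kappa>_def
        by (subst sum_Pow_between[of R "{r}" "{}" "R - {r}" \<beta> x]) (use R True in auto)
      also have "\<dots> = \<beta> / (x + \<beta>) * (x + \<beta>) ^ card R"
        using x pos card_Suc_Diff1[OF R True] by (simp add: power_Suc[symmetric] divide_simps mult_ac del: power_Suc)
      finally show ?thesis using True by simp
    qed (auto intro!: sum.neutral)
    \<comment> \<open>For \<open>r\<close> to be the least element, the rows above it are kept out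
      of \<open>M\<close> and contribute \<open>x\<close> each, while the rows below it are
      unconstrained and contribute \<open>x + \<beta>\<close> each.\<close>
    have r2: "(\<Sum>M\<in>Pow R. if r \<in> M \<and> (\<forall>i\<in>M. r \<le> i) then \<kappa> M else 0) =
        (if r \<in> R then \<beta> * x ^ card {i \<in> R. i < r} * (x + \<beta>) ^ card {i \<in> R. r < i} else 0)"
    proof (cases "r \<in> R")
      case True
      have "(\<Sum>M\<in>Pow R. if r \<in> M \<and> (\<forall>i\<in>M. r \<le> i) then \<kappa> M else 0) =
          (\<Sum>M | {r} \<subseteq> M \<and> M \<subseteq> {r} \<union> {i \<in> R. r < i}. \<kappa> M)"
        using R True by (intro sum.mono_neutral_cong_right) (auto simp: le_less)
      also have "\<dots> = \<beta> * x ^ card {i \<in> R. i < r} * (x + \<beta>) ^ card {i \<in> R. r < i}"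
        unfolding \<kappa>_def
        by (subst sum_Pow_between[of R "{r}" "{i \<in> R. i < r}" "{i \<in> R. r < i}" \<beta> x]) (use R True in auto)
      finally show ?thesis using True by simp
    qed (auto intro!: sum.neutral)
    have "(\<Sum>T\<in>{Alpha, Beta}. \<Sum>M\<in>Pow R. symbol_factor x T * \<kappa> M * mark r T M) =
      (\<Sum>M\<in>Pow R. (\<alpha> * x + \<beta>) * \<kappa> M + (v - 1) * (\<alpha> * x + \<beta>) * (if r \<in> M then \<kappa> M else 0)
         + (u - v) * \<alpha> * x * (if r \<in> M \<and> (\<forall>i\<in>M. r \<le> i) then \<kappa> M else 0))"
      by (simp add: sum.distrib[symmetric] symbol_factor_def)
         (intro sum.cong refl, auto simp: mark_def algebra_simps)
    also have "\<dots> = (\<alpha> * x + \<beta>) * (\<Sum>M\<in>Pow R. \<kappa> M)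
        + (v - 1) * (\<alpha> * x + \<beta>) * (\<Sum>M\<in>Pow R. if r \<in> M then \<kappa> M else 0)
        + (u - v) * \<alpha> * x * (\<Sum>M\<in>Pow R. if r \<in> M \<and> (\<forall>i\<in>M. r \<le> i) then \<kappa> M else 0)"
      by (simp only: sum.distrib sum_distrib_left)
    also have "\<dots> = (\<alpha> * x + \<beta>) * ((x + \<beta>) ^ card R +
         (v - 1) * \<beta> / (x + \<beta>) * (if r \<in> R then (x + \<beta>) ^ card R else 0)) +
       (u - v) * \<alpha> * \<beta> *
         (if r \<in> R then x * x ^ card {i \<in> R. i < r} * (x + \<beta>) ^ card {i \<in> R. r < i} else 0)"
      unfolding all r1 r2 by (simp add: algebra_simps add_divide_distrib diff_divide_distrib)
    finally show ?thesis by (simp add: \<kappa>_def)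
  qed
  have "gen (Suc n) x = (\<Sum>S\<in>stair_tableaux n. marked_weight n S *
     (\<Sum>T\<in>{Alpha, Beta}. \<Sum>M\<in>Pow (free_rows n S). symbol_factor x T *
        (\<beta> ^ card M * x ^ card (free_rows n S - M)) * mark r T M))"
    unfolding gen_def sum_stair_tableaux_Suc sum_distrib_left r_def
    by (intro sum.cong refl marked_weight_add_column) auto
  also have "\<dots> = (\<Sum>S\<in>stair_tableaux n. (\<alpha> * x + \<beta>) * (marked_weight n S * (x + \<beta>) ^ card (free_rows n S))
      + (\<alpha> * x + \<beta>) * ((v - 1) * \<beta> / (x + \<beta>)) *
         (if r \<in> free_rows n S then marked_weight n S * (x + \<beta>) ^ card (free_rows n S) else 0)
      + (u - v) * \<alpha> * \<beta> * (if r \<in> free_rows n S then marked_weight n S *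
       (x * x ^ card {i \<in> free_rows n S. i < r} * (x + \<beta>) ^ card {i \<in> free_rows n S. r < i}) else 0))"
    by (intro sum.cong refl) (simp only: inner[OF finite_free_rows], simp add: algebra_simps)
  also have "\<dots> = (\<alpha> * x + \<beta>) * gen n (x + \<beta>) +
      (\<alpha> * x + \<beta>) * ((v - 1) * \<beta> / (x + \<beta>)) * gen_free n r (x + \<beta>) +
      (u - v) * \<alpha> * \<beta> * gen_split n x"
    unfolding gen_def gen_free_def gen_split_def r_def by (simp only: sum.distrib sum_distrib_left)
  finally show ?thesis by (simp add: r_def algebra_simps)
qed

text \<open>A row \<open>r \<le> n\<close> that is free in the enlarged tableau is free in
  \<open>S\<close>. Dropping the marks, which are at most 1, leaves the full binomial sum over
  columns.\<close>

lemma gen_free_Suc_le: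
  assumes x: "x > 0" and r: "r \<le> n"
  shows "gen_free (Suc n) r x \<le> (\<alpha> * x + \<beta>) * gen_free n r (x + \<beta>)"
proof -
  have "gen_free (Suc n) r x \<le> (\<Sum>S\<in>stair_tableaux n. \<Sum>T\<in>{Alpha, Beta}. \<Sum>M\<in>Pow (free_rows n S).
     if r \<in> free_rows n S then marked_weight n S *
       (symbol_factor x T * (\<beta> ^ card M * x ^ card (free_rows n S - M))) else 0)"
    unfolding gen_free_def sum_stair_tableaux_Suc
  proof (intro sum_mono)
    fix S T M assume S: "S \<in> stair_tableaux n" "M \<in> Pow (free_rows n S)"
    then have M: "M \<subseteq> free_rows n S" by simp
    have "r \<in> free_rows n S" if "r \<in> free_rows (Suc n) (add_column n S T M)"
      using that r stair_column_bounds(2)[OF M] M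
      unfolding free_rows_add_column[OF S(1) M] by (auto split: if_splits)
    moreover have "marked_weight n S * (symbol_factor x T * (\<beta> ^ card M * x ^ card (free_rows n S - M)) *
      mark (n + 2 - k) T M) \<le> marked_weight n S * (symbol_factor x T * (\<beta> ^ card M * x ^ card (free_rows n S - M)))"
      using pos x by (intro mult_left_mono mult_right_le_one_le mult_nonneg_nonneg symbol_factor_nonneg)
        (auto simp: mark_bounds marked_weight_nonneg)
    moreover have "0 \<le> marked_weight n S * (symbol_factor x T * (\<beta> ^ card M * x ^ card (free_rows n S - M)))"
      using pos x by (simp add: symbol_factor_nonneg marked_weight_nonneg)
    ultimately show "(if r \<in> free_rows (Suc n) (add_column n S T M)
         then marked_weight (Suc n) (add_column n S T M) *
           x ^ card (free_rows (Suc n) (add_column n S T M)) else 0)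
      \<le> (if r \<in> free_rows n S then marked_weight n S *
       (symbol_factor x T * (\<beta> ^ card M * x ^ card (free_rows n S - M))) else 0)"
      unfolding marked_weight_add_column[OF S(1) M] by auto
  qed
  also have "\<dots> = (\<Sum>S\<in>stair_tableaux n. (\<alpha> * x + \<beta>) *
     (if r \<in> free_rows n S then marked_weight n S * (x + \<beta>) ^ card (free_rows n S) else 0))"
  proof (intro sum.cong refl)
    fix S
    show "(\<Sum>T\<in>{Alpha, Beta}. \<Sum>M\<in>Pow (free_rows n S).
     if r \<in> free_rows n S then marked_weight n S *
       (symbol_factor x T * (\<beta> ^ card M * x ^ card (free_rows n S - M))) else 0) = (\<alpha> * x + \<beta>) *
     (if r \<in> free_rows n S then marked_weight n S * (x + \<beta>) ^ card (free_rows n S) else 0)"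
      by (subst sum_columns) simp_all
  qed
  also have "\<dots> = (\<alpha> * x + \<beta>) * gen_free n r (x + \<beta>)"
    by (simp add: gen_free_def sum_distrib_left)
  finally show ?thesis .
qed

text \<open>Only the columns that avoid both row \<open>r\<close> and row \<open>n + 2 - k\<close>
  are kept: they leave \<open>r\<close> free and carry mark 1. Each avoided free row costs a factor
  \<open>x / (x + \<beta>)\<close>, hence the square.\<close>

lemma gen_free_Suc_ge:
  assumes x: "x > 0" and r: "r \<le> n"
  shows "(\<alpha> * x + \<beta>) * ((x / (x + \<beta>))\<^sup>2 * gen_free n r (x + \<beta>)) \<le> gen_free (Suc n) r x"
proof -
  define F where "F = (\<lambda>S. free_rows n S - {r, n + 2 - k})"
  have "(\<alpha> * x + \<beta>) * ((x / (x + \<beta>))\<^sup>2 * gen_free n r (x + \<beta>)) =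
    (\<Sum>S\<in>stair_tableaux n. (\<alpha> * x + \<beta>) *
     (if r \<in> free_rows n S then marked_weight n S * ((x / (x + \<beta>))\<^sup>2 * (x + \<beta>) ^ card (free_rows n S)) else 0))"
    by (simp add: gen_free_def sum_distrib_left if_distrib mult_ac cong: if_cong)
  also have "\<dots> \<le> (\<Sum>S\<in>stair_tableaux n. (\<alpha> * x + \<beta>) *
     (if r \<in> free_rows n S then marked_weight n S *
        (x ^ card (free_rows n S - F S) * (x + \<beta>) ^ card (F S)) else 0))"
  proof (intro sum_mono mult_left_mono)
    fix S
    have "card (free_rows n S) = card (free_rows n S - F S) + card (F S)"
      using card_Diff_subset[of "F S" "free_rows n S"] card_mono[of "free_rows n S" "F S"]
      by (simp add: F_def)
    then have eq: "x ^ card (free_rows n S - F S) * (x + \<beta>) ^ card (F S) =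
        (x / (x + \<beta>)) ^ card (free_rows n S - F S) * (x + \<beta>) ^ card (free_rows n S)"
      using x pos by (simp add: power_add power_divide)
    have "card (free_rows n S - F S) \<le> card {r, n + 2 - k}"
      by (intro card_mono) (auto simp: F_def)
    also have "\<dots> \<le> 2" by (simp add: card_insert_if)
    finally have "(x / (x + \<beta>))\<^sup>2 \<le> (x / (x + \<beta>)) ^ card (free_rows n S - F S)"
      using x pos by (intro power_decreasing) auto
    then have "(x / (x + \<beta>))\<^sup>2 * (x + \<beta>) ^ card (free_rows n S) \<le> x ^ card (free_rows n S - F S) * (x + \<beta>) ^ card (F S)"
      unfolding eq using x pos by (intro mult_right_mono) auto
    then show "(if r \<in> free_rows n S then marked_weight n S * ((x / (x + \<beta>))\<^sup>2 * (x + \<beta>) ^ card (free_rows n S)) else 0)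
       \<le> (if r \<in> free_rows n S then marked_weight n S *
        (x ^ card (free_rows n S - F S) * (x + \<beta>) ^ card (F S)) else 0)"
      using marked_weight_nonneg by (auto intro: mult_left_mono)
    show "0 \<le> \<alpha> * x + \<beta>" using x pos by simp
  qed
  also have "\<dots> = (\<Sum>S\<in>stair_tableaux n. \<Sum>T\<in>{Alpha, Beta}. \<Sum>M\<in>Pow (F S).
     if r \<in> free_rows n S then marked_weight n S *
       (symbol_factor x T * (\<beta> ^ card M * x ^ card (free_rows n S - M))) else 0)"
  proof (intro sum.cong refl)
    fix S
    show "(\<alpha> * x + \<beta>) * (if r \<in> free_rows n S then marked_weight n S *
        (x ^ card (free_rows n S - F S) * (x + \<beta>) ^ card (F S)) else 0) =
      (\<Sum>T\<in>{Alpha, Beta}. \<Sum>M\<in>Pow (F S).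
     if r \<in> free_rows n S then marked_weight n S *
       (symbol_factor x T * (\<beta> ^ card M * x ^ card (free_rows n S - M))) else 0)"
      by (subst sum_columns) (simp_all add: F_def)
  qed
  also have "\<dots> \<le> (\<Sum>S\<in>stair_tableaux n. \<Sum>T\<in>{Alpha, Beta}. \<Sum>M\<in>Pow (free_rows n S).
     if r \<in> free_rows (Suc n) (add_column n S T M)
         then marked_weight (Suc n) (add_column n S T M) *
           x ^ card (free_rows (Suc n) (add_column n S T M)) else 0)"
  proof (rule sum_mono, rule sum_mono)
    fix S T assume S: "S \<in> stair_tableaux n"
    have "(\<Sum>M\<in>Pow (F S). if r \<in> free_rows n S then marked_weight n S *
       (symbol_factor x T * (\<beta> ^ card M * x ^ card (free_rows n S - M))) else 0) \<le>
      (\<Sum>M\<in>Pow (F S). if r \<in> free_rows (Suc n) (add_column n S T M)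
         then marked_weight (Suc n) (add_column n S T M) *
           x ^ card (free_rows (Suc n) (add_column n S T M)) else 0)"
    proof (intro sum_mono)
      fix M assume MF: "M \<in> Pow (F S)"
      then have M: "M \<subseteq> free_rows n S" by (auto simp: F_def)
      have "mark (n + 2 - k) T M = 1" using MF by (auto simp: mark_def F_def)
      moreover have "r \<in> free_rows (Suc n) (add_column n S T M)" if "r \<in> free_rows n S"
        unfolding free_rows_add_column[OF S M] using MF that by (auto simp: F_def)
      ultimately show "(if r \<in> free_rows n S then marked_weight n S *
         (symbol_factor x T * (\<beta> ^ card M * x ^ card (free_rows n S - M))) else 0) \<le>
        (if r \<in> free_rows (Suc n) (add_column n S T M)
         then marked_weight (Suc n) (add_column n S T M) *
           x ^ card (free_rows (Suc n) (add_column n S T M)) else 0)"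
        unfolding marked_weight_add_column[OF S M] using pos x
        by (auto simp: symbol_factor_nonneg marked_weight_nonneg)
    qed
    also have "\<dots> \<le> (\<Sum>M\<in>Pow (free_rows n S). if r \<in> free_rows (Suc n) (add_column n S T M)
         then marked_weight (Suc n) (add_column n S T M) *
           x ^ card (free_rows (Suc n) (add_column n S T M)) else 0)"
      using x by (intro sum_mono2) (auto simp: F_def marked_weight_nonneg)
    finally show "(\<Sum>M\<in>Pow (F S). if r \<in> free_rows n S then marked_weight n S *
       (symbol_factor x T * (\<beta> ^ card M * x ^ card (free_rows n S - M))) else 0) \<le> \<dots>" .
  qed
  also have "\<dots> = gen_free (Suc n) r x"
    unfolding gen_free_def sum_stair_tableaux_Suc ..
  finally show ?thesis .
qed

text \<open>The bottom row is free only if its symbol is \<open>Alpha\<close>. As every new symbol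
  other than the topmost is \<open>Beta\<close>, this forces \<open>M = {}\<close>.\<close>

lemma gen_free_Suc_Suc:
  "gen_free (Suc n) (Suc n) x = \<alpha> * x * gen n x"
proof -
  have nS: "Suc n \<notin> free_rows n S" for S by (auto simp: free_rows_def)
  have "gen_free (Suc n) (Suc n) x = (\<Sum>S\<in>stair_tableaux n. \<Sum>T\<in>{Alpha, Beta}. \<Sum>M\<in>Pow (free_rows n S).
     if T = Alpha \<and> M = {} then marked_weight n S * (\<alpha> * x * x ^ card (free_rows n S)) else 0)"
    unfolding gen_free_def sum_stair_tableaux_Suc
  proof (intro sum.cong refl)
    fix S T M assume S: "S \<in> stair_tableaux n" "M \<in> Pow (free_rows n S)"
    then have M: "M \<subseteq> free_rows n S" by simp
    have "Min (insert (Suc n) M) \<noteq> Suc n" if "i \<in> M" for i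
    proof -
      have "Min (insert (Suc n) M) \<le> i"
        using stair_column_bounds(1)[OF M] that by (intro Min_le) auto
      then show ?thesis using stair_column_bounds(3)[OF M that] by simp
    qed
    then have "Suc n \<in> free_rows (Suc n) (add_column n S T M) \<longleftrightarrow> T = Alpha \<and> M = {}"
      unfolding free_rows_add_column[OF S(1) M] using nS[of S] by auto
    then show "(if Suc n \<in> free_rows (Suc n) (add_column n S T M)
         then marked_weight (Suc n) (add_column n S T M) *
           x ^ card (free_rows (Suc n) (add_column n S T M)) else 0) =
      (if T = Alpha \<and> M = {} then marked_weight n S * (\<alpha> * x * x ^ card (free_rows n S)) else 0)"
      unfolding marked_weight_add_column[OF S(1) M] by (auto simp: mark_def symbol_factor_def)
  qed
  also have "\<dots> = (\<Sum>S\<in>stair_tableaux n. marked_weight n S * (\<alpha> * x * x ^ card (free_rows n S)))"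
    by (intro sum.cong refl) (simp add: sum.delta')
  finally show ?thesis
    by (simp add: gen_def sum_distrib_left mult_ac)
qed

lemma gen_0: "gen 0 x = 1"
proof -
  have "free_rows 0 S = {}" for S by (auto simp: free_rows_def)
  then show ?thesis
    by (simp add: gen_def stair_tableaux_0 marked_weight_def stair_weight_def symbol_count_def diagonal_count_def)
qed

lemma gen_free_nonneg: "x \<ge> 0 \<Longrightarrow> gen_free n r x \<ge> 0"
  unfolding gen_free_def by (intro sum_nonneg) (simp add: marked_weight_nonneg)

text \<open>The row \<open>r = n + 2 - k\<close>, if free, has at most \<open>k - 2\<close> rows
  below it, so \<open>gen_split\<close> differs from \<open>gen_free\<close> at \<open>x\<close> by
  at most a bounded power of \<open>(x + \<beta>) / x\<close>. The comparison at
  \<open>x + \<beta>\<close> serves to order the two correction terms of the recurrence.\<close>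

lemma gen_split_bounds:
  assumes x: "x > 0"
  shows "gen_free n (n + 2 - k) x \<le> gen_split n x"
    and "gen_split n x \<le> ((x + \<beta>) / x) ^ (k - 2) * gen_free n (n + 2 - k) x"
    and "gen_split n x \<le> x / (x + \<beta>) * gen_free n (n + 2 - k) (x + \<beta>)"
proof -
  define r where "r = n + 2 - k"
  define A B where "A = (\<lambda>S. card {i \<in> free_rows n S. i < r})"
    and "B = (\<lambda>S. card {i \<in> free_rows n S. r < i})"
  have card: "card (free_rows n S) = Suc (A S + B S)" "B S \<le> k - 2" if "r \<in> free_rows n S" for S
  proof -
    have "free_rows n S = insert r ({i \<in> free_rows n S. i < r} \<union> {i \<in> free_rows n S. r < i})"
      using that by auto
    also have "card \<dots> = Suc (card ({i \<in> free_rows n S. i < r} \<union> {i \<in> free_rows n S. r < i}))"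
      by (rule card_insert_disjoint) auto
    also have "\<dots> = Suc (A S + B S)"
      unfolding A_def B_def by (subst card_Un_disjoint) auto
    finally show "card (free_rows n S) = Suc (A S + B S)" .
    have "B S \<le> card {r<..n}"
      unfolding B_def by (intro card_mono) (auto simp: free_rows_def)
    also have "\<dots> \<le> k - 2"
      using that by (auto simp: r_def free_rows_def)
    finally show "B S \<le> k - 2" .
  qed
  have *: "gen_split n x = (\<Sum>S\<in>stair_tableaux n.
     if r \<in> free_rows n S then marked_weight n S * (x * x ^ A S * (x + \<beta>) ^ B S) else 0)"
    unfolding gen_split_def A_def B_def r_def ..
  show "gen_free n (n + 2 - k) x \<le> gen_split n x"
    unfolding gen_free_def * r_def[symmetric]
  proof (intro sum_mono)
    fix S
    have "marked_weight n S * (x * x ^ A S * x ^ B S) \<le> marked_weight n S * (x * x ^ A S * (x + \<beta>) ^ B S)"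
      using x pos by (intro mult_left_mono power_mono marked_weight_nonneg) auto
    then show "(if r \<in> free_rows n S then marked_weight n S * x ^ card (free_rows n S) else 0) \<le>
        (if r \<in> free_rows n S then marked_weight n S * (x * x ^ A S * (x + \<beta>) ^ B S) else 0)"
      by (simp add: card power_add)
  qed
  show "gen_split n x \<le> ((x + \<beta>) / x) ^ (k - 2) * gen_free n (n + 2 - k) x"
    unfolding gen_free_def * r_def[symmetric] sum_distrib_left
  proof (intro sum_mono)
    fix S
    have "x * x ^ A S * (x + \<beta>) ^ B S \<le> ((x + \<beta>) / x) ^ (k - 2) * x ^ card (free_rows n S)"
      if "r \<in> free_rows n S"
    proof -
      have "x * x ^ A S * (x + \<beta>) ^ B S = ((x + \<beta>) / x) ^ B S * x ^ card (free_rows n S)"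
        using x by (simp add: card[OF that] power_add power_divide)
      also have "\<dots> \<le> ((x + \<beta>) / x) ^ (k - 2) * x ^ card (free_rows n S)"
        using x pos card(2)[OF that] by (intro mult_right_mono power_increasing) auto
      finally show ?thesis .
    qed
    from mult_left_mono[OF this marked_weight_nonneg]
    show "(if r \<in> free_rows n S then marked_weight n S * (x * x ^ A S * (x + \<beta>) ^ B S) else 0) \<le>
       ((x + \<beta>) / x) ^ (k - 2) *
       (if r \<in> free_rows n S then marked_weight n S * x ^ card (free_rows n S) else 0)"
      by (simp add: mult_ac)
  qed
  show "gen_split n x \<le> x / (x + \<beta>) * gen_free n (n + 2 - k) (x + \<beta>)"
    unfolding gen_free_def * r_def[symmetric] sum_distrib_left
  proof (intro sum_mono)
    fix S
    have "x * x ^ A S * (x + \<beta>) ^ B S \<le> x / (x + \<beta>) * (x + \<beta>) ^ card (free_rows n S)"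
      if "r \<in> free_rows n S"
    proof -
      have "x * x ^ A S * (x + \<beta>) ^ B S \<le> x * (x + \<beta>) ^ A S * (x + \<beta>) ^ B S"
        using x pos by (intro mult_right_mono mult_left_mono power_mono) auto
      also have "\<dots> = x / (x + \<beta>) * (x + \<beta>) ^ card (free_rows n S)"
        using x pos by (simp add: card[OF that] power_add)
      finally show ?thesis .
    qed
    from mult_left_mono[OF this marked_weight_nonneg]
    show "(if r \<in> free_rows n S then marked_weight n S * (x * x ^ A S * (x + \<beta>) ^ B S) else 0) \<le>
       x / (x + \<beta>) *
       (if r \<in> free_rows n S then marked_weight n S * (x + \<beta>) ^ card (free_rows n S) else 0)"
      by (simp add: mult_ac)
  qed
qed

text \<open>Normalised generating functions: \<open>norm_const n c\<close> is the value of \<open>gen n (\<beta> * c)\<close> at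
  \<open>u = v = 1\<close>, and the substitution \<open>x = \<beta> * c\<close> turns the shift by \<open>\<beta>\<close> into a shift by \<open>1\<close>.\<close>

definition norm_const :: "nat \<Rightarrow> real \<Rightarrow> real" where
  "norm_const n c = (\<alpha> * \<beta>) ^ n * pochhammer (1 / \<alpha> + c) n"

definition ngen :: "nat \<Rightarrow> real \<Rightarrow> real" where
  "ngen n c = gen n (\<beta> * c) / norm_const n c"

definition nfree :: "nat \<Rightarrow> nat \<Rightarrow> real \<Rightarrow> real" where
  "nfree n r c = gen_free n r (\<beta> * c) / norm_const n c"

definition nsplit :: "nat \<Rightarrow> real \<Rightarrow> real" where
  "nsplit n c = gen_split n (\<beta> * c) / norm_const n c"

section \<open>Normalised recurrences\<close>

lemma norm_const_pos: "c > 0 \<Longrightarrow> norm_const n c > 0"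
  using pos by (simp add: norm_const_def pochhammer_pos add_pos_pos)

lemma norm_const_Suc: "norm_const (Suc n) c = \<alpha> * \<beta> * (1 / \<alpha> + c) * norm_const n (c + 1)"
  by (simp add: norm_const_def pochhammer_rec add.assoc)

lemma norm_const_Suc': "norm_const (Suc n) c = \<alpha> * \<beta> * (1 / \<alpha> + c + n) * norm_const n c"
  by (simp add: norm_const_def pochhammer_Suc)

lemma factor_eq: "\<alpha> * (\<beta> * c) + \<beta> = \<alpha> * \<beta> * (1 / \<alpha> + c)"
  using pos by (simp add: field_simps)

lemma shift_eq: "\<beta> * c + \<beta> = \<beta> * (c + 1)"
  by (simp add: algebra_simps)

lemma ngen_0: "ngen 0 c = 1"
  by (simp add: ngen_def gen_0 norm_const_def)

lemma nfree_nonneg: "c > 0 \<Longrightarrow> nfree n r c \<ge> 0"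
  using pos norm_const_pos[of c n] by (simp add: nfree_def gen_free_nonneg)

lemma ngen_nonneg: "c > 0 \<Longrightarrow> ngen n c \<ge> 0"
  using pos norm_const_pos[of c n]
  by (auto simp: ngen_def gen_def marked_weight_nonneg intro!: divide_nonneg_nonneg sum_nonneg)

text \<open>Peeling the first factor off the Pochhammer symbol moves the argument to
  \<open>c + 1\<close>, peeling off the last one keeps it at \<open>c\<close>. The first form
  normalises \<open>gen\<close> and \<open>gen_free\<close>, the second
  \<open>gen_split\<close>.\<close>

lemma ngen_Suc:
  assumes c: "c > 0"
  shows "ngen (Suc n) c = ngen n (c + 1) + (v - 1) * (nfree n (n + 2 - k) (c + 1) / (c + 1)) +
     (u - v) * (nsplit n c / (1 / \<alpha> + c + n))"
proof -
  have f: "1 / \<alpha> + c > 0" "1 / \<alpha> + c + n > 0" using c pos by (simp_all add: add_pos_pos add_pos_nonneg)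
  note nz = norm_const_pos[OF c, of n] norm_const_pos[of "c + 1" n]
  have "ngen (Suc n) c = (\<alpha> * \<beta> * (1 / \<alpha> + c)) *
      (gen n (\<beta> * (c + 1)) + (v - 1) * \<beta> / (\<beta> * (c + 1)) * gen_free n (n + 2 - k) (\<beta> * (c + 1)))
        / norm_const (Suc n) c +
      (u - v) * (\<alpha> * \<beta> * gen_split n (\<beta> * c)) / norm_const (Suc n) c"
    unfolding ngen_def using c pos
    by (subst gen_Suc) (simp_all add: factor_eq shift_eq add_divide_distrib mult.assoc)
  also have "(\<alpha> * \<beta> * (1 / \<alpha> + c)) *
      (gen n (\<beta> * (c + 1)) + (v - 1) * \<beta> / (\<beta> * (c + 1)) * gen_free n (n + 2 - k) (\<beta> * (c + 1)))
        / norm_const (Suc n) c = ngen n (c + 1) + (v - 1) * (nfree n (n + 2 - k) (c + 1) / (c + 1))"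
    unfolding norm_const_Suc ngen_def nfree_def using f nz c pos by (simp add: add_divide_distrib)
  also have "(u - v) * (\<alpha> * \<beta> * gen_split n (\<beta> * c)) / norm_const (Suc n) c =
      (u - v) * (nsplit n c / (1 / \<alpha> + c + n))"
    unfolding norm_const_Suc' nsplit_def using f nz c pos by simp
  finally show ?thesis .
qed

lemma nfree_Suc_Suc:
  assumes c: "c > 0"
  shows "nfree (Suc n) (Suc n) c = c / (1 / \<alpha> + c + n) * ngen n c"
proof -
  have "1 / \<alpha> + c + n > 0" using c pos by (simp add: add_pos_pos add_pos_nonneg)
  then show ?thesis
    unfolding nfree_def ngen_def norm_const_Suc' gen_free_Suc_Suc
    using norm_const_pos[OF c, of n] pos c by simp
qed

lemma nfree_Suc:
  assumes c: "c > 0" and r: "r \<le> n"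
  shows "nfree (Suc n) r c \<le> nfree n r (c + 1)"
    and "(c / (c + 1))\<^sup>2 * nfree n r (c + 1) \<le> nfree (Suc n) r c"
proof -
  have f: "1 / \<alpha> + c > 0" using c pos by (simp add: add_pos_pos)
  note nz = norm_const_pos[OF c, of "Suc n"] norm_const_pos[of "c + 1" n]
  have x: "\<beta> * c > 0" using c pos by simp
  have m: "\<alpha> * \<beta> * (1 / \<alpha> + c) > 0" using f pos by simp
  have "nfree (Suc n) r c \<le> \<alpha> * \<beta> * (1 / \<alpha> + c) * gen_free n r (\<beta> * (c + 1)) / norm_const (Suc n) c"
    unfolding nfree_def using gen_free_Suc_le[OF x r] nz(1)
    by (intro divide_right_mono) (simp_all add: factor_eq shift_eq)
  then show "nfree (Suc n) r c \<le> nfree n r (c + 1)"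
    unfolding nfree_def norm_const_Suc using m by (simp only: mult_divide_mult_cancel_left)
  have "\<beta> \<noteq> 0" using pos by simp
  then have q: "\<beta> * c / (\<beta> * (c + 1)) = c / (c + 1)" by (rule mult_divide_mult_cancel_left)
  have "\<alpha> * \<beta> * (1 / \<alpha> + c) * ((c / (c + 1))\<^sup>2 * gen_free n r (\<beta> * (c + 1))) / norm_const (Suc n) c \<le> nfree (Suc n) r c"
    unfolding nfree_def using gen_free_Suc_ge[OF x r] nz(1)
    by (intro divide_right_mono) (simp_all only: factor_eq shift_eq q less_imp_le)
  then show "(c / (c + 1))\<^sup>2 * nfree n r (c + 1) \<le> nfree (Suc n) r c"
    unfolding nfree_def[of n] norm_const_Suc using m by (simp only: mult_divide_mult_cancel_left times_divide_eq_right)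
qed

text \<open>Goes back to the size \<open>i\<close> at which row \<open>i\<close> is the bottom row,
  each removed column moving the argument up by one. The loss factors of the single steps
  telescope.\<close>

lemma nfree_add:
  assumes "c > 0"
  shows "nfree (i + l) i c \<le> nfree i i (c + l)"
    and "(c / (c + l))\<^sup>2 * nfree i i (c + l) \<le> nfree (i + l) i c"
  using assms
proof (induction l arbitrary: c)
  case 0
  {
    case 1
    then show ?case by simp
  next
    case 2
    then show ?case by simp
  }
next
  case (Suc l)
  {
    case 1
    have "nfree (i + Suc l) i c \<le> nfree (i + l) i (c + 1)"
      using nfree_Suc(1)[OF 1, of i "i + l"] by simp
    also have "\<dots> \<le> nfree i i (c + 1 + l)"
      using Suc(1)[of "c + 1"] 1 by simp
    finally show ?case by (simp add: ac_simps)
  next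
    case 2
    have "(c / (c + Suc l))\<^sup>2 * nfree i i (c + Suc l) =
        (c / (c + 1))\<^sup>2 * (((c + 1) / (c + 1 + l))\<^sup>2 * nfree i i (c + 1 + l))"
      using 2 by (simp add: power_divide ac_simps)
    also have "\<dots> \<le> (c / (c + 1))\<^sup>2 * nfree (i + l) i (c + 1)"
      using Suc(2)[of "c + 1"] 2 by (intro mult_left_mono) auto
    also have "\<dots> \<le> nfree (i + Suc l) i c"
      using nfree_Suc(2)[OF 2, of i "i + l"] by simp
    finally show ?case .
  }
qed

lemma nsplit_bounds:
  assumes c: "c > 0"
  shows "nfree n (n + 2 - k) c \<le> nsplit n c"
    and "nsplit n c \<le> (1 + 1 / c) ^ (k - 2) * nfree n (n + 2 - k) c"
    and "nsplit n c / (1 / \<alpha> + c + n) \<le> nfree n (n + 2 - k) (c + 1) / (c + 1)"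
proof -
  have x: "\<beta> * c > 0" using c pos by simp
  have f: "1 / \<alpha> + c > 0" "1 / \<alpha> + c + n > 0" using c pos by (simp_all add: add_pos_pos add_pos_nonneg)
  note nz = norm_const_pos[OF c, of n] norm_const_pos[of "c + 1" n] norm_const_pos[OF c, of "Suc n"]
  show "nfree n (n + 2 - k) c \<le> nsplit n c"
    unfolding nfree_def nsplit_def
    using gen_split_bounds(1)[OF x] nz(1) by (intro divide_right_mono) auto
  have q: "(\<beta> * c + \<beta>) / (\<beta> * c) = 1 + 1 / c" "\<beta> * c / (\<beta> * (c + 1)) = c / (c + 1)"
    using pos c by (simp_all add: shift_eq, simp_all add: divide_simps)
  have "nsplit n c \<le> ((1 + 1 / c) ^ (k - 2) * gen_free n (n + 2 - k) (\<beta> * c)) / norm_const n c"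
    unfolding nsplit_def using gen_split_bounds(2)[OF x, of n] nz(1)
    by (intro divide_right_mono) (auto simp: q)
  then show "nsplit n c \<le> (1 + 1 / c) ^ (k - 2) * nfree n (n + 2 - k) c"
    by (simp add: nfree_def)
  have "nsplit n c / (1 / \<alpha> + c + n) = \<alpha> * \<beta> * gen_split n (\<beta> * c) / norm_const (Suc n) c"
    unfolding norm_const_Suc' nsplit_def using f nz c pos by simp
  also have "\<dots> \<le> \<alpha> * \<beta> * (c / (c + 1) * gen_free n (n + 2 - k) (\<beta> * (c + 1))) / norm_const (Suc n) c"
    using gen_split_bounds(3)[OF x, of n] nz(3) pos
    by (intro divide_right_mono mult_left_mono) (auto simp: q shift_eq)
  also have "\<dots> = c / (1 / \<alpha> + c) * (nfree n (n + 2 - k) (c + 1) / (c + 1))"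
    unfolding norm_const_Suc nfree_def using f nz c pos by simp
  also have "\<dots> \<le> nfree n (n + 2 - k) (c + 1) / (c + 1)"
    using f c pos nfree_nonneg[of "c + 1" n "n + 2 - k"] by (intro mult_left_le_one_le) auto
  finally show "nsplit n c / (1 / \<alpha> + c + n) \<le> nfree n (n + 2 - k) (c + 1) / (c + 1)" .
qed

text \<open>Written as \<open>- (1 - v) * (X - Y) - (1 - u) * Y\<close> with
  \<open>0 \<le> Y\<close> and \<open>Y \<le> X\<close>, the correction in the recurrence is
  nonpositive.\<close>

lemma ngen_le_1: "c > 0 \<Longrightarrow> ngen n c \<le> 1"
proof (induction n arbitrary: c)
  case (Suc n)
  define X Y where "X = nfree n (n + 2 - k) (c + 1) / (c + 1)" and "Y = nsplit n c / (1 / \<alpha> + c + n)"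
  have "0 \<le> Y"
    unfolding Y_def using Suc.prems pos nsplit_bounds(1)[OF Suc.prems, of n] nfree_nonneg[OF Suc.prems, of n "n + 2 - k"]
    by (intro divide_nonneg_nonneg) auto
  moreover have "Y \<le> X" unfolding X_def Y_def by (rule nsplit_bounds(3)) fact
  moreover have "ngen (Suc n) c = ngen n (c + 1) - (1 - v) * (X - Y) - (1 - u) * Y"
    unfolding ngen_Suc[OF Suc.prems] X_def[symmetric] Y_def[symmetric] by (simp add: algebra_simps)
  moreover have "(1 - v) * (X - Y) \<ge> 0" "(1 - u) * Y \<ge> 0"
    using unit calculation by simp_all
  ultimately show ?case using Suc.IH[of "c + 1"] Suc.prems by simp
qed (simp add: ngen_0)

text \<open>Row \<open>r = n + 2 - k\<close> was the bottom row at size \<open>r\<close>, that is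
  \<open>k - 2\<close> columns earlier. Going back to that size and removing one more column
  expresses \<open>nfree n r\<close> by \<open>ngen\<close> at size \<open>n + 1 - k\<close>, up to
  factors that tend to 1 as \<open>c\<close> grows.\<close>

lemma ngen_recurrence:
  assumes c: "c > 0"
  obtains X Y where
    "ngen (Suc n) c = ngen n (c + 1) + (v - 1) * X + (u - v) * Y" "0 \<le> Y" "Y \<le> X"
    "n + 1 < k \<Longrightarrow> X = 0"
    "n + 1 \<ge> k \<Longrightarrow> X \<le> (c + k - 1) / ((c + 1) * (1 / \<alpha> + c + n)) * ngen (n + 1 - k) (c + k - 1)"
    "n + 1 \<ge> k \<Longrightarrow> (c + 1) / ((c + k - 1) * (1 / \<alpha> + c + n)) * ngen (n + 1 - k) (c + k - 1) \<le> X"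
    "n + 1 \<ge> k \<Longrightarrow> Y \<le> (1 + 1 / c) ^ (k - 2) * (c + k - 2) /
       ((1 / \<alpha> + c + n - 1) * (1 / \<alpha> + c + n)) * ngen (n + 1 - k) (c + k - 2)"
    "n + 1 \<ge> k \<Longrightarrow> c\<^sup>2 / ((c + k - 2) * (1 / \<alpha> + c + n - 1) * (1 / \<alpha> + c + n)) *
       ngen (n + 1 - k) (c + k - 2) \<le> Y"
proof
  define r where "r = n + 2 - k"
  define m where "m = n + 1 - k"
  define X Y where "X = nfree n r (c + 1) / (c + 1)" and "Y = nsplit n c / (1 / \<alpha> + c + n)"
  have f: "1 / \<alpha> + c + n > 0" using c pos by (simp_all add: add_pos_pos add_pos_nonneg)
  show "ngen (Suc n) c = ngen n (c + 1) + (v - 1) * X + (u - v) * Y"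
    unfolding X_def Y_def r_def by (rule ngen_Suc) fact
  show "0 \<le> Y"
    unfolding Y_def using f nsplit_bounds(1)[OF c, of n] nfree_nonneg[OF c, of n r]
    by (intro divide_nonneg_nonneg) (auto simp: r_def)
  show "Y \<le> X" unfolding X_def Y_def r_def by (rule nsplit_bounds(3)) fact
  \<comment> \<open>Here the new \<open>k\<close>-th diagonal is empty: truncation gives
    \<open>r = 0\<close>, which is not a row.\<close>
  show "X = 0" if "n + 1 < k"
  proof -
    have "r = 0" using that by (simp add: r_def)
    then show ?thesis by (simp add: X_def nfree_def gen_free_def free_rows_def)
  qed
  assume n: "n + 1 \<ge> k"
  have rm: "r = Suc m" "n = r + (k - 2)" "real m + real k = real n + 1" "real (k - 2) = real k - 2"
    using n k by (auto simp: r_def m_def)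
  \<comment> \<open>The argument \<open>c'\<close> is kept general: \<open>c + 1\<close> is used to
    bound \<open>X\<close>, and \<open>c\<close> to bound \<open>Y\<close>.\<close>
  have F: "nfree n r c' \<le> (c' + k - 2) / (1 / \<alpha> + c' + n - 1) * ngen m (c' + k - 2)"
    "(c' / (c' + k - 2))\<^sup>2 * ((c' + k - 2) / (1 / \<alpha> + c' + n - 1) * ngen m (c' + k - 2)) \<le> nfree n r c'"
    if c': "c' > 0" for c'
  proof -
    have p: "c' + k - 2 > 0" using c' k by simp
    have e: "1 / \<alpha> + (c' + k - 2) + m = 1 / \<alpha> + c' + n - 1" using rm by simp
    have e': "c' + real (k - 2) = c' + k - 2" using rm by simp
    show "nfree n r c' \<le> (c' + k - 2) / (1 / \<alpha> + c' + n - 1) * ngen m (c' + k - 2)"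
      using nfree_add(1)[OF c', where i = r and l = "k - 2"]
      unfolding rm(2)[symmetric] e' using nfree_Suc_Suc[OF p, of m] unfolding e rm(1)[symmetric] by simp
    show "(c' / (c' + k - 2))\<^sup>2 * ((c' + k - 2) / (1 / \<alpha> + c' + n - 1) * ngen m (c' + k - 2)) \<le> nfree n r c'"
      using nfree_add(2)[OF c', where i = r and l = "k - 2"]
      unfolding rm(2)[symmetric] e' using nfree_Suc_Suc[OF p, of m] unfolding e rm(1)[symmetric] by simp
  qed
  have c1: "c + 1 > 0" using c by simp
  have e1: "c + 1 + k - 2 = c + k - 1" "1 / \<alpha> + (c + 1) + n - 1 = 1 / \<alpha> + c + n" by simp_all
  have p1: "c + k - 1 > 0" "c + k - 2 > 0" using c k by auto
  have "n \<ge> 1" using n k by simp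
  then have f1: "1 / \<alpha> + c + n - 1 > 0" using c pos
    by (smt (verit, ccfv_SIG) divide_pos_pos of_nat_1 of_nat_mono)
  show "X \<le> (c + k - 1) / ((c + 1) * (1 / \<alpha> + c + n)) * ngen (n + 1 - k) (c + k - 1)"
    unfolding X_def m_def[symmetric] using divide_right_mono[OF F(1)[OF c1], of "c + 1"] c
    unfolding e1 by (simp add: mult_ac)
  have "((c + 1) / (c + k - 1))\<^sup>2 * ((c + k - 1) / (1 / \<alpha> + c + n) * ngen m (c + k - 1)) / (c + 1) \<le> X"
    unfolding X_def using divide_right_mono[OF F(2)[OF c1], of "c + 1"] c
    unfolding e1 by simp
  also have "((c + 1) / (c + k - 1))\<^sup>2 * ((c + k - 1) / (1 / \<alpha> + c + n) * ngen m (c + k - 1)) / (c + 1) =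
      (c + 1) / ((c + k - 1) * (1 / \<alpha> + c + n)) * ngen m (c + k - 1)"
    using p1 c1 f by (simp add: power2_eq_square)
  finally show "(c + 1) / ((c + k - 1) * (1 / \<alpha> + c + n)) * ngen (n + 1 - k) (c + k - 1) \<le> X"
    by (simp add: m_def)
  have "nsplit n c \<le> (1 + 1 / c) ^ (k - 2) * ((c + k - 2) / (1 / \<alpha> + c + n - 1) * ngen m (c + k - 2))"
    using nsplit_bounds(2)[OF c, of n] mult_left_mono[OF F(1)[OF c], of "(1 + 1 / c) ^ (k - 2)"] c
    by (simp add: r_def)
  from divide_right_mono[OF this, of "1 / \<alpha> + c + n"] f
  show "Y \<le> (1 + 1 / c) ^ (k - 2) * (c + k - 2) /
       ((1 / \<alpha> + c + n - 1) * (1 / \<alpha> + c + n)) * ngen (n + 1 - k) (c + k - 2)"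
    unfolding Y_def m_def[symmetric] by simp
  have "(c / (c + k - 2))\<^sup>2 * ((c + k - 2) / (1 / \<alpha> + c + n - 1) * ngen m (c + k - 2)) \<le> nsplit n c"
    using nsplit_bounds(1)[OF c, of n] F(2)[OF c] by (simp add: r_def)
  from divide_right_mono[OF this, of "1 / \<alpha> + c + n"] f
  have "(c / (c + k - 2))\<^sup>2 * ((c + k - 2) / (1 / \<alpha> + c + n - 1) * ngen m (c + k - 2)) / (1 / \<alpha> + c + n) \<le> Y"
    unfolding Y_def by simp
  also have "(c / (c + k - 2))\<^sup>2 * ((c + k - 2) / (1 / \<alpha> + c + n - 1) * ngen m (c + k - 2)) / (1 / \<alpha> + c + n) =
     c\<^sup>2 / ((c + k - 2) * (1 / \<alpha> + c + n - 1) * (1 / \<alpha> + c + n)) * ngen m (c + k - 2)"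
    using p1 f1 f by (simp add: power2_eq_square)
  finally show "c\<^sup>2 / ((c + k - 2) * (1 / \<alpha> + c + n - 1) * (1 / \<alpha> + c + n)) *
       ngen (n + 1 - k) (c + k - 2) \<le> Y"
    by (simp add: m_def)
qed

end

section \<open>The limit of the generating functions\<close>

text \<open>From \<open>1 - z \<le> exp (- z)\<close> follows
  \<open>exp z \<le> 1 / (1 - z)\<close>, and
  \<open>(1 + z + z\<^sup>2) * (1 - z) = 1 - z ^ 3\<close> is at least 1.\<close>

lemma exp_le_quadratic_of_nonpos:
  fixes z :: real
  assumes "z \<le> 0"
  shows "exp z \<le> 1 + z + z\<^sup>2"
proof -
  have "1 - z \<le> exp (- z)" using exp_ge_add_one_self[of "- z"] by simp
  then have "1 \<le> exp (- z) * (1 / (1 - z))" using assms by (simp add: field_simps)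
  then have "exp z \<le> exp z * (exp (- z) * (1 / (1 - z)))"
    using mult_left_mono[of 1 "exp (- z) * (1 / (1 - z))" "exp z"] by simp
  also have "\<dots> = 1 / (1 - z)"
    by (simp add: exp_minus mult.assoc[symmetric])
  also have "\<dots> \<le> 1 + z + z\<^sup>2"
  proof -
    have "z ^ 3 \<le> 0" using assms by (simp add: power_le_zero_eq)
    then have "1 \<le> (1 + z + z\<^sup>2) * (1 - z)" by (simp add: algebra_simps power2_eq_square power3_eq_cube)
    then show ?thesis using assms by (simp add: divide_le_eq)
  qed
  finally show ?thesis .
qed

lemma abs_exp_diff_le_of_nonpos:
  fixes x y :: real
  assumes "x \<le> 0" "y \<le> 0"
  shows "\<bar>exp x - exp y\<bar> \<le> \<bar>x - y\<bar>"
proof -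
  have *: "exp t - exp s \<le> t - s" if "s \<le> t" "t \<le> 0" for s t :: real
  proof -
    have "1 - exp (s - t) \<le> t - s"
      using exp_ge_add_one_self[of "s - t"] by linarith
    then have "exp t * (1 - exp (s - t)) \<le> 1 * (t - s)"
      using that by (intro mult_mono) auto
    then show ?thesis by (simp add: algebra_simps exp_diff)
  qed
  show ?thesis using *[of x y] *[of y x] assms by (cases "x \<le> y") auto
qed

text \<open>On the unit interval the convex power lies below its chord, whose slope is
  \<open>2 ^ m - 1\<close>.\<close>

lemma one_plus_power_le:
  fixes x :: real
  assumes "0 \<le> x" "x \<le> 1"
  shows "(1 + x) ^ m \<le> 1 + (2 ^ m - 1) * x"
proof (induction m)
  case (Suc m)
  have "(1 + x) ^ Suc m \<le> (1 + x) * (1 + (2 ^ m - 1) * x)"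
    using Suc assms by (simp add: mult_left_mono)
  also have "\<dots> = 1 + 2 ^ m * x + (2 ^ m - 1) * (x * x)" by (simp add: algebra_simps)
  also have "\<dots> \<le> 1 + 2 ^ m * x + (2 ^ m - 1) * x"
    using assms by (intro add_left_mono mult_left_mono) (auto simp: mult_left_le)
  finally show ?case by (simp add: algebra_simps)
qed simp

text \<open>The error bound for the recurrence has the shape \<open>B * (N ^ 5 / c ^ 6)\<close>. With \<open>N\<close> fixed, the step
  from \<open>c + 1\<close> to \<open>c\<close> leaves a slack of \<open>3 / N\<close>, of which the errors entering through \<open>X\<close> and \<open>Y\<close>
  use \<open>2 / N\<close> and the discretisation the rest.\<close>

lemma sixth_power_step:
  fixes c N :: real
  assumes "c > 0" "N \<ge> 5" "c + 2 \<le> N"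
  shows "1 / (c + 1) ^ 6 \<le> (1 - 3 / N) * (1 / c ^ 6)"
proof -
  have "1 + 6 * (1 / c) \<le> (1 + 1 / c) ^ 6"
    using Bernoulli_inequality[of "1 / c" 6] assms by (simp add: order_trans[of "- 1" 0])
  also have "\<dots> = (c + 1) ^ 6 / c ^ 6"
    using assms by (simp add: power_divide[symmetric] add_divide_distrib)
  finally have "(c + 1) ^ 6 \<ge> (1 + 6 / c) * c ^ 6"
    using assms by (simp add: pos_le_divide_eq)
  moreover have "(1 - 3 / N) * (1 + 6 / c) \<ge> 1"
  proof -
    have "3 * (c + 6) \<le> 6 * N" using assms by simp
    then show ?thesis using assms by (simp add: field_simps)
  qed
  ultimately have "1 * c ^ 6 \<le> (1 - 3 / N) * (1 + 6 / c) * c ^ 6"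
    "(1 - 3 / N) * ((1 + 6 / c) * c ^ 6) \<le> (1 - 3 / N) * (c + 1) ^ 6"
    using assms by (auto intro!: mult_right_mono mult_left_mono)
  then have "c ^ 6 \<le> (1 - 3 / N) * (c + 1) ^ 6" by (simp only: mult.assoc mult_1)
  then show ?thesis using assms by (simp add: divide_simps mult.commute)
qed

section \<open>The limit function\<close>

context tableau_pgf
begin

text \<open>The integral from 1 to \<open>s\<close> of \<open>(1 - v) - (u - v) * t\<close> in
  \<open>t\<close>, so that \<open>limit_pgf\<close> solves the limiting equation with value 1 at 1.
  The exponent at 0 is \<open>(u - 1) / 2 + (v - 1) / 2\<close>.\<close>

definition limit_exponent :: "real \<Rightarrow> real" where
  "limit_exponent s = (v - 1) * (1 - s) + (u - v) * (1 - s\<^sup>2) / 2"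

definition limit_pgf :: "real \<Rightarrow> real" where
  "limit_pgf s = exp (limit_exponent s)"

lemma limit_exponent_nonpos:
  assumes "0 \<le> s" "s \<le> 1"
  shows "limit_exponent s \<le> 0"
proof -
  have "limit_exponent s = - ((1 - s) * ((1 - v) * (1 - s) + (1 - u) * (1 + s)) / 2)"
    by (simp add: limit_exponent_def field_simps power2_eq_square)
  moreover have "(1 - v) * (1 - s) \<ge> 0" "(1 - u) * (1 + s) \<ge> 0" using assms unit by simp_all
  ultimately show ?thesis using assms by simp
qed

text \<open>The difference quotient of a quadratic polynomial is its derivative at the midpoint
  \<open>p\<close>, here a sum of two terms in the unit interval.\<close>

lemma limit_exponent_diff:
  assumes "0 \<le> s" "s \<le> 1" "0 \<le> t" "t \<le> 1"
  shows "\<bar>limit_exponent s - limit_exponent t\<bar> \<le> 2 * \<bar>s - t\<bar>"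
proof -
  define p where "p = (s + t) / 2"
  have "limit_exponent s - limit_exponent t = (s - t) * ((1 - v) * (1 - p) + (1 - u) * p)"
    by (simp add: limit_exponent_def p_def field_simps power2_eq_square)
  moreover have p: "0 \<le> p" "p \<le> 1" using assms by (auto simp: p_def)
  have "0 \<le> (1 - v) * (1 - p)" "(1 - v) * (1 - p) \<le> 1" "0 \<le> (1 - u) * p" "(1 - u) * p \<le> 1"
    using p unit by (auto intro: mult_le_one)
  then have "\<bar>(1 - v) * (1 - p) + (1 - u) * p\<bar> \<le> 2" by simp
  ultimately show ?thesis
    by (simp add: abs_mult mult.commute[of "\<bar>s - t\<bar>"] mult_right_mono)
qed

lemma limit_pgf_bounds:
  assumes "0 \<le> s" "s \<le> 1"
  shows "0 \<le> limit_pgf s" "limit_pgf s \<le> 1"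
  using limit_exponent_nonpos[OF assms] by (simp_all add: limit_pgf_def)

lemma limit_pgf_diff:
  assumes "0 \<le> s" "s \<le> 1" "0 \<le> t" "t \<le> 1"
  shows "\<bar>limit_pgf s - limit_pgf t\<bar> \<le> 2 * \<bar>s - t\<bar>"
  using abs_exp_diff_le_of_nonpos[OF limit_exponent_nonpos[OF assms(1,2)] limit_exponent_nonpos[OF assms(3,4)]]
    limit_exponent_diff[OF assms] by (simp add: limit_pgf_def)

lemma limit_pgf_1: "limit_pgf 1 = 1"
  by (simp add: limit_pgf_def limit_exponent_def)

text \<open>One Euler step from \<open>(c + 1) / N\<close> down to \<open>c / N\<close>. Linearising
  the exponential costs \<open>z\<^sup>2 \<le> 1 / N\<^sup>2\<close>; replacing the slope at the
  midpoint by the slope at \<open>c / N\<close> costs at most another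
  \<open>1 / N\<^sup>2\<close>.\<close>

lemma limit_pgf_step:
  assumes c: "0 \<le> c" "c + 1 \<le> N"
  shows "\<bar>limit_pgf (c / N) - limit_pgf ((c + 1) / N) -
     ((v - 1) / N + (u - v) * c / N\<^sup>2) * limit_pgf ((c + 1) / N)\<bar> \<le> 2 / N\<^sup>2"
proof -
  have N: "N > 0" using c by simp
  define f1 where "f1 = limit_pgf ((c + 1) / N)"
  define z where "z = limit_exponent (c / N) - limit_exponent ((c + 1) / N)"
  \<comment> \<open>The midpoint of \<open>c / N\<close> and \<open>(c + 1) / N\<close>, at which
    the slope gives \<open>z\<close> exactly.\<close>
  define t where "t = (2 * c + 1) / (2 * N)"
  have t: "0 \<le> t" "t \<le> 1" using c N by (auto simp: t_def field_simps)
  have f1: "0 \<le> f1" "f1 \<le> 1"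
    unfolding f1_def using c N by (auto intro!: limit_pgf_bounds simp: field_simps)
  have zt: "z = - ((1 - v) * (1 - t) + (1 - u) * t) / N"
    using N by (simp add: z_def limit_exponent_def t_def field_simps power2_eq_square)
  have "0 \<le> (1 - v) * (1 - t) + (1 - u) * t" using t unit by simp
  moreover have "(1 - v) * (1 - t) + (1 - u) * t \<le> 1"
  proof -
    have "(1 - v) * (1 - t) \<le> 1 * (1 - t)" "(1 - u) * t \<le> 1 * t"
      using t unit by (auto intro: mult_left_le_one_le)
    then show ?thesis by simp
  qed
  ultimately have z: "z \<le> 0" "\<bar>z\<bar> \<le> 1 / N"
    unfolding zt using N by (simp_all only: minus_divide_left[symmetric] abs_minus_cancel)
      (simp_all add: divide_right_mono)
  have z2: "z\<^sup>2 \<le> 1 / N\<^sup>2"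
    using power_mono[OF z(2), of 2] by (simp add: power_divide)
  have "limit_pgf (c / N) = f1 * exp z"
    by (simp add: limit_pgf_def f1_def z_def exp_add[symmetric])
  moreover have "\<bar>f1 * exp z - f1 * (1 + z)\<bar> \<le> 1 / N\<^sup>2"
  proof -
    have "\<bar>exp z - (1 + z)\<bar> \<le> 1 / N\<^sup>2"
      using exp_ge_add_one_self[of z] exp_le_quadratic_of_nonpos[OF z(1)] z2 by simp
    then have "f1 * \<bar>exp z - (1 + z)\<bar> \<le> 1 * (1 / N\<^sup>2)"
      using f1 by (intro mult_mono) auto
    then show ?thesis using f1 by (simp add: abs_mult right_diff_distrib[symmetric])
  qed
  moreover have "\<bar>f1 * (1 + z) - f1 - ((v - 1) / N + (u - v) * c / N\<^sup>2) * f1\<bar> \<le> 1 / N\<^sup>2"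
  proof -
    have "z - ((v - 1) / N + (u - v) * c / N\<^sup>2) = (u - v) / (2 * N\<^sup>2)"
      using N by (simp add: z_def limit_exponent_def field_simps power2_eq_square)
    then have "f1 * (1 + z) - f1 - ((v - 1) / N + (u - v) * c / N\<^sup>2) * f1 = f1 * (u - v) * (1 / (2 * N\<^sup>2))"
      by (simp add: algebra_simps)
    moreover have "\<bar>f1 * (u - v)\<bar> \<le> 1"
      unfolding abs_mult using f1 unit by (intro mult_le_one) auto
    then have "\<bar>f1 * (u - v)\<bar> * \<bar>1 / (2 * N\<^sup>2)\<bar> \<le> 1 * (1 / N\<^sup>2)"
      using N by (intro mult_mono) (auto simp: divide_simps)
    ultimately show ?thesis by (simp only: abs_mult mult_1)
  qed
  moreover have "\<bar>x - f1 - y\<bar> \<le> 2 / N\<^sup>2"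
    if "x = p" "\<bar>p - q\<bar> \<le> 1 / N\<^sup>2" "\<bar>q - f1 - y\<bar> \<le> 1 / N\<^sup>2" for x y p q
  proof -
    have "2 / N\<^sup>2 = 1 / N\<^sup>2 + 1 / N\<^sup>2" by simp
    then show ?thesis using that by linarith
  qed
  ultimately show ?thesis unfolding f1_def[symmetric] by blast
qed

section \<open>Comparison of the recurrence with the limit function\<close>

text \<open>Below size \<open>k\<close> the \<open>k\<close>-th diagonal is empty, so the recurrence
  only shifts \<open>c\<close>.\<close>

lemma ngen_eq_1: "n < k \<Longrightarrow> c > 0 \<Longrightarrow> ngen n c = 1"
proof (induction n arbitrary: c)
  case (Suc n)
  obtain X Y where "ngen (Suc n) c = ngen n (c + 1) + (v - 1) * X + (u - v) * Y" "0 \<le> Y" "Y \<le> X" "X = 0"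
    using ngen_recurrence[OF Suc.prems(2), of n] Suc.prems(1) by (metis Suc_eq_plus1)
  then show ?case using Suc by simp
qed (simp add: ngen_0)

text \<open>A crude bound that is also useful for small \<open>c\<close>: the change in one step
  lies between \<open>- X\<close> and 0, and \<open>c + k - 1 \<le> k * (c + 1)\<close> bounds
  \<open>X\<close>.\<close>

lemma ngen_step_le:
  assumes c: "c > 0"
  shows "\<bar>ngen (Suc n) c - ngen n (c + 1)\<bar> \<le> k / (1 / \<alpha> + c + n)"
proof -
  have f: "1 / \<alpha> + c + n > 0" using c pos by (simp_all add: add_pos_pos add_pos_nonneg)
  obtain X Y where XY: "ngen (Suc n) c = ngen n (c + 1) + (v - 1) * X + (u - v) * Y" "0 \<le> Y" "Y \<le> X"
    "n + 1 < k \<Longrightarrow> X = 0"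
    "n + 1 \<ge> k \<Longrightarrow> X \<le> (c + k - 1) / ((c + 1) * (1 / \<alpha> + c + n)) * ngen (n + 1 - k) (c + k - 1)"
    by (rule ngen_recurrence[OF c, of n]) blast
  have "X \<le> k / (1 / \<alpha> + c + n)"
  proof (cases "n + 1 < k")
    case True
    then show ?thesis using XY(4) f by simp
  next
    case False
    then have "X \<le> (c + k - 1) / ((c + 1) * (1 / \<alpha> + c + n)) * ngen (n + 1 - k) (c + k - 1)"
      using XY(5) by simp
    also have "\<dots> \<le> (c + k - 1) / ((c + 1) * (1 / \<alpha> + c + n)) * 1"
      using c k f by (intro mult_left_mono ngen_le_1) auto
    also have "\<dots> \<le> (k * (c + 1)) / ((c + 1) * (1 / \<alpha> + c + n))"
    proof -
      have "c \<le> k * c" using c k by simp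
      then have "c + k - 1 \<le> k * (c + 1)" by (simp add: algebra_simps)
      moreover have "0 \<le> (c + 1) * (1 / \<alpha> + c + n)" using c f by (intro mult_nonneg_nonneg) auto
      ultimately show ?thesis by (simp only: divide_right_mono mult_1_right)
    qed
    also have "\<dots> = k / (1 / \<alpha> + c + n)" using c by simp
    finally show ?thesis .
  qed
  moreover have "(v - 1) * X + (u - v) * Y = - ((1 - v) * (X - Y) + (1 - u) * Y)"
    by (simp add: algebra_simps)
  moreover have "0 \<le> (1 - v) * (X - Y)" "(1 - v) * (X - Y) \<le> 1 * (X - Y)"
      "0 \<le> (1 - u) * Y" "(1 - u) * Y \<le> 1 * Y"
    using XY(2,3) unit by (auto intro: mult_left_le_one_le)
  ultimately have "\<bar>ngen (Suc n) c - ngen n (c + 1)\<bar> \<le> 1 * (X - Y) + 1 * Y"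
    unfolding XY(1) add.assoc add_diff_cancel_left' by simp
  then show ?thesis using \<open>X \<le> k / (1 / \<alpha> + c + n)\<close> by simp
qed

lemma ngen_iterate_le:
  assumes b: "b > 0" and m: "m \<le> n" and n: "n > 1"
  shows "\<bar>ngen n b - ngen (n - m) (b + m)\<bar> \<le> m * (k / (1 / \<alpha> + b + n - 1))"
  using m
proof (induction m)
  case (Suc m)
  define d where "d = n - Suc m"
  have d: "n - m = Suc d" "real d = real n - real m - 1" using Suc.prems by (auto simp: d_def)
  have e: "1 / \<alpha> + (b + m) + d = 1 / \<alpha> + b + n - 1" using d(2) by simp
  have "\<bar>ngen (Suc d) (b + m) - ngen d (b + m + 1)\<bar> \<le> k / (1 / \<alpha> + b + n - 1)"
    using ngen_step_le[of "b + m" d] b unfolding e by simp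
  moreover have "\<bar>ngen n b - ngen (Suc d) (b + m)\<bar> \<le> m * (k / (1 / \<alpha> + b + n - 1))"
    using Suc d(1) by simp
  moreover have "real (Suc m) * q = real m * q + q" for q
    by (simp add: algebra_simps)
  moreover have "b + real (Suc m) = b + m + 1" by simp
  ultimately show ?case unfolding d_def[symmetric] by (simp only:)
qed simp

text \<open>\<open>M\<close> stands for \<open>1 / \<alpha> + c + n\<close>, and \<open>e\<close>
  for the value of \<open>ngen\<close> in the bounds for \<open>X\<close>. The quotients
  \<open>(c + k - 1) / (c + 1)\<close> and \<open>(c + 1) / (c + k - 1)\<close> are within
  \<open>k / c\<close> of 1, and \<open>1 / M - 1 / (M + 1)\<close> is at most
  \<open>1 / (c * (M + 1))\<close>.\<close>

lemma free_term_estimate: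
  fixes c M :: real
  assumes c: "c \<ge> 4" and M: "c + 1 \<le> M" and e: "0 \<le> e" "e \<le> 1"
    and X: "X \<le> (c + k - 1) / ((c + 1) * M) * e" "(c + 1) / ((c + k - 1) * M) * e \<le> X"
  shows "\<bar>X - e / (M + 1)\<bar> \<le> (2 * k + 2) / (c * (M + 1))"
proof -
  define N where "N = M + 1"
  have p: "c > 0" "M > 0" "N > 0" "c + k - 1 > 0" using c M k by (auto simp: N_def)
  have cM: "1 / M \<le> 2 / N" using p M c by (simp add: N_def field_simps)
  have "1 / M - 1 / N = 1 / M * (1 / N)" using p by (simp add: N_def field_simps)
  also have "\<dots> \<le> 1 / c * (1 / N)" using p M by (intro mult_right_mono) (auto simp: frac_le)
  finally have d: "1 / M - 1 / N \<le> 1 / (c * N)" by simp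
  have d0: "0 \<le> 1 / M - 1 / N" using p by (simp add: N_def field_simps)
  have kM: "k / (c * M) \<le> 2 * k / (c * N)"
    using mult_left_mono[OF cM, of "k / c"] p by (simp add: mult_ac)
  have "(c + k - 1) / ((c + 1) * M) \<le> 1 / M + k / (c * M)"
  proof -
    have "(c + k - 1) / (c + 1) = 1 + (real k - 2) / (c + 1)" using p by (simp add: field_simps)
    also have "(real k - 2) / (c + 1) \<le> k / c" using p k by (intro frac_le) auto
    finally have "(c + k - 1) / (c + 1) * (1 / M) \<le> (1 + k / c) * (1 / M)"
      using p by (intro mult_right_mono) auto
    then show ?thesis using p by (simp add: add_divide_distrib diff_divide_distrib distrib_right left_diff_distrib)
  qed
  moreover have s2: "(2 * k + 2) / (c * N) = 2 * k / (c * N) + 2 * (1 / (c * N))" "0 \<le> 1 / (c * N)"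
    using p by (simp_all add: add_divide_distrib)
  ultimately have u1: "(c + k - 1) / ((c + 1) * M) \<le> 1 / N + (2 * k + 2) / (c * N)"
    using d kM by linarith
  have "1 / M - k / (c * M) \<le> (c + 1) / ((c + k - 1) * M)"
  proof -
    have "(c + 1) / (c + k - 1) = 1 - (real k - 2) / (c + k - 1)" using p by (simp add: field_simps)
    moreover have "(real k - 2) / (c + k - 1) \<le> k / c" using p k by (intro frac_le) auto
    ultimately have "(1 - k / c) * (1 / M) \<le> (c + 1) / (c + k - 1) * (1 / M)"
      using p by (intro mult_right_mono) auto
    then show ?thesis using p by (simp add: add_divide_distrib diff_divide_distrib distrib_right left_diff_distrib)
  qed
  then have l1: "1 / N - (2 * k + 2) / (c * N) \<le> (c + 1) / ((c + k - 1) * M)"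
    using d0 kM s2 by linarith
  have r0: "0 \<le> (2 * k + 2) / (c * N)" using p by simp
  have re: "(2 * k + 2) / (c * N) * e \<le> (2 * k + 2) / (c * N)"
    using r0 e by (intro mult_left_le) auto
  have "X \<le> (1 / N + (2 * k + 2) / (c * N)) * e"
    using X(1) mult_right_mono[OF u1 e(1)] by linarith
  moreover have "(1 / N - (2 * k + 2) / (c * N)) * e \<le> X"
    using X(2) mult_right_mono[OF l1 e(1)] by linarith
  ultimately show ?thesis
    using re unfolding N_def[symmetric] by (simp add: abs_le_iff ring_distribs)
qed

text \<open>The errors come from the numerator, which exceeds \<open>c\<close> by at most
  \<open>W\<close> in the upper bound and falls short of it by at most \<open>k\<close> in the lower
  one, and from replacing \<open>(M - 1) * M\<close> by \<open>(M + 1)\<^sup>2\<close>.\<close>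

lemma split_term_estimate:
  fixes c M :: real
  assumes c: "c \<ge> 4" and M: "c + 1 \<le> M" and e: "0 \<le> e" "e \<le> 1"
    and Y: "Y \<le> (1 + 1 / c) ^ (k - 2) * (c + k - 2) / ((M - 1) * M) * e"
      "c\<^sup>2 / ((c + k - 2) * (M - 1) * M) * e \<le> Y"
  defines "W \<equiv> real k + 2 ^ k + 2 ^ k * real k"
  shows "\<bar>Y - c * e / (M + 1)\<^sup>2\<bar> \<le> (2 * W + 6) / (c * (M + 1))"
proof -
  define N where "N = M + 1"
  have p: "c > 0" "M > 4" "N > 5" "c + k - 2 > 0" "c \<le> N" using c M k by (auto simp: N_def)
  have W0: "W \<ge> 0" by (simp add: W_def)
  have MM: "(M - 1) * M = N\<^sup>2 - 3 * N + 2" by (simp add: N_def power2_eq_square algebra_simps)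
  have "(N - 6) * N \<ge> 0" using p M c by (simp add: N_def)
  then have half: "N\<^sup>2 \<le> 2 * ((M - 1) * M)" unfolding MM by (simp add: power2_eq_square algebra_simps)
  have pMM: "(M - 1) * M > 0" using p by simp
  have pN: "N\<^sup>2 > 0" using p by simp
  have inv: "1 / ((M - 1) * M) \<le> 2 / N\<^sup>2"
    using divide_left_mono[OF half, of 2] mult_pos_pos[OF pMM pN] by (simp add: mult.assoc)
  have inv2: "1 / ((M - 1) * M) \<le> 1 / N\<^sup>2 + 6 / (N * N\<^sup>2)"
  proof -
    have "1 / ((M - 1) * M) - 1 / N\<^sup>2 = (3 * N - 2) / N\<^sup>2 * (1 / ((M - 1) * M))"
      unfolding MM using pMM pN unfolding MM by (simp add: field_simps)
    also have "\<dots> \<le> (3 * N) / N\<^sup>2 * (2 / N\<^sup>2)"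
      using inv pN pMM p by (intro mult_mono divide_right_mono) auto
    also have "\<dots> = 6 / (N * N\<^sup>2)" using p by (simp add: power2_eq_square)
    finally show ?thesis by simp
  qed
  \<comment> \<open>\<open>W\<close> collects the terms beyond \<open>c\<close> of
    \<open>(1 + 2 ^ k / c) * (c + k)\<close>, with \<open>1 / c\<close> bounded by 1.\<close>
  have up: "(1 + 1 / c) ^ (k - 2) * (c + k - 2) \<le> c + W"
  proof -
    have "(1 + 1 / c) ^ (k - 2) \<le> 1 + (2 ^ (k - 2) - 1) * (1 / c)"
      using c by (intro one_plus_power_le) auto
    also have "\<dots> \<le> 1 + 2 ^ k * (1 / c)"
    proof -
      have "(2::real) ^ (k - 2) \<le> 2 ^ k" by (intro power_increasing) auto
      then have "(2::real) ^ (k - 2) - 1 \<le> 2 ^ k" by linarith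
      then show ?thesis using c by (intro add_left_mono mult_right_mono) auto
    qed
    finally have "(1 + 1 / c) ^ (k - 2) * (c + k - 2) \<le> (1 + 2 ^ k * (1 / c)) * (c + k)"
      using p by (intro mult_mono) auto
    also have "\<dots> = c + k + 2 ^ k + 2 ^ k * real k * (1 / c)"
      using p by (simp add: field_simps)
    also have "2 ^ k * real k * (1 / c) \<le> 2 ^ k * real k * 1"
      using c by (intro mult_left_mono) auto
    finally show ?thesis by (simp add: W_def)
  qed
  have Nc: "1 / N\<^sup>2 \<le> 1 / (c * N)"
    using p by (auto intro!: divide_left_mono simp: power2_eq_square)
  have "(1 + 1 / c) ^ (k - 2) * (c + k - 2) / ((M - 1) * M) \<le> (c + W) * (1 / ((M - 1) * M))"
    using divide_right_mono[OF up, of "(M - 1) * M"] pMM by simp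
  also have "\<dots> = c * (1 / ((M - 1) * M)) + W * (1 / ((M - 1) * M))" by (rule distrib_right)
  also have "\<dots> \<le> c * (1 / N\<^sup>2 + 6 / (N * N\<^sup>2)) + W * (2 / N\<^sup>2)"
    using inv inv2 p W0 by (intro add_mono mult_left_mono) auto
  also have "\<dots> = c / N\<^sup>2 + (c / N) * (6 / N\<^sup>2) + W * (2 / N\<^sup>2)" by (simp add: ring_distribs)
  also have "(c / N) * (6 / N\<^sup>2) \<le> 6 / N\<^sup>2"
    using p by (intro mult_left_le_one_le) auto
  also have "c / N\<^sup>2 + 6 / N\<^sup>2 + W * (2 / N\<^sup>2) = c / N\<^sup>2 + (2 * W + 6) * (1 / N\<^sup>2)"
    by (simp add: add_divide_distrib)
  also have "\<dots> \<le> c / N\<^sup>2 + (2 * W + 6) * (1 / (c * N))"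
    using Nc W0 by (intro add_left_mono mult_left_mono) auto
  finally have u1: "(1 + 1 / c) ^ (k - 2) * (c + k - 2) / ((M - 1) * M) \<le> c / N\<^sup>2 + (2 * W + 6) / (c * N)"
    by simp
  have "c - k \<le> c\<^sup>2 / (c + k - 2)"
  proof -
    have "k * k \<ge> 2 * k" using k by simp
    then have "real k * real k \<ge> 2 * real k" using of_nat_mono by fastforce
    then have "(c - k) * (c + k - 2) \<le> c\<^sup>2"
      using p by (simp add: power2_eq_square algebra_simps)
    then show ?thesis using p by (simp add: le_divide_eq)
  qed
  then have "(c - k) / N\<^sup>2 \<le> c\<^sup>2 / (c + k - 2) / N\<^sup>2"
    using p by (intro divide_right_mono) auto
  also have "\<dots> \<le> c\<^sup>2 / (c + k - 2) / ((M - 1) * M)"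
    using p pMM MM by (intro divide_left_mono) auto
  also have "\<dots> = c\<^sup>2 / ((c + k - 2) * (M - 1) * M)" by (simp add: mult_ac)
  finally have "c / N\<^sup>2 - k * (1 / N\<^sup>2) \<le> c\<^sup>2 / ((c + k - 2) * (M - 1) * M)"
    by (simp add: diff_divide_distrib)
  moreover have "k * (1 / N\<^sup>2) \<le> (2 * W + 6) * (1 / (c * N))"
  proof (intro mult_mono Nc)
    show "real k \<le> 2 * W + 6" by (simp add: W_def)
  qed (use W0 in auto)
  ultimately have l1: "c / N\<^sup>2 - (2 * W + 6) / (c * N) \<le> c\<^sup>2 / ((c + k - 2) * (M - 1) * M)"
    by simp
  have r0: "0 \<le> (2 * W + 6) / (c * N)" using p W0 by simp
  have re: "(2 * W + 6) / (c * N) * e \<le> (2 * W + 6) / (c * N)"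
    using r0 e by (intro mult_left_le) auto
  have "Y \<le> (c / N\<^sup>2 + (2 * W + 6) / (c * N)) * e"
    using Y(1) mult_right_mono[OF u1 e(1)] by linarith
  moreover have "(c / N\<^sup>2 - (2 * W + 6) / (c * N)) * e \<le> Y"
    using Y(2) mult_right_mono[OF l1 e(1)] by linarith
  ultimately show ?thesis
    using re unfolding N_def[symmetric] by (simp add: abs_le_iff ring_distribs)
qed

text \<open>The coefficients of \<open>1 / (c * N)\<close> in the error of one step, with
  \<open>W = k + 2 ^ k + 2 ^ k * k\<close>: \<open>6 * k + 2\<close> from \<open>X\<close>,
  \<open>2 * W + 6 + 4 * (k + 1)\<close> from \<open>Y\<close>, and 2 from the Euler step.\<close>

definition step_const :: real where
  "step_const = 10 * k + 14 + 2 * (k + 2 ^ k + 2 ^ k * k)"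

text \<open>The additional \<open>2 / \<alpha> + 2 * k\<close> covers the starting sizes
  \<open>n < k\<close>.\<close>

definition error_const :: real where
  "error_const = step_const + 2 / \<alpha> + 2 * k"

lemma step_const_bounds: "0 \<le> step_const" "step_const \<le> error_const" "2 / \<alpha> + 2 * k \<le> error_const"
  using pos by (auto simp: step_const_def error_const_def)

text \<open>The induction step in abstract form: \<open>E\<close> is the value of
  \<open>ngen\<close> at argument \<open>c + 1\<close>, while \<open>e1\<close> and
  \<open>e2\<close> are the values in the bounds for \<open>X\<close> and \<open>Y\<close>. The
  latter enter with coefficients of order at most \<open>1 / N\<close>, so it suffices to compare
  them with the limit function at \<open>(c + 1) / N\<close>, which is at distance of order
  \<open>1 / N\<close> from their own points.\<close>

lemma ngen_approx_step:
  fixes c M :: real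
  defines "N \<equiv> M + 1"
  assumes c: "c \<ge> 4" and M: "c + 1 \<le> M" "k \<le> M - c + 1"
    and rec: "E' = E + (v - 1) * X + (u - v) * Y"
    and E: "\<bar>E - limit_pgf ((c + 1) / N)\<bar> \<le> error_const * (N ^ 5 / (c + 1) ^ 6)"
    and e1: "0 \<le> e1" "e1 \<le> 1" "\<bar>e1 - limit_pgf ((c + k - 1) / M)\<bar> \<le> error_const * (M ^ 5 / (c + k - 1) ^ 6)"
    and e2: "0 \<le> e2" "e2 \<le> 1" "\<bar>e2 - limit_pgf ((c + k - 2) / (M - 1))\<bar> \<le> error_const * ((M - 1) ^ 5 / (c + k - 2) ^ 6)"
    and X: "X \<le> (c + k - 1) / ((c + 1) * M) * e1" "(c + 1) / ((c + k - 1) * M) * e1 \<le> X"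
    and Y: "Y \<le> (1 + 1 / c) ^ (k - 2) * (c + k - 2) / ((M - 1) * M) * e2"
      "c\<^sup>2 / ((c + k - 2) * (M - 1) * M) * e2 \<le> Y"
  shows "\<bar>E' - limit_pgf (c / N)\<bar> \<le> error_const * (N ^ 5 / c ^ 6)"
proof -
  define B where "B = error_const"
  define f1 where "f1 = limit_pgf ((c + 1) / N)"
  define W where "W = real k + 2 ^ k + 2 ^ k * real k"
  define D where "D = 1 / (c * N)"
  define \<Phi> where "\<Phi> = B * (N ^ 5 / c ^ 6)"
  have B: "step_const \<le> B" "0 \<le> B" using step_const_bounds by (auto simp: B_def)
  have p: "c > 0" "N \<ge> 6" "c + 2 \<le> N" "M = N - 1" "k \<ge> 2" using c M k by (auto simp: N_def)
  have ND: "1 / N\<^sup>2 \<le> D"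
    using p by (auto intro!: divide_left_mono simp: D_def power2_eq_square)
  have D0: "D \<ge> 0" using p by (simp add: D_def)
  have s: "0 \<le> (c + 1) / N" "(c + 1) / N \<le> 1" "0 \<le> (c + k - 1) / M" "(c + k - 1) / M \<le> 1"
     "0 \<le> (c + k - 2) / (M - 1)" "(c + k - 2) / (M - 1) \<le> 1"
    using p M by (auto simp: divide_le_eq_1)
  \<comment> \<open>The error bound grows with \<open>n\<close> and shrinks with \<open>d\<close>,
    so the errors of \<open>e1\<close> and \<open>e2\<close> are at most the target bound
    \<open>\<Phi>\<close>.\<close>
  have mono: "error_const * (n ^ 5 / d ^ 6) \<le> \<Phi>" if "0 \<le> n" "n \<le> N" "c \<le> d" for n d
    using that p B(2) unfolding \<Phi>_def B_def by (intro mult_left_mono frac_le power_mono) auto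
  have d1: "\<bar>(c + k - 1) / M - (c + 1) / N\<bar> \<le> 2 * k / N"
  proof -
    have "(c + k - 1) / M - (c + 1) / N = ((real k - 2) + (c + 1) / N) / M"
      unfolding p(4) using p(1-3,5) by (simp add: divide_simps) (simp add: algebra_simps)
    moreover have "0 \<le> ((real k - 2) + (c + 1) / N) / M" using s p by simp
    moreover have "((real k - 2) + (c + 1) / N) / M \<le> k / M"
      using s(2) p by (intro divide_right_mono) linarith+
    moreover have "k / M \<le> 2 * k / N" using p by (simp add: field_simps)
    ultimately show ?thesis by linarith
  qed
  have d2: "\<bar>(c + k - 2) / (M - 1) - (c + 1) / N\<bar> \<le> 2 * (k + 1) / N"
  proof -
    have "(c + k - 2) / (M - 1) - (c + 1) / N = ((real k - 3) + 2 * ((c + 1) / N)) / (M - 1)"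
      unfolding p(4) using p(1-3,5) by (simp add: divide_simps) (simp add: algebra_simps)
    moreover have "\<bar>((real k - 3) + 2 * ((c + 1) / N)) / (M - 1)\<bar> \<le> (k + 1) / (M - 1)"
      unfolding abs_divide
    proof (intro frac_le)
      show "\<bar>(real k - 3) + 2 * ((c + 1) / N)\<bar> \<le> real (k + 1)"
        using s(1,2) p(5) by linarith
    qed (use p in auto)
    moreover have "(k + 1) / (M - 1) \<le> 2 * (k + 1) / N"
    proof -
      have "1 / (M - 1) \<le> 2 / N" using p by (simp add: field_simps)
      from mult_left_mono[OF this, of "real (k + 1)"] show ?thesis by (simp add: mult_ac)
    qed
    ultimately show ?thesis by linarith
  qed
  have E1: "\<bar>e1 - f1\<bar> \<le> \<Phi> + 4 * k / N"
  proof -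
    have "\<bar>e1 - limit_pgf ((c + k - 1) / M)\<bar> \<le> \<Phi>"
      using e1(3) mono[of M "c + k - 1"] p by simp
    moreover have "\<bar>limit_pgf ((c + k - 1) / M) - f1\<bar> \<le> 2 * (2 * k / N)"
      unfolding f1_def by (rule order_trans[OF limit_pgf_diff[OF s(3,4,1,2)] mult_left_mono[OF d1]]) simp
    ultimately show ?thesis by simp
  qed
  have E2: "\<bar>e2 - f1\<bar> \<le> \<Phi> + 4 * (k + 1) / N"
  proof -
    have "\<bar>e2 - limit_pgf ((c + k - 2) / (M - 1))\<bar> \<le> \<Phi>"
      using e2(3) mono[of "M - 1" "c + k - 2"] p by simp
    moreover have "\<bar>limit_pgf ((c + k - 2) / (M - 1)) - f1\<bar> \<le> 2 * (2 * (k + 1) / N)"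
      unfolding f1_def by (rule order_trans[OF limit_pgf_diff[OF s(5,6,1,2)] mult_left_mono[OF d2]]) simp
    ultimately show ?thesis by simp
  qed
  have X': "\<bar>X - f1 / N\<bar> \<le> (6 * k + 2) * D + \<Phi> / N"
  proof -
    have "\<bar>X - e1 / N\<bar> \<le> (2 * k + 2) * D"
      unfolding N_def D_def using free_term_estimate[OF c M(1) e1(1,2) X] by simp
    moreover have "\<bar>e1 / N - f1 / N\<bar> \<le> \<Phi> / N + 4 * k * (1 / N\<^sup>2)"
      using divide_right_mono[OF E1, of N] p
      by (simp add: diff_divide_distrib[symmetric] abs_divide add_divide_distrib power2_eq_square)
    moreover have "4 * k * (1 / N\<^sup>2) \<le> 4 * k * D" using ND by (intro mult_left_mono) auto
    moreover have "(6 * k + 2) * D = (2 * k + 2) * D + 4 * k * D" by (simp add: algebra_simps)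
    ultimately show ?thesis by linarith
  qed
  have Y': "\<bar>Y - c * f1 / N\<^sup>2\<bar> \<le> (2 * W + 6 + 4 * (k + 1)) * D + \<Phi> / N"
  proof -
    have "\<bar>Y - c * e2 / N\<^sup>2\<bar> \<le> (2 * W + 6) * D"
      unfolding N_def D_def W_def using split_term_estimate[OF c M(1) e2(1,2) Y] by simp
    moreover have "\<bar>c * e2 / N\<^sup>2 - c * f1 / N\<^sup>2\<bar> \<le> \<Phi> / N + 4 * (k + 1) * (1 / N\<^sup>2)"
    proof -
      have "\<bar>c * e2 / N\<^sup>2 - c * f1 / N\<^sup>2\<bar> = c / N\<^sup>2 * \<bar>e2 - f1\<bar>"
        using p by (simp add: diff_divide_distrib[symmetric] right_diff_distrib[symmetric] abs_mult abs_divide)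
      also have "\<dots> \<le> N / N\<^sup>2 * (\<Phi> + 4 * (k + 1) / N)"
        using E2 p by (intro mult_mono divide_right_mono) auto
      also have "\<dots> = \<Phi> / N + 4 * (k + 1) * (1 / N\<^sup>2)"
        using p by (simp add: power2_eq_square field_simps)
      finally show ?thesis .
    qed
    moreover have "4 * (k + 1) * (1 / N\<^sup>2) \<le> 4 * (k + 1) * D" using ND by (intro mult_left_mono) auto
    moreover have "(2 * W + 6 + 4 * (k + 1)) * D = (2 * W + 6) * D + 4 * (k + 1) * D" by (simp add: algebra_simps)
    ultimately show ?thesis by linarith
  qed
  have f: "\<bar>limit_pgf (c / N) - f1 - ((v - 1) / N + (u - v) * c / N\<^sup>2) * f1\<bar> \<le> 2 * D"
    using limit_pgf_step[of c N] p ND unfolding f1_def by simp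
  have "\<bar>E - f1\<bar> \<le> (1 - 3 / N) * \<Phi>"
  proof -
    have "\<bar>E - f1\<bar> \<le> B * N ^ 5 * (1 / (c + 1) ^ 6)"
      using E by (simp add: f1_def B_def)
    also have "\<dots> \<le> B * N ^ 5 * ((1 - 3 / N) * (1 / c ^ 6))"
      using sixth_power_step[of c N] p B by (intro mult_left_mono) auto
    finally show ?thesis by (simp add: \<Phi>_def mult_ac)
  qed
  moreover have "E' - limit_pgf (c / N) = (E - f1) - (1 - v) * (X - f1 / N) + (u - v) * (Y - c * f1 / N\<^sup>2)
      - (limit_pgf (c / N) - f1 - ((v - 1) / N + (u - v) * c / N\<^sup>2) * f1)"
    unfolding rec by (simp add: algebra_simps diff_divide_distrib)
  moreover have "\<bar>(1 - v) * (X - f1 / N)\<bar> \<le> (6 * k + 2) * D + \<Phi> / N"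
    using X' unit by (auto simp: abs_mult intro: order_trans[OF mult_left_le_one_le])
  moreover have "\<bar>(u - v) * (Y - c * f1 / N\<^sup>2)\<bar> \<le> (2 * W + 6 + 4 * (k + 1)) * D + \<Phi> / N"
    using Y' unit by (auto simp: abs_mult intro!: order_trans[OF mult_left_le_one_le])
  \<comment> \<open>The letters of this triangle inequality are bound locally and unrelated to
    \<open>B\<close> and \<open>D\<close> above.\<close>
  moreover have "\<bar>y\<bar> \<le> A + B + C + D"
    if "\<bar>p\<bar> \<le> A" "y = p - q + r - t" "\<bar>q\<bar> \<le> B" "\<bar>r\<bar> \<le> C" "\<bar>t\<bar> \<le> D" for y p q r t A B C D :: real
    using that by linarith
  ultimately have "\<bar>E' - limit_pgf (c / N)\<bar> \<le> (1 - 3 / N) * \<Phi> + ((6 * k + 2) * D + \<Phi> / N)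
     + ((2 * W + 6 + 4 * (k + 1)) * D + \<Phi> / N) + 2 * D"
    using f by blast
  also have "\<dots> = \<Phi> - \<Phi> / N + step_const * D"
    by (simp add: step_const_def W_def algebra_simps)
  \<comment> \<open>Since \<open>c \<le> N\<close> gives \<open>1 / c \<le> N ^ 5 / c ^ 6\<close>,
    the remaining \<open>\<Phi> / N\<close> absorbs the discretisation errors.\<close>
  also have "step_const * D \<le> \<Phi> / N"
  proof -
    have "c ^ 5 \<le> N ^ 5" using p by (intro power_mono) auto
    then have "c ^ 5 / c ^ 6 \<le> N ^ 5 / c ^ 6" using p by (intro divide_right_mono) auto
    moreover have "c ^ 5 / c ^ 6 = 1 / c" using p by (simp add: eval_nat_numeral)
    ultimately have "step_const * (1 / c) \<le> \<Phi>"
      unfolding \<Phi>_def using B p step_const_bounds by (intro mult_mono) auto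
    from divide_right_mono[OF this, of N] p show ?thesis by (simp add: D_def)
  qed
  finally show ?thesis by (simp add: \<Phi>_def B_def)
qed

text \<open>The induction is strong because \<open>X\<close> and \<open>Y\<close> for size
  \<open>n\<close> involve \<open>ngen\<close> at size \<open>n - k\<close>. For
  \<open>n < k\<close> the value is 1, as is the limit function at 1, and the Lipschitz bound
  suffices.\<close>

lemma ngen_approx:
  assumes "c \<ge> 4"
  shows "\<bar>ngen n c - limit_pgf (c / (1 / \<alpha> + c + n))\<bar> \<le> error_const * ((1 / \<alpha> + c + n) ^ 5 / c ^ 6)"
  using assms
proof (induction n arbitrary: c rule: less_induct)
  case (less n c)
  have c: "c > 0" using less.prems by simp
  have a: "1 / \<alpha> > 0" using pos by simp
  define N where "N = 1 / \<alpha> + c + n"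
  have N: "N > 0" "c \<le> N" using c a unfolding N_def by linarith+
  show ?case
  proof (cases "n < k")
    case True
    have s: "0 \<le> c / N" "c / N \<le> 1" using N c by auto
    have "\<bar>ngen n c - limit_pgf (c / N)\<bar> \<le> 2 * \<bar>1 - c / N\<bar>"
      using ngen_eq_1[OF True c] limit_pgf_diff[of 1 "c / N"] s by (simp add: limit_pgf_1)
    also have "\<dots> = (2 / \<alpha> + 2 * n) * (1 / N)"
    proof -
      have "1 - c / N = (1 / \<alpha> + n) / N" using N by (simp add: N_def field_simps)
      moreover have "(1 / \<alpha> + n) / N \<ge> 0" using N a by simp
      ultimately show ?thesis by (simp add: add_divide_distrib)
    qed
    also have "\<dots> \<le> error_const * (N ^ 5 / c ^ 6)"
    proof (intro mult_mono)
      show "2 / \<alpha> + 2 * n \<le> error_const"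
        using step_const_bounds(3) True by simp
      have "c ^ 6 \<le> N ^ 6" using N c by (intro power_mono) auto
      then have "1 / N * c ^ 6 \<le> N ^ 5" using N by (simp add: divide_le_eq eval_nat_numeral mult_ac)
      then show "1 / N \<le> N ^ 5 / c ^ 6" using c by (simp add: le_divide_eq)
      show "0 \<le> error_const" using step_const_bounds by simp
      show "0 \<le> 1 / N" using N by simp
    qed
    finally show ?thesis by (simp add: N_def)
  next
    case False
    then obtain n' where n: "n = Suc n'" using k by (cases n) auto
    define M where "M = 1 / \<alpha> + c + n'"
    have n': "n' + 1 \<ge> k" "n' \<ge> 1" using False n k by auto
    have n'r: "real n' + 1 \<ge> real k" "real n' \<ge> 1" using n' by linarith+
    have NM: "N = M + 1" by (simp add: N_def M_def n)
    obtain X Y where XY: "ngen (Suc n') c = ngen n' (c + 1) + (v - 1) * X + (u - v) * Y"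
      "n' + 1 \<ge> k \<Longrightarrow> X \<le> (c + k - 1) / ((c + 1) * M) * ngen (n' + 1 - k) (c + k - 1)"
      "n' + 1 \<ge> k \<Longrightarrow> (c + 1) / ((c + k - 1) * M) * ngen (n' + 1 - k) (c + k - 1) \<le> X"
      "n' + 1 \<ge> k \<Longrightarrow> Y \<le> (1 + 1 / c) ^ (k - 2) * (c + k - 2) / ((M - 1) * M) * ngen (n' + 1 - k) (c + k - 2)"
      "n' + 1 \<ge> k \<Longrightarrow> c\<^sup>2 / ((c + k - 2) * (M - 1) * M) * ngen (n' + 1 - k) (c + k - 2) \<le> Y"
      unfolding M_def by (rule ngen_recurrence[OF c, of n']) blast
    have "\<bar>ngen (Suc n') c - limit_pgf (c / (M + 1))\<bar> \<le> error_const * ((M + 1) ^ 5 / c ^ 6)"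
    proof (rule ngen_approx_step[OF less.prems _ _ XY(1) _ _ _ _ _ _ _ XY(2,3)[OF n'(1)] XY(4,5)[OF n'(1)]])
      show "c + 1 \<le> M" "k \<le> M - c + 1" using a n'r unfolding M_def by linarith+
      \<comment> \<open>The sum of \<open>1 / \<alpha>\<close>, argument and size is still
        \<open>N\<close> for the shifted term; it drops by 1 and by 2 for the values in
        \<open>X\<close> and \<open>Y\<close>.\<close>
      have e: "1 / \<alpha> + (c + 1) + n' = M + 1"
        "1 / \<alpha> + (c + k - 1) + (n' + 1 - k) = M"
        "1 / \<alpha> + (c + k - 2) + (n' + 1 - k) = M - 1"
        using n'(1) by (auto simp: M_def of_nat_diff)
      show "\<bar>ngen n' (c + 1) - limit_pgf ((c + 1) / (M + 1))\<bar> \<le> error_const * ((M + 1) ^ 5 / (c + 1) ^ 6)"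
        using less.IH[of n' "c + 1"] less.prems unfolding e by (simp add: n)
      have lt: "n' + 1 - k < n" using k n by simp
      have ge: "c + k - 1 \<ge> 4" "c + k - 2 \<ge> 4" using less.prems k by auto
      show "\<bar>ngen (n' + 1 - k) (c + k - 1) - limit_pgf ((c + k - 1) / M)\<bar> \<le> error_const * (M ^ 5 / (c + k - 1) ^ 6)"
        using less.IH[OF lt ge(1)] unfolding e .
      show "\<bar>ngen (n' + 1 - k) (c + k - 2) - limit_pgf ((c + k - 2) / (M - 1))\<bar> \<le> error_const * ((M - 1) ^ 5 / (c + k - 2) ^ 6)"
        using less.IH[OF lt ge(2)] unfolding e .
    qed (use less.prems k in \<open>auto intro!: ngen_nonneg ngen_le_1\<close>)
    moreover have "1 / \<alpha> + c + n = M + 1" by (simp add: M_def n)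
    ultimately show ?thesis by (simp only: n)
  qed
qed

text \<open>Three errors: \<open>m\<close> crude steps, the approximation at an argument of at least
  \<open>m\<close>, and the distance of the point reached from 0. \<open>A\<close> is a common bound
  for \<open>1 / \<alpha>\<close> and \<open>1 / \<beta>\<close>, which makes the rate uniform in
  the parameters.\<close>

definition rate :: "real \<Rightarrow> nat \<Rightarrow> nat \<Rightarrow> real" where
  "rate A n m = m * k / (real n - 1) +
     (step_const + 2 * A + 2 * k) * ((2 * A + n) ^ 5 / real m ^ 6) + 2 * ((A + m) / n)"

text \<open>The first \<open>m\<close> steps of the recurrence, where the relative error of the coefficients is not
  small, are estimated trivially.\<close>

lemma ngen_limit:
  assumes A: "1 / \<alpha> \<le> A" "1 / \<beta> \<le> A" and m: "4 \<le> m" "m \<le> n"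
  shows "\<bar>ngen n (1 / \<beta>) - limit_pgf 0\<bar> \<le> rate A n m"
proof -
  define b where "b = 1 / \<beta>"
  define N where "N = 1 / \<alpha> + b + n"
  have ab: "1 / \<alpha> > 0" "b > 0" using pos by (auto simp: b_def)
  have n: "n > 1" "real n > 1" using m by auto
  have N: "N \<ge> n" "N > 0" "b + m \<le> N" "N \<le> 2 * A + n"
    using ab n A \<open>m \<le> n\<close> unfolding N_def b_def by linarith+
  have 1: "\<bar>ngen n b - ngen (n - m) (b + m)\<bar> \<le> m * k / (real n - 1)"
  proof -
    have "\<bar>ngen n b - ngen (n - m) (b + m)\<bar> \<le> m * (k / (1 / \<alpha> + b + n - 1))"
      using ngen_iterate_le[OF ab(2) m(2)] n by simp
    also have "\<dots> \<le> m * (k / (real n - 1))"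
      using n ab by (intro mult_left_mono divide_left_mono mult_pos_pos) linarith+
    finally show ?thesis by simp
  qed
  have e: "1 / \<alpha> + (b + m) + (n - m) = N" using m by (simp add: N_def of_nat_diff)
  have "\<bar>ngen (n - m) (b + m) - limit_pgf ((b + m) / N)\<bar> \<le> error_const * (N ^ 5 / (b + m) ^ 6)"
    using ngen_approx[of "b + m" "n - m"] m ab unfolding e by simp
  also have "\<dots> \<le> (step_const + 2 * A + 2 * k) * ((2 * A + n) ^ 5 / real m ^ 6)"
  proof (intro mult_mono frac_le power_mono)
    show "error_const \<le> step_const + 2 * A + 2 * k" using A(1) by (simp add: error_const_def)
    show "0 \<le> step_const + 2 * A + 2 * k" using step_const_bounds(1) A(1) ab(1) by linarith
  qed (use N m ab in auto)
  finally have 2: "\<bar>ngen (n - m) (b + m) - limit_pgf ((b + m) / N)\<bar> \<le> (step_const + 2 * A + 2 * k) * ((2 * A + n) ^ 5 / real m ^ 6)" .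
  have "\<bar>limit_pgf ((b + m) / N) - limit_pgf 0\<bar> \<le> 2 * \<bar>(b + m) / N - 0\<bar>"
    using N ab by (intro limit_pgf_diff) auto
  also have "\<dots> \<le> 2 * ((A + m) / n)"
    using N ab n A by (auto simp: b_def intro!: frac_le)
  finally show ?thesis using 1 2 unfolding rate_def b_def by linarith
qed

end

section \<open>From generating functions to convergence in distribution\<close>

text \<open>Each power of \<open>1 / 2\<close> is isolated from the others, so a continuous function
  separates \<open>(1 / 2) ^ r\<close> from them, and Weierstrass approximation on the unit interval
  applies. A polynomial in \<open>(1 / 2) ^ m\<close> is a combination of functions
  \<open>u ^ m\<close> with \<open>u = (1 / 2) ^ i\<close>.\<close>

lemma indicator_polynomial_approx:
  fixes e :: real
  assumes "e > 0"
  obtains a :: "nat \<Rightarrow> real" and d :: nat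
  where "\<And>m. \<bar>(if m = r then 1 else 0) - (\<Sum>i\<le>d. a i * ((1 / 2) ^ m) ^ i)\<bar> < e"
proof -
  \<comment> \<open>A tent at \<open>(1 / 2) ^ r\<close> whose half-width
    \<open>(1 / 2) ^ (r + 1)\<close> is the distance to the nearest other power.\<close>
  define g where "g = (\<lambda>x::real. max 0 (1 - 2 ^ (r + 1) * \<bar>x - (1 / 2) ^ r\<bar>))"
  have "continuous_on {0..1} g" unfolding g_def by (intro continuous_intros)
  then obtain q where q: "real_polynomial_function q" "\<And>x. x \<in> {0..1} \<Longrightarrow> \<bar>g x - q x\<bar> < e"
    using Stone_Weierstrass_real_polynomial_function[of "{0..1}" g e] assms by auto
  obtain a d where ad: "q = (\<lambda>x. \<Sum>i\<le>d. a i * x ^ i)"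
    using q(1) unfolding real_polynomial_function_iff_sum by blast
  have half: "2 ^ (r + 1) * ((1 / 2 :: real) ^ r - (1 / 2) ^ (r + 1)) = 1"
    by (simp add: power_divide)
  have half': "2 ^ (r + 1) * ((1 / 2 :: real) ^ m - (1 / 2) ^ (m + 1)) \<ge> 1" if "m + 1 \<le> r" for m
  proof -
    have "(1 / 2 :: real) ^ r \<le> (1 / 2) ^ m" using that by (intro power_decreasing) auto
    then have "2 ^ r * (1 / 2 :: real) ^ r \<le> 2 ^ r * (1 / 2) ^ m"
      by (intro mult_left_mono) auto
    moreover have "2 ^ r * (1 / 2 :: real) ^ r = 1" by (simp add: power_divide)
    ultimately show ?thesis by simp
  qed
  have "g ((1 / 2) ^ m) = (if m = r then 1 else 0)" for m
  proof -
    consider "m = r" | "r + 1 \<le> m" | "m + 1 \<le> r" by linarith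
    then show ?thesis
    proof cases
      case 2
      have "(1 / 2 :: real) ^ m \<le> (1 / 2) ^ (r + 1)" using 2 by (intro power_decreasing) auto
      then have "2 ^ (r + 1) * ((1 / 2 :: real) ^ r - (1 / 2) ^ (r + 1)) \<le> 2 ^ (r + 1) * \<bar>(1 / 2) ^ m - (1 / 2) ^ r\<bar>"
        by (intro mult_left_mono, linarith, simp)
      then show ?thesis using 2 unfolding half g_def by simp
    next
      case 3
      have "(1 / 2 :: real) ^ r \<le> (1 / 2) ^ (m + 1)" using 3 by (intro power_decreasing) auto
      then have "2 ^ (r + 1) * ((1 / 2 :: real) ^ m - (1 / 2) ^ (m + 1)) \<le> 2 ^ (r + 1) * \<bar>(1 / 2) ^ m - (1 / 2) ^ r\<bar>"
        by (intro mult_left_mono, linarith, simp)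
      then have "1 \<le> 2 ^ (r + 1) * \<bar>(1 / 2) ^ m - (1 / 2 :: real) ^ r\<bar>"
        by (rule order_trans[OF half'[OF 3]])
      then show ?thesis using 3 unfolding g_def by simp
    qed (simp add: g_def)
  qed
  moreover have "(1 / 2 :: real) ^ m \<in> {0..1}" for m by (simp add: power_le_one)
  ultimately have "\<bar>(if m = r then 1 else 0) - (\<Sum>i\<le>d. a i * ((1 / 2) ^ m) ^ i)\<bar> < e" for m
    using q(2)[of "(1 / 2) ^ m"] unfolding ad by simp
  then show ?thesis by (rule that)
qed

locale pgf_convergence =
  fixes M :: "nat \<Rightarrow> 'a measure" and X Y :: "nat \<Rightarrow> 'a \<Rightarrow> nat"
    and N :: "'b measure" and U V :: "'b \<Rightarrow> nat"
  assumes prob: "\<And>n. prob_space (M n)" "prob_space N"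
    and meas [measurable]: "\<And>n. X n \<in> measurable (M n) (count_space UNIV)"
      "\<And>n. Y n \<in> measurable (M n) (count_space UNIV)"
      "U \<in> measurable N (count_space UNIV)" "V \<in> measurable N (count_space UNIV)"
    and pgf: "\<And>u v. 0 \<le> u \<Longrightarrow> u \<le> 1 \<Longrightarrow> 0 \<le> v \<Longrightarrow> v \<le> 1 \<Longrightarrow>
      (\<lambda>n. \<integral>x. u ^ X n x * v ^ Y n x \<partial>M n) \<longlonglongrightarrow> (\<integral>x. u ^ U x * v ^ V x \<partial>N :: real)"
begin

lemma integrable_bounded:
  fixes f :: "nat \<Rightarrow> nat \<Rightarrow> real"
  assumes "\<And>i j. \<bar>f i j\<bar> \<le> C"
  shows "integrable (M n) (\<lambda>x. f (X n x) (Y n x))" "integrable N (\<lambda>x. f (U x) (V x))"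
proof -
  interpret A: prob_space "M n" by (rule prob)
  interpret B: prob_space N by (rule prob)
  have [measurable]: "(\<lambda>x. f (X n x) (Y n x)) \<in> borel_measurable (M n)"
    by (rule measurable_compose_countable[OF measurable_compose_countable[where g = "Y n"]]) measurable
  have [measurable]: "(\<lambda>x. f (U x) (V x)) \<in> borel_measurable N"
    by (rule measurable_compose_countable[OF measurable_compose_countable[where g = V]]) measurable
  show "integrable (M n) (\<lambda>x. f (X n x) (Y n x))" "integrable N (\<lambda>x. f (U x) (V x))"
    using assms by (auto intro!: A.integrable_const_bound[where B = C] B.integrable_const_bound[where B = C])
qed

definition converges :: "(nat \<Rightarrow> nat \<Rightarrow> real) \<Rightarrow> bool" where
  "converges f \<longleftrightarrow> (\<lambda>n. \<integral>x. f (X n x) (Y n x) \<partial>M n) \<longlonglongrightarrow> (\<integral>x. f (U x) (V x) \<partial>N)"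

lemma converges_sum:
  assumes "finite I" "\<And>i. i \<in> I \<Longrightarrow> converges (f i)" "\<And>i r s. i \<in> I \<Longrightarrow> \<bar>f i r s\<bar> \<le> C i"
  shows "converges (\<lambda>r s. \<Sum>i\<in>I. c i * f i r s)"
proof -
  have "integrable (M n) (\<lambda>x. c i * f i (X n x) (Y n x))" "integrable N (\<lambda>x. c i * f i (U x) (V x))" if "i \<in> I" for i n
    using integrable_bounded[of "f i" "C i", OF assms(3)[OF that]] by simp_all
  then show ?thesis
    using assms(2) unfolding converges_def
    by (simp add: Bochner_Integration.integral_sum) (intro tendsto_sum tendsto_mult_left; blast)
qed

lemma converges_approx:
  assumes "\<And>e. e > 0 \<Longrightarrow> \<exists>g C. converges g \<and> (\<forall>r s. \<bar>g r s\<bar> \<le> C) \<and> (\<forall>r s. \<bar>f r s - g r s\<bar> \<le> e)"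
  shows "converges f"
proof -
  have fb: "\<exists>C. \<forall>r s. \<bar>f r s\<bar> \<le> C"
  proof -
    obtain g C where g: "\<And>r s. \<bar>g r s\<bar> \<le> C" "\<And>r s. \<bar>f r s - g r s\<bar> \<le> (1::real)"
      using assms[OF zero_less_one] by blast
    have "\<bar>f r s\<bar> \<le> C + 1" for r s
      using g[of r s] by linarith
    then show ?thesis by blast
  qed
  then obtain C' where C': "\<And>r s. \<bar>f r s\<bar> \<le> C'" by blast
  show ?thesis
    unfolding converges_def
  proof (rule LIMSEQ_I)
    fix e :: real assume e: "e > 0"
    obtain g C where g: "converges g" "\<And>r s. \<bar>g r s\<bar> \<le> C" "\<And>r s. \<bar>f r s - g r s\<bar> \<le> e / 4"
      using assms[of "e / 4"] e by auto
    obtain n0 where n0: "\<And>n. n \<ge> n0 \<Longrightarrow>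
        norm ((\<integral>x. g (X n x) (Y n x) \<partial>M n) - (\<integral>x. g (U x) (V x) \<partial>N)) < e / 4"
      using LIMSEQ_D[OF g(1)[unfolded converges_def], of "e / 4"] e by auto
    note if_g = integrable_bounded[of g C, OF g(2)] and if_f = integrable_bounded[of f C', OF C']
    have 1: "\<bar>(\<integral>x. f (X n x) (Y n x) \<partial>M n) - (\<integral>x. g (X n x) (Y n x) \<partial>M n)\<bar> \<le> e / 4" for n
    proof -
      interpret A: prob_space "M n" by (rule prob)
      have "\<bar>\<integral>x. f (X n x) (Y n x) - g (X n x) (Y n x) \<partial>M n\<bar> \<le> (\<integral>x. e / 4 \<partial>M n)"
        using g(3) if_g if_f by (intro order_trans[OF integral_abs_bound integral_mono]) auto
      then show ?thesis using if_g if_f by (simp add: A.prob_space)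
    qed
    have 2: "\<bar>(\<integral>x. f (U x) (V x) \<partial>N) - (\<integral>x. g (U x) (V x) \<partial>N)\<bar> \<le> e / 4"
    proof -
      interpret A: prob_space N by (rule prob)
      have "\<bar>\<integral>x. f (U x) (V x) - g (U x) (V x) \<partial>N\<bar> \<le> (\<integral>x. e / 4 \<partial>N)"
        using g(3) if_g if_f by (intro order_trans[OF integral_abs_bound integral_mono]) auto
      then show ?thesis using if_g if_f by (simp add: A.prob_space)
    qed
    have "norm ((\<integral>x. f (X n x) (Y n x) \<partial>M n) - (\<integral>x. f (U x) (V x) \<partial>N)) < e" if "n \<ge> n0" for n
      using 1[of n] 2 n0[OF that] e unfolding real_norm_def by linarith
    then show "\<exists>no. \<forall>n\<ge>no. norm ((\<integral>x. f (X n x) (Y n x) \<partial>M n) - (\<integral>x. f (U x) (V x) \<partial>N)) < e"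
      by blast
  qed
qed

text \<open>Products of two one-variable approximations are combinations of
  \<open>u ^ i * v ^ j\<close> with \<open>u\<close> and \<open>v\<close> powers of
  \<open>1 / 2\<close>, to which the hypothesis on generating functions applies.\<close>

lemma converges_point: "converges (\<lambda>i j. if i = r \<and> j = s then 1 else 0)"
proof (rule converges_approx)
  fix e :: real assume "e > 0"
  \<comment> \<open>The product error splits into parts of at most \<open>d\<close> and
    \<open>2 * d\<close>, and \<open>d \<le> 1\<close> keeps \<open>Q\<close> bounded by 2.\<close>
  define d where "d = min 1 (e / 3)"
  have d: "d > 0" "d \<le> 1" "3 * d \<le> e" using \<open>e > 0\<close> by (auto simp: d_def)
  obtain a m where a: "\<And>i. \<bar>(if i = r then 1 else 0) - (\<Sum>k\<le>m. a k * ((1 / 2) ^ i) ^ k)\<bar> < d"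
    by (rule indicator_polynomial_approx[OF d(1)]) blast
  obtain b l where b: "\<And>i. \<bar>(if i = s then 1 else 0) - (\<Sum>k\<le>l. b k * ((1 / 2) ^ i) ^ k)\<bar> < d"
    by (rule indicator_polynomial_approx[OF d(1)]) blast
  define P Q where "P = (\<lambda>i. \<Sum>k\<le>m. a k * ((1 / 2 :: real) ^ i) ^ k)"
    and "Q = (\<lambda>i. \<Sum>k\<le>l. b k * ((1 / 2 :: real) ^ i) ^ k)"
  have P: "\<bar>(if i = r then 1 else 0) - P i\<bar> < d" and Q: "\<bar>(if i = s then 1 else 0) - Q i\<bar> < d" for i
    using a b by (auto simp: P_def Q_def)
  have P2: "\<bar>P i\<bar> \<le> 2" and Q2: "\<bar>Q i\<bar> \<le> 2" for i
    using P[of i] Q[of i] d by (auto split: if_splits)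
  have eq: "P i * Q j = (\<Sum>(k, k')\<in>{..m} \<times> {..l}. (a k * b k') * (((1 / 2) ^ k) ^ i * ((1 / 2) ^ k') ^ j))" for i j
    unfolding P_def Q_def sum_product sum.cartesian_product
    by (intro sum.cong refl) (auto simp: power_mult[symmetric] mult_ac)
  have "converges (\<lambda>i j. P i * Q j)"
    unfolding eq case_prod_unfold
  proof (rule converges_sum[where C = "\<lambda>_. 1"])
    show "converges (\<lambda>i j. ((1 / 2) ^ fst z) ^ i * ((1 / 2) ^ snd z) ^ j)" for z :: "nat \<times> nat"
      unfolding converges_def by (intro pgf) (auto simp: power_le_one)
    show "\<bar>((1 / 2 :: real) ^ fst z) ^ i * ((1 / 2) ^ snd z) ^ j\<bar> \<le> 1" for z :: "nat \<times> nat" and i j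
      by (simp add: abs_mult power_abs mult_le_one power_le_one)
  qed auto
  moreover have "\<bar>P i * Q j\<bar> \<le> 2 * 2" for i j
    unfolding abs_mult using P2 Q2 by (intro mult_mono) auto
  moreover have "\<bar>(if i = r \<and> j = s then 1 else 0) - P i * Q j\<bar> \<le> e" for i j
  proof -
    define x y where "x = (if i = r then 1 else 0 :: real)" and "y = (if j = s then 1 else 0 :: real)"
    have "(if i = r \<and> j = s then 1 else 0) - P i * Q j = x * (y - Q j) + Q j * (x - P i)"
      by (simp add: x_def y_def algebra_simps)
    moreover have "\<bar>x * (y - Q j)\<bar> \<le> 1 * d"
      unfolding abs_mult using Q[of j] by (intro mult_mono) (auto simp: x_def y_def)
    moreover have "\<bar>Q j * (x - P i)\<bar> \<le> 2 * d"
      unfolding abs_mult using P[of i] Q2[of j] d by (intro mult_mono) (auto simp: x_def)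
    ultimately show ?thesis using d(3) by linarith
  qed
  ultimately show "\<exists>g C. converges g \<and> (\<forall>r s. \<bar>g r s\<bar> \<le> C) \<and>
      (\<forall>i j. \<bar>(if i = r \<and> j = s then 1 else 0) - g i j\<bar> \<le> e)"
    by (intro exI[of _ "\<lambda>i j. P i * Q j"] exI[of _ "2 * 2"]) auto
qed

lemma converges_finite_support:
  "converges (\<lambda>i j. if i < K \<and> j < K then f i j else 0)"
proof -
  have "converges (\<lambda>i j. \<Sum>z\<in>{..<K} \<times> {..<K}. f (fst z) (snd z) * (if i = fst z \<and> j = snd z then 1 else 0))"
    by (rule converges_sum[where C = "\<lambda>_. 1"]) (auto intro: converges_point)
  moreover have "(\<Sum>z\<in>{..<K} \<times> {..<K}. f (fst z) (snd z) * (if i = fst z \<and> j = snd z then 1 else 0)) =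
      (if i < K \<and> j < K then f i j else 0)" for i j
  proof -
    have "(\<Sum>z\<in>{..<K} \<times> {..<K}. f (fst z) (snd z) * (if i = fst z \<and> j = snd z then 1 else 0)) =
        (\<Sum>z\<in>{..<K} \<times> {..<K}. if z = (i, j) then f i j else 0)"
      by (intro sum.cong refl) auto
    then show ?thesis by (simp add: sum.delta)
  qed
  ultimately show ?thesis by (simp only:)
qed

text \<open>No mass of the limit law escapes to infinity; this is the source of tightness for the
  whole sequence.\<close>

lemma box_mass: "(\<lambda>K. \<integral>x. (if U x < K \<and> V x < K then 1 else 0 :: real) \<partial>N) \<longlonglongrightarrow> 1"
proof -
  interpret A: prob_space N by (rule prob)
  have "(\<lambda>K. \<integral>x. (if U x < K \<and> V x < K then 1 else 0 :: real) \<partial>N) \<longlonglongrightarrow> (\<integral>x. 1 \<partial>N)"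
  proof (rule integral_dominated_convergence[where w = "\<lambda>_. 1"])
    show "AE x in N. (\<lambda>K. if U x < K \<and> V x < K then 1 else 0 :: real) \<longlonglongrightarrow> 1"
    proof (rule AE_I2)
      fix x
      have "eventually (\<lambda>K. U x < K \<and> V x < K) sequentially"
        by (intro eventually_conj eventually_gt_at_top)
      then have "eventually (\<lambda>K. (if U x < K \<and> V x < K then 1 else 0 :: real) = 1) sequentially"
        by eventually_elim simp
      then show "(\<lambda>K. if U x < K \<and> V x < K then 1 else 0 :: real) \<longlonglongrightarrow> 1"
        by (rule tendsto_eventually)
    qed
  qed auto
  then show ?thesis by (simp add: A.prob_space)
qed

text \<open>The test function is cut off to a square box. The box carries nearly all mass under the
  limit law and its mass converges, so it carries nearly all mass under \<open>M n\<close> for large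
  \<open>n\<close>, which bounds the part cut off.\<close>

lemma converges_bounded:
  assumes f: "\<And>i j. \<bar>f i j\<bar> \<le> C"
  shows "converges f"
  unfolding converges_def
proof (rule LIMSEQ_I)
  fix e :: real assume e: "e > 0"
  have C: "C \<ge> 0" using f[of 0 0] by linarith
  \<comment> \<open>Dividing by \<open>C + 1\<close> allows for \<open>C = 0\<close> and still gives
    \<open>C * d \<le> e / 4\<close>.\<close>
  define d where "d = e / (4 * (C + 1))"
  have d: "d > 0" "C * d \<le> e / 4"
  proof -
    show "d > 0" using e C by (simp add: d_def)
    have "C * d \<le> (C + 1) * d" using \<open>d > 0\<close> by (simp add: algebra_simps)
    also have "\<dots> = e / 4" using C by (simp add: d_def field_simps)
    finally show "C * d \<le> e / 4" .
  qed
  obtain K where K: "\<bar>(\<integral>x. (if U x < K \<and> V x < K then 1 else 0 :: real) \<partial>N) - 1\<bar> < d / 2"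
    using LIMSEQ_D[OF box_mass, of "d / 2"] d(1) by auto
  define g h where "g = (\<lambda>i j. if i < K \<and> j < K then f i j else 0)"
    and "h = (\<lambda>i j. if i < K \<and> j < K then 1 else 0 :: real)"
  have h: "\<bar>h i j\<bar> \<le> 1" and g: "\<bar>g i j\<bar> \<le> C" for i j using f C by (auto simp: g_def h_def)
  have fg: "\<bar>f i j - g i j\<bar> \<le> C * (1 - h i j)" for i j using f by (auto simp: g_def h_def)
  obtain n1 where n1: "\<And>n. n \<ge> n1 \<Longrightarrow>
      norm ((\<integral>x. g (X n x) (Y n x) \<partial>M n) - (\<integral>x. g (U x) (V x) \<partial>N)) < e / 4"
    using LIMSEQ_D[OF converges_finite_support[of K f, unfolded converges_def], of "e / 4"] e
    by (auto simp: g_def)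
  obtain n2 where n2: "\<And>n. n \<ge> n2 \<Longrightarrow>
      norm ((\<integral>x. h (X n x) (Y n x) \<partial>M n) - (\<integral>x. h (U x) (V x) \<partial>N)) < d / 2"
    using LIMSEQ_D[OF converges_finite_support[of K "\<lambda>_ _. 1", unfolded converges_def], of "d / 2"] d
    by (auto simp: h_def)
  note int = integrable_bounded[of f C, OF f] integrable_bounded[of g C, OF g] integrable_bounded[of h 1, OF h]
  have 1: "\<bar>(\<integral>x. f (X n x) (Y n x) \<partial>M n) - (\<integral>x. g (X n x) (Y n x) \<partial>M n)\<bar>
      \<le> C * (1 - (\<integral>x. h (X n x) (Y n x) \<partial>M n))" for n
  proof -
    interpret A: prob_space "M n" by (rule prob)
    have "\<bar>\<integral>x. f (X n x) (Y n x) - g (X n x) (Y n x) \<partial>M n\<bar> \<le> (\<integral>x. C * (1 - h (X n x) (Y n x)) \<partial>M n)"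
      using fg int by (intro order_trans[OF integral_abs_bound integral_mono]) auto
    then show ?thesis using int by (simp add: A.prob_space)
  qed
  have 2: "\<bar>(\<integral>x. f (U x) (V x) \<partial>N) - (\<integral>x. g (U x) (V x) \<partial>N)\<bar> \<le> C * (1 - (\<integral>x. h (U x) (V x) \<partial>N))"
  proof -
    interpret A: prob_space N by (rule prob)
    have "\<bar>\<integral>x. f (U x) (V x) - g (U x) (V x) \<partial>N\<bar> \<le> (\<integral>x. C * (1 - h (U x) (V x)) \<partial>N)"
      using fg int by (intro order_trans[OF integral_abs_bound integral_mono]) auto
    then show ?thesis using int by (simp add: A.prob_space)
  qed
  have hU: "\<bar>(\<integral>x. h (U x) (V x) \<partial>N) - 1\<bar> < d / 2" using K unfolding h_def .
  have "norm ((\<integral>x. f (X n x) (Y n x) \<partial>M n) - (\<integral>x. f (U x) (V x) \<partial>N)) < e" if "n \<ge> max n1 n2" for n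
  proof -
    have "1 - (\<integral>x. h (X n x) (Y n x) \<partial>M n) \<le> d" "1 - (\<integral>x. h (U x) (V x) \<partial>N) \<le> d"
      using n2[of n] that hU d(1) unfolding real_norm_def by linarith+
    then have Cd: "C * (1 - (\<integral>x. h (X n x) (Y n x) \<partial>M n)) \<le> C * d" "C * (1 - (\<integral>x. h (U x) (V x) \<partial>N)) \<le> C * d"
      using C by (auto intro: mult_left_mono)
    have *: "\<bar>x - y\<bar> < e"
      if "\<bar>x - p\<bar> \<le> A" "\<bar>y - q\<bar> \<le> B" "norm (p - q) < e / 4" "A \<le> C * d" "B \<le> C * d" for x y p q A B :: real
      using that d(2) e unfolding real_norm_def by linarith
    have "n \<ge> n1" using that by simp
    then show ?thesis
      unfolding real_norm_def by (intro *[OF 1 2 _ Cd] n1)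
  qed
  then show "\<exists>no. \<forall>n\<ge>no. norm ((\<integral>x. f (X n x) (Y n x) \<partial>M n) - (\<integral>x. f (U x) (V x) \<partial>N)) < e"
    by blast
qed

end

section \<open>The Poisson generating function\<close>

lemma (in prob_space) poisson_pgf:
  fixes Z :: "'a \<Rightarrow> nat" and u r :: real
  assumes Z: "random_variable (count_space UNIV) Z"
    and D: "distr M (count_space UNIV) Z = measure_pmf (poisson_pmf r)"
    and u: "0 \<le> u" "u \<le> 1" and r: "0 < r"
  shows "expectation (\<lambda>\<omega>. u ^ Z \<omega>) = exp (r * (u - 1))"
proof -
  have "expectation (\<lambda>\<omega>. u ^ Z \<omega>) = (\<integral>i. u ^ i \<partial>distr M (count_space UNIV) Z)"
    using Z by (subst integral_distr) auto
  also have "\<dots> = (\<integral>i. pmf (poisson_pmf r) i * u ^ i \<partial>count_space UNIV)"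
    unfolding D measure_pmf_eq_density by (subst integral_real_density) auto
  also have "\<dots> = exp (r * (u - 1))"
  proof -
    have "(\<lambda>i. exp (- r) * ((r * u) ^ i /\<^sub>R fact i)) sums (exp (- r) * exp (r * u))"
      by (intro sums_mult exp_converges)
    then have s: "(\<lambda>i. pmf (poisson_pmf r) i * u ^ i) sums exp (r * (u - 1))"
      by (simp add: pmf_poisson[OF r] power_mult_distrib divide_inverse mult_ac exp_add[symmetric] algebra_simps)
    then have "integrable (count_space UNIV) (\<lambda>i. pmf (poisson_pmf r) i * u ^ i)"
      using u by (auto simp: integrable_count_space_nat_iff sums_iff)
    from sums_integral_count_space_nat[OF this] s show ?thesis by (rule sums_unique2)
  qed
  finally show ?thesis .
qed

section \<open>The random tableau\<close>

text \<open>With \<open>u = v = 1\<close> the recurrence only shifts \<open>c\<close>, so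
  \<open>ngen\<close> is constantly 1. At \<open>c = 1 / \<beta>\<close> the variable
  \<open>x = \<beta> * c\<close> is 1, where \<open>gen\<close> is the partition function and
  \<open>norm_const\<close> the stated product.\<close>

lemma stair_Z_eq:
  assumes "\<alpha> > 0" "\<beta> > 0"
  shows "stair_Z n \<alpha> \<beta> = (\<Prod>i<n. \<alpha> + \<beta> + real i * \<alpha> * \<beta>)"
proof -
  interpret tableau_pgf \<alpha> \<beta> 1 1 2 by unfold_locales (use assms in auto)
  have "ngen n c = 1" if "c > 0" for c
    using that by (induction n arbitrary: c) (simp_all add: ngen_0 ngen_Suc)
  from this[of "1 / \<beta>"] have "gen n 1 = norm_const n (1 / \<beta>)"
    using assms norm_const_pos[of "1 / \<beta>" n] by (simp add: ngen_def)
  moreover have "gen n 1 = stair_Z n \<alpha> \<beta>"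
    by (simp add: gen_def stair_Z_def marked_weight_def)
  moreover have "norm_const n (1 / \<beta>) = (\<Prod>i<n. \<alpha> + \<beta> + real i * \<alpha> * \<beta>)"
  proof (induction n)
    case (Suc n)
    have "\<alpha> * \<beta> * (1 / \<alpha> + 1 / \<beta> + n) = \<alpha> + \<beta> + n * \<alpha> * \<beta>"
      using assms by (simp add: field_simps)
    then show ?case using Suc by (simp add: norm_const_Suc')
  qed (simp add: norm_const_def)
  ultimately show ?thesis by simp
qed

lemma stair_Z_pos: "\<alpha> > 0 \<Longrightarrow> \<beta> > 0 \<Longrightarrow> stair_Z n \<alpha> \<beta> > 0"
  by (simp add: stair_Z_eq prod_pos add_pos_nonneg)

lemma stair_weight_nonneg: "\<alpha> > 0 \<Longrightarrow> \<beta> > 0 \<Longrightarrow> stair_weight \<alpha> \<beta> S \<ge> 0"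
  by (simp add: stair_weight_def)

lemma stair_prob_fin_bounds:
  assumes "\<alpha> > 0" "\<beta> > 0"
  shows "0 \<le> stair_prob_fin n \<alpha> \<beta> S"
    and "S \<in> stair_tableaux n \<Longrightarrow> stair_prob_fin n \<alpha> \<beta> S \<le> 1"
    and "(\<Sum>S\<in>stair_tableaux n. stair_prob_fin n \<alpha> \<beta> S) = 1"
proof -
  note Z = stair_Z_pos[OF assms, of n] and w = stair_weight_nonneg[OF assms]
  show "0 \<le> stair_prob_fin n \<alpha> \<beta> S"
    using Z w by (simp add: stair_prob_fin_def)
  show "stair_prob_fin n \<alpha> \<beta> S \<le> 1" if "S \<in> stair_tableaux n"
    using Z member_le_sum[OF that, of "stair_weight \<alpha> \<beta>"] w by (simp add: stair_prob_fin_def stair_Z_def)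
  show "(\<Sum>S\<in>stair_tableaux n. stair_prob_fin n \<alpha> \<beta> S) = 1"
    using Z by (simp add: stair_prob_fin_def sum_divide_distrib[symmetric] stair_Z_def)
qed

lemma (in tableau_pgf) sum_stair_prob_fin:
  "(\<Sum>S\<in>stair_tableaux n. stair_prob_fin n \<alpha> \<beta> S *
     (u ^ diagonal_count n k Alpha S * v ^ diagonal_count n k Beta S)) = ngen n (1 / \<beta>)"
proof -
  have "norm_const n (1 / \<beta>) = stair_Z n \<alpha> \<beta>"
  proof (induction n)
    case (Suc n)
    have "\<alpha> * \<beta> * (1 / \<alpha> + 1 / \<beta> + n) = \<alpha> + \<beta> + n * \<alpha> * \<beta>"
      using pos by (simp add: field_simps)
    then show ?case using Suc pos by (simp add: norm_const_Suc' stair_Z_eq)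
  qed (simp add: norm_const_def stair_Z_eq pos)
  then show ?thesis
    using pos by (simp add: ngen_def gen_def marked_weight_def stair_prob_fin_def sum_divide_distrib mult_ac)
qed

section \<open>Limits at infinite parameters\<close>

text \<open>\<open>Z\<close> grows like \<open>x ^ d\<close>. For \<open>p \<le> d\<close> the
  quotient converges by comparison of degrees; for \<open>p > d\<close> it would be unbounded,
  contrary to the assumed bound by 1.\<close>

lemma monomial_ratio_convergent:
  fixes Z :: "real \<Rightarrow> real"
  assumes C: "C > 0" and Z: "((\<lambda>x. Z x / x ^ d) \<longlongrightarrow> z) at_top" "z > 0"
    and le: "eventually (\<lambda>x. C * x ^ p / Z x \<le> 1) at_top"
  shows "\<exists>l. ((\<lambda>x. C * x ^ p / Z x) \<longlongrightarrow> l) at_top"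
proof (cases "p \<le> d")
  case True
  have "((\<lambda>x::real. C * (x ^ p / x ^ d)) \<longlongrightarrow> C * (if p = d then 1 else 0)) at_top"
  proof (intro tendsto_mult_left)
    show "((\<lambda>x::real. x ^ p / x ^ d) \<longlongrightarrow> (if p = d then 1 else 0)) at_top"
    proof (cases "p = d")
      case True
      have "eventually (\<lambda>x::real. x ^ p / x ^ d = 1) at_top"
        using eventually_gt_at_top[of 0] by eventually_elim (simp add: True)
      then show ?thesis using True by (simp add: tendsto_eventually)
    next
      case False
      then have "d - p > 0" using \<open>p \<le> d\<close> by simp
      then have "((\<lambda>x::real. inverse (x ^ (d - p))) \<longlongrightarrow> 0) at_top"
        by (intro tendsto_inverse_0_at_top filterlim_pow_at_top filterlim_ident)
      moreover have "eventually (\<lambda>x::real. inverse (x ^ (d - p)) = x ^ p / x ^ d) at_top"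
        using eventually_gt_at_top[of 0]
        by eventually_elim (use \<open>p \<le> d\<close> in \<open>simp add: power_diff field_simps\<close>)
      ultimately have "((\<lambda>x::real. x ^ p / x ^ d) \<longlongrightarrow> 0) at_top"
        by (rule Lim_transform_eventually)
      then show ?thesis using False by simp
    qed
  qed
  from tendsto_divide[OF this Z(1)] Z(2)
  have "((\<lambda>x. C * (x ^ p / x ^ d) / (Z x / x ^ d)) \<longlongrightarrow> C * (if p = d then 1 else 0) / z) at_top"
    by simp
  moreover have "eventually (\<lambda>x. C * (x ^ p / x ^ d) / (Z x / x ^ d) = C * x ^ p / Z x) at_top"
    using eventually_gt_at_top[of 0] by eventually_elim simp
  ultimately have "((\<lambda>x. C * x ^ p / Z x) \<longlongrightarrow> C * (if p = d then 1 else 0) / z) at_top"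
    by (rule Lim_transform_eventually)
  then show ?thesis by blast
next
  case False
  have lim: "filterlim (\<lambda>x::real. C * x ^ (p - d)) at_top at_top"
    using False C by (intro filterlim_tendsto_pos_mult_at_top[OF tendsto_const]
      filterlim_pow_at_top filterlim_ident) auto
  have "eventually (\<lambda>x. z / 2 < Z x / x ^ d) at_top" "eventually (\<lambda>x. Z x / x ^ d < 2 * z) at_top"
    using Z(2) by (intro order_tendstoD[OF Z(1)]; simp)+
  moreover have "eventually (\<lambda>x::real. 2 * z \<le> C * x ^ (p - d)) at_top"
    using lim by (simp add: filterlim_at_top)
  ultimately have "eventually (\<lambda>x::real. False) at_top"
    using le eventually_gt_at_top[of 0]
  proof eventually_elim
    case (elim x)
    have "Z x / x ^ d > 0" using elim(1) Z(2) by linarith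
    then have "Z x > 0" using elim(5) by (simp add: zero_less_divide_iff)
    then have "C * x ^ p \<le> Z x" using elim(4) by (simp add: divide_le_eq)
    then have "C * x ^ p / x ^ d \<le> Z x / x ^ d" using elim(5) by (intro divide_right_mono) auto
    moreover have "C * x ^ p / x ^ d = C * x ^ (p - d)"
      using False elim(5) by (simp add: power_diff)
    ultimately show False using elim(2,3) by linarith
  qed
  then show ?thesis by simp
qed

lemma prod_ratio_tendsto:
  fixes z :: "nat \<Rightarrow> real \<Rightarrow> real"
  assumes "\<And>i. i < n \<Longrightarrow> ((\<lambda>x. z i x / x ^ e i) \<longlongrightarrow> c i) at_top"
  shows "((\<lambda>x. (\<Prod>i<n. z i x) / x ^ (\<Sum>i<n. e i)) \<longlongrightarrow> (\<Prod>i<n. c i)) at_top"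
proof -
  have "((\<lambda>x. \<Prod>i<n. z i x / x ^ e i) \<longlongrightarrow> (\<Prod>i<n. c i)) at_top"
    using assms by (intro tendsto_prod) auto
  then show ?thesis by (simp add: prod_dividef power_sum)
qed

text \<open>\<open>Lim\<close> denotes a limit only if one exists. Along the curve the weight is a
  monomial in \<open>x\<close>, each factor of the partition function grows like a power of
  \<open>x\<close>, and the quotient is a probability, hence at most 1.\<close>

lemma stair_prob_fin_convergent:
  fixes a b :: "real \<Rightarrow> real"
  assumes S: "S \<in> stair_tableaux n"
    and mono: "\<And>x. stair_weight (a x) (b x) S = C * x ^ p" "C > 0"
    and ev: "eventually (\<lambda>x. a x > 0 \<and> b x > 0) at_top"
    and lim: "\<And>i::nat. i < n \<Longrightarrow> ((\<lambda>x. (a x + b x + real i * a x * b x) / x ^ e i) \<longlongrightarrow> c i) at_top"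
    and c: "\<And>i. i < n \<Longrightarrow> c i > 0"
  shows "((\<lambda>x. stair_prob_fin n (a x) (b x) S) \<longlongrightarrow> Lim at_top (\<lambda>x. stair_prob_fin n (a x) (b x) S)) at_top"
proof -
  define Z where "Z = (\<lambda>x. \<Prod>i<n. a x + b x + real i * a x * b x)"
  have eq: "eventually (\<lambda>x. C * x ^ p / Z x = stair_prob_fin n (a x) (b x) S) at_top"
    using ev by eventually_elim (simp add: stair_prob_fin_def mono stair_Z_eq Z_def)
  have "eventually (\<lambda>x. C * x ^ p / Z x \<le> 1) at_top"
    using ev eq by eventually_elim (simp add: stair_prob_fin_bounds S)
  moreover have "((\<lambda>x. Z x / x ^ (\<Sum>i<n. e i)) \<longlongrightarrow> (\<Prod>i<n. c i)) at_top"
    unfolding Z_def by (intro prod_ratio_tendsto lim)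
  moreover have "(\<Prod>i<n. c i) > 0" using c by (intro prod_pos) auto
  ultimately obtain l where "((\<lambda>x. C * x ^ p / Z x) \<longlongrightarrow> l) at_top"
    using monomial_ratio_convergent[OF mono(2)] by blast
  then have "((\<lambda>x. stair_prob_fin n (a x) (b x) S) \<longlongrightarrow> l) at_top"
    using eq by (rule Lim_transform_eventually)
  then show ?thesis by (simp add: tendsto_Lim)
qed

text \<open>All cases of \<^const>\<open>stair_prob\<close> are limits along curves on which \<open>1 / \<alpha>\<close> and \<open>1 / \<beta>\<close>
  stay bounded, so bounds that are uniform in these quantities carry over to infinite parameters.\<close>

lemma stair_prob_limit:
  assumes "\<alpha> > 0" "\<beta> > 0"
  obtains a b :: "real \<Rightarrow> real" and A :: real
  where "\<And>n S. S \<in> stair_tableaux n \<Longrightarrow>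
      ((\<lambda>x. stair_prob_fin n (a x) (b x) S) \<longlongrightarrow> stair_prob n \<alpha> \<beta> S) at_top"
    and "eventually (\<lambda>x. a x > 0 \<and> b x > 0 \<and> 1 / a x \<le> A \<and> 1 / b x \<le> A) at_top"
proof -
  define a0 b0 where "a0 = enn2real \<alpha>" and "b0 = enn2real \<beta>"
  have a0: "a0 > 0" if "\<alpha> \<noteq> \<top>"
    using that assms by (simp add: a0_def enn2real_positive_iff less_top)
  have b0: "b0 > 0" if "\<beta> \<noteq> \<top>"
    using that assms by (simp add: b0_def enn2real_positive_iff less_top)
  have ev: "eventually (\<lambda>x::real. x > 0 \<and> 1 / x \<le> 1) at_top"
    using eventually_ge_at_top[of 1] by eventually_elim simp
  consider "\<alpha> = \<top>" "\<beta> = \<top>" | "\<alpha> = \<top>" "\<beta> \<noteq> \<top>" | "\<alpha> \<noteq> \<top>" "\<beta> = \<top>" | "\<alpha> \<noteq> \<top>" "\<beta> \<noteq> \<top>"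
    by blast
  then show ?thesis
  proof cases
    case 1
    show ?thesis
    proof (rule that[of "\<lambda>x. x" "\<lambda>x. x" 1])
      fix n S assume S: "S \<in> stair_tableaux n"
      have "((\<lambda>x. stair_prob_fin n x x S) \<longlongrightarrow> Lim at_top (\<lambda>x. stair_prob_fin n x x S)) at_top"
      \<comment> \<open>The factor with \<open>i = 0\<close> is \<open>2 * x\<close>; the others
        grow like \<open>i * x\<^sup>2\<close>.\<close>
      proof (rule stair_prob_fin_convergent[OF S, where C = 1 and p = "symbol_count Alpha S + symbol_count Beta S"
          and e = "\<lambda>i. if i = 0 then 1 else 2" and c = "\<lambda>i. if i = 0 then 2 else real i"])
        show "((\<lambda>x::real. (x + x + real i * x * x) / x ^ (if i = 0 then 1 else 2)) \<longlongrightarrow> (if i = 0 then 2 else real i)) at_top" for i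
        proof (cases "i = 0")
          case True
          have "((\<lambda>x::real. (x + x) / x) \<longlongrightarrow> 2) at_top" by real_asymp
          then show ?thesis using True by simp
        next
          case False
          then have "real i > 0" by simp
          then have "((\<lambda>x::real. (x + x + real i * x * x) / x ^ 2) \<longlongrightarrow> real i) at_top" by real_asymp
          then show ?thesis using False by simp
        qed
        show "\<forall>\<^sub>F x::real in at_top. 0 < x \<and> 0 < x" using ev by eventually_elim simp
      qed (auto simp: stair_weight_def power_add)
      then show "((\<lambda>x. stair_prob_fin n x x S) \<longlongrightarrow> stair_prob n \<alpha> \<beta> S) at_top"
        by (simp add: stair_prob_def 1)
    qed (use ev in auto)
  next
    case 2
    note b = b0[OF 2(2)]
    show ?thesis
    proof (rule that[of "\<lambda>x. x" "\<lambda>x. b0" "max 1 (1 / b0)"])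
      fix n S assume S: "S \<in> stair_tableaux n"
      have "((\<lambda>x. stair_prob_fin n x b0 S) \<longlongrightarrow> Lim at_top (\<lambda>x. stair_prob_fin n x b0 S)) at_top"
      \<comment> \<open>With \<open>b0\<close> fixed every factor is affine in \<open>x\<close>,
        with leading coefficient \<open>1 + i * b0\<close>.\<close>
      proof (rule stair_prob_fin_convergent[OF S, where C = "b0 ^ symbol_count Beta S" and p = "symbol_count Alpha S"
          and e = "\<lambda>i. 1" and c = "\<lambda>i. 1 + real i * b0"])
        show "((\<lambda>x::real. (x + b0 + real i * x * b0) / x ^ 1) \<longlongrightarrow> 1 + i * b0) at_top" for i
        proof -
          have "((\<lambda>x::real. 1 + i * b0 + b0 / x) \<longlongrightarrow> 1 + i * b0) at_top"
            by real_asymp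
          moreover have "eventually (\<lambda>x::real. 1 + i * b0 + b0 / x = (x + b0 + real i * x * b0) / x ^ 1) at_top"
            using eventually_gt_at_top[of 0] by eventually_elim (simp add: field_simps)
          ultimately show ?thesis by (rule Lim_transform_eventually)
        qed
        show "\<forall>\<^sub>F x::real in at_top. 0 < x \<and> 0 < b0" using ev by eventually_elim (simp add: b)
      qed (use b in \<open>auto simp: stair_weight_def add_pos_nonneg\<close>)
      then show "((\<lambda>x. stair_prob_fin n x b0 S) \<longlongrightarrow> stair_prob n \<alpha> \<beta> S) at_top"
        by (simp add: stair_prob_def 2 b0_def)
    next
      show "\<forall>\<^sub>F x in at_top. 0 < x \<and> 0 < b0 \<and> 1 / x \<le> max 1 (1 / b0) \<and> 1 / b0 \<le> max 1 (1 / b0)"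
        using ev by eventually_elim (use b in \<open>auto simp: le_max_iff_disj\<close>)
    qed
  next
    case 3
    note a = a0[OF 3(1)]
    show ?thesis
    proof (rule that[of "\<lambda>x. a0" "\<lambda>x. x" "max 1 (1 / a0)"])
      fix n S assume S: "S \<in> stair_tableaux n"
      have "((\<lambda>x. stair_prob_fin n a0 x S) \<longlongrightarrow> Lim at_top (\<lambda>x. stair_prob_fin n a0 x S)) at_top"
      proof (rule stair_prob_fin_convergent[OF S, where C = "a0 ^ symbol_count Alpha S" and p = "symbol_count Beta S"
          and e = "\<lambda>i. 1" and c = "\<lambda>i. 1 + real i * a0"])
        show "((\<lambda>x::real. (a0 + x + real i * a0 * x) / x ^ 1) \<longlongrightarrow> 1 + i * a0) at_top" for i
        proof -
          have "((\<lambda>x::real. 1 + i * a0 + a0 / x) \<longlongrightarrow> 1 + i * a0) at_top"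
            by real_asymp
          moreover have "eventually (\<lambda>x::real. 1 + i * a0 + a0 / x = (a0 + x + real i * a0 * x) / x ^ 1) at_top"
            using eventually_gt_at_top[of 0] by eventually_elim (simp add: field_simps)
          ultimately show ?thesis by (rule Lim_transform_eventually)
        qed
        show "\<forall>\<^sub>F x::real in at_top. 0 < a0 \<and> 0 < x" using ev by eventually_elim (simp add: a)
      qed (use a in \<open>auto simp: stair_weight_def add_pos_nonneg\<close>)
      then show "((\<lambda>x. stair_prob_fin n a0 x S) \<longlongrightarrow> stair_prob n \<alpha> \<beta> S) at_top"
        by (simp add: stair_prob_def 3 a0_def)
    next
      show "\<forall>\<^sub>F x in at_top. 0 < a0 \<and> 0 < x \<and> 1 / a0 \<le> max 1 (1 / a0) \<and> 1 / x \<le> max 1 (1 / a0)"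
        using ev by eventually_elim (use a in \<open>auto simp: le_max_iff_disj\<close>)
    qed
  next
    case 4
    show ?thesis
    proof (rule that[of "\<lambda>x. a0" "\<lambda>x. b0" "max (1 / a0) (1 / b0)"])
      show "((\<lambda>x. stair_prob_fin n a0 b0 S) \<longlongrightarrow> stair_prob n \<alpha> \<beta> S) at_top" for n S
        by (simp add: stair_prob_def 4 a0_def b0_def)
    qed (use a0[OF 4(1)] b0[OF 4(2)] in auto)
  qed
qed

lemma stair_prob_distribution:
  assumes "\<alpha> > 0" "\<beta> > 0"
  shows "S \<in> stair_tableaux n \<Longrightarrow> 0 \<le> stair_prob n \<alpha> \<beta> S"
    and "(\<Sum>S\<in>stair_tableaux n. stair_prob n \<alpha> \<beta> S) = 1"
proof -
  obtain a b :: "real \<Rightarrow> real" and A :: real where lim: "\<And>n S. S \<in> stair_tableaux n \<Longrightarrow>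
      ((\<lambda>x. stair_prob_fin n (a x) (b x) S) \<longlongrightarrow> stair_prob n \<alpha> \<beta> S) at_top"
    and ev: "eventually (\<lambda>x. a x > 0 \<and> b x > 0 \<and> 1 / a x \<le> A \<and> 1 / b x \<le> A) at_top"
    by (rule stair_prob_limit[OF assms]) blast
  show "0 \<le> stair_prob n \<alpha> \<beta> S" if "S \<in> stair_tableaux n"
  proof (rule tendsto_lowerbound[OF lim[OF that]])
    show "\<forall>\<^sub>F x in at_top. 0 \<le> stair_prob_fin n (a x) (b x) S"
      using ev by eventually_elim (simp add: stair_prob_fin_bounds)
  qed simp
  have "((\<lambda>x. \<Sum>S\<in>stair_tableaux n. stair_prob_fin n (a x) (b x) S) \<longlongrightarrow>
      (\<Sum>S\<in>stair_tableaux n. stair_prob n \<alpha> \<beta> S)) at_top"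
    by (intro tendsto_sum lim)
  moreover have "\<forall>\<^sub>F x in at_top. (\<Sum>S\<in>stair_tableaux n. stair_prob_fin n (a x) (b x) S) = 1"
    using ev by eventually_elim (simp add: stair_prob_fin_bounds)
  then have "((\<lambda>x. \<Sum>S\<in>stair_tableaux n. stair_prob_fin n (a x) (b x) S) \<longlongrightarrow> 1) at_top"
    by (rule tendsto_eventually)
  ultimately show "(\<Sum>S\<in>stair_tableaux n. stair_prob n \<alpha> \<beta> S) = 1"
    by (intro tendsto_unique[of at_top]) auto
qed

section \<open>Convergence of the joint generating function\<close>

text \<open>The bound \<open>rate\<close> is uniform over parameters whose reciprocals are at most
  \<open>A\<close>. So for fixed \<open>n\<close> it survives the passage to the limit along the
  curve, and only then does \<open>n\<close> tend to infinity.\<close>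

lemma stair_prob_pgf_tendsto:
  fixes u v :: real
  assumes "\<alpha> > 0" "\<beta> > 0" and k: "k > 1" and u: "0 \<le> u" "u \<le> 1" and v: "0 \<le> v" "v \<le> 1"
  shows "(\<lambda>n. \<Sum>S\<in>stair_tableaux n. stair_prob n \<alpha> \<beta> S *
      (u ^ diagonal_count n k Alpha S * v ^ diagonal_count n k Beta S)) \<longlonglongrightarrow>
    exp ((u - 1) / 2) * exp ((v - 1) / 2)"
proof -
  obtain a b :: "real \<Rightarrow> real" and A :: real where lim: "\<And>n S. S \<in> stair_tableaux n \<Longrightarrow>
      ((\<lambda>x. stair_prob_fin n (a x) (b x) S) \<longlongrightarrow> stair_prob n \<alpha> \<beta> S) at_top"
    and ev: "eventually (\<lambda>x. a x > 0 \<and> b x > 0 \<and> 1 / a x \<le> A \<and> 1 / b x \<le> A) at_top"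
    by (rule stair_prob_limit[OF assms(1,2)]) blast
  have A: "A \<ge> 0"
  proof -
    from ev have "eventually (\<lambda>x::real. A \<ge> 0) at_top"
    proof eventually_elim
      case (elim x)
      then have "0 < 1 / a x" by simp
      then show ?case using elim by linarith
    qed
    then show ?thesis by simp
  qed
  define G where "G = (\<lambda>n. \<Sum>S\<in>stair_tableaux n. stair_prob n \<alpha> \<beta> S *
      (u ^ diagonal_count n k Alpha S * v ^ diagonal_count n k Beta S))"
  define L where "L = exp ((u - 1) / 2) * exp ((v - 1) / 2)"
  define K where "K = tableau_pgf.step_const k + 2 * A + 2 * real k"
  have bound: "\<bar>G n - L\<bar> \<le> m * k / (real n - 1) + K * ((2 * A + n) ^ 5 / real m ^ 6) + 2 * ((A + m) / n)"
    if m: "4 \<le> m" "m \<le> n" for n m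
  proof (rule tendsto_upperbound)
    show "((\<lambda>x. \<bar>(\<Sum>S\<in>stair_tableaux n. stair_prob_fin n (a x) (b x) S *
      (u ^ diagonal_count n k Alpha S * v ^ diagonal_count n k Beta S)) - L\<bar>) \<longlongrightarrow> \<bar>G n - L\<bar>) at_top"
      unfolding G_def by (intro tendsto_intros lim)
    show "\<forall>\<^sub>F x in at_top. \<bar>(\<Sum>S\<in>stair_tableaux n. stair_prob_fin n (a x) (b x) S *
      (u ^ diagonal_count n k Alpha S * v ^ diagonal_count n k Beta S)) - L\<bar> \<le>
      m * k / (real n - 1) + K * ((2 * A + n) ^ 5 / real m ^ 6) + 2 * ((A + m) / n)"
      using ev
    proof eventually_elim
      case (elim x)
      interpret tableau_pgf "a x" "b x" u v k by unfold_locales (use elim u v k in auto)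
      have "limit_pgf 0 = L"
        by (simp add: limit_pgf_def limit_exponent_def L_def exp_add[symmetric] field_simps)
      then show ?case
        using ngen_limit[of A m n] elim m unfolding sum_stair_prob_fin rate_def K_def by simp
    qed
  qed simp
  \<comment> \<open>Both \<open>m / n\<close> and \<open>n ^ 5 / m ^ 6\<close> have to vanish, so
    any exponent strictly between \<open>5 / 6\<close> and 1 would serve.\<close>
  define m where "m = (\<lambda>n. nat \<lceil>real n powr (9 / 10)\<rceil>)"
  have m: "real n powr (9 / 10) \<le> m n" "m n \<le> real n powr (9 / 10) + 1" for n
    unfolding m_def by (auto simp: of_nat_ceiling)
  have K: "K \<ge> 0"
  proof -
    interpret tableau_pgf 1 1 u v k by unfold_locales (use u v k in auto)
    show ?thesis unfolding K_def using step_const_bounds(1) A by simp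
  qed
  define h where "h = (\<lambda>n. (real n powr (9 / 10) + 1) * k / (real n - 1) +
      K * ((2 * A + n) ^ 5 / (real n powr (9 / 10)) ^ 6) + 2 * ((A + (real n powr (9 / 10) + 1)) / n))"
  have "eventually (\<lambda>n. real n powr (9 / 10) \<ge> 4) sequentially" by real_asymp
  moreover have "eventually (\<lambda>n. real n powr (9 / 10) + 1 \<le> real n) sequentially" by real_asymp
  ultimately have "eventually (\<lambda>n. \<bar>G n - L\<bar> \<le> h n) sequentially"
    using eventually_gt_at_top[of 1]
  proof eventually_elim
    case (elim n)
    have mn: "4 \<le> m n" "m n \<le> n" using m[of n] elim by linarith+
    have "m n * k / (real n - 1) \<le> (real n powr (9 / 10) + 1) * k / (real n - 1)"
      unfolding of_nat_mult using m(2)[of n] elim by (intro divide_right_mono mult_right_mono) auto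
    moreover have "K * ((2 * A + n) ^ 5 / real (m n) ^ 6) \<le> K * ((2 * A + n) ^ 5 / (real n powr (9 / 10)) ^ 6)"
      using m(1)[of n] elim A K by (intro mult_left_mono divide_left_mono power_mono mult_pos_pos) auto
    moreover have "2 * ((A + m n) / n) \<le> 2 * ((A + (real n powr (9 / 10) + 1)) / n)"
      using m(2)[of n] elim by (intro mult_left_mono divide_right_mono) auto
    ultimately show ?case using bound[OF mn] unfolding h_def by linarith
  qed
  moreover have "h \<longlonglongrightarrow> 0"
  proof -
    have "(\<lambda>n. (real n powr (9 / 10) + 1) / (real n - 1)) \<longlonglongrightarrow> 0" by real_asymp
    from tendsto_mult_right_zero[OF this, of "real k"]
    have 1: "(\<lambda>n. (real n powr (9 / 10) + 1) * k / (real n - 1)) \<longlonglongrightarrow> 0" by (simp add: mult_ac)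
    have "(\<lambda>n. (2 * A + real n) ^ 5 / (real n powr (9 / 10)) ^ 6) \<longlonglongrightarrow> 0" by real_asymp
    from tendsto_mult_right_zero[OF this, of K]
    have 2: "(\<lambda>n. K * ((2 * A + real n) ^ 5 / (real n powr (9 / 10)) ^ 6)) \<longlonglongrightarrow> 0" .
    have "(\<lambda>n. (A + (real n powr (9 / 10) + 1)) / real n) \<longlonglongrightarrow> 0" by real_asymp
    from tendsto_mult_right_zero[OF this, of 2]
    have 3: "(\<lambda>n. 2 * ((A + (real n powr (9 / 10) + 1)) / real n)) \<longlonglongrightarrow> 0" .
    from tendsto_add[OF tendsto_add[OF 1 2] 3] show ?thesis by (simp add: h_def)
  qed
  ultimately have "(\<lambda>n. \<bar>G n - L\<bar>) \<longlonglongrightarrow> 0"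
    by (intro tendsto_sandwich[of "\<lambda>_. 0" "\<lambda>n. \<bar>G n - L\<bar>" sequentially h 0]) auto
  then show ?thesis
    unfolding G_def L_def by (simp add: tendsto_rabs_zero_iff LIM_zero_iff)
qed

section \<open>The tableau measure and the limit theorem\<close>

lemma integral_stair_measure:
  fixes g :: "tableau \<Rightarrow> real"
  assumes "\<alpha> > 0" "\<beta> > 0"
  shows "integral\<^sup>L (stair_measure n \<alpha> \<beta>) g = (\<Sum>S\<in>stair_tableaux n. stair_prob n \<alpha> \<beta> S * g S)"
proof -
  \<comment> \<open>The positive part agrees with \<open>stair_prob\<close> on the tableaux and is
    nonnegative everywhere; off the tableaux the sign of \<open>stair_prob\<close> has not been
    established.\<close>
  have "stair_measure n \<alpha> \<beta> = point_measure (stair_tableaux n) (\<lambda>S. ennreal (max 0 (stair_prob n \<alpha> \<beta> S)))"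
    unfolding stair_measure_def point_measure_def
    by (intro density_cong) (auto simp: AE_count_space stair_prob_distribution[OF assms])
  then show ?thesis
    using stair_prob_distribution(1)[OF assms]
    by (simp add: lebesgue_integral_point_measure_finite)
qed

lemma prob_space_stair_measure:
  assumes "\<alpha> > 0" "\<beta> > 0"
  shows "prob_space (stair_measure n \<alpha> \<beta>)"
proof
  have "emeasure (stair_measure n \<alpha> \<beta>) (stair_tableaux n) = (\<Sum>S\<in>stair_tableaux n. ennreal (stair_prob n \<alpha> \<beta> S))"
    unfolding stair_measure_def by (subst emeasure_point_measure_finite) auto
  also have "\<dots> = ennreal (\<Sum>S\<in>stair_tableaux n. stair_prob n \<alpha> \<beta> S)"
    using stair_prob_distribution(1)[OF assms] by (intro sum_ennreal)
  finally show "emeasure (stair_measure n \<alpha> \<beta>) (space (stair_measure n \<alpha> \<beta>)) = 1"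
    by (simp add: stair_prob_distribution[OF assms] stair_measure_def space_point_measure)
qed

text \<open>The generating function of an independent pair factors into two Poisson ones, giving
  \<open>exp ((u - 1) / 2) * exp ((v - 1) / 2)\<close>, the limit found for the tableaux. This gives
  convergence for every bounded function on pairs of naturals, in particular for the restriction of
  a bounded continuous function of the plane.\<close>

theorem theorem8:
  fixes k :: nat and \<alpha> \<beta> :: ennreal
    and M :: "'w measure" and Z1 Z2 :: "'w \<Rightarrow> nat"
  assumes "k > 1"
    and "\<alpha> > 0" and "\<beta> > 0"
    and "prob_space M"
    and "prob_space.indep_var M (count_space UNIV) Z1 (count_space UNIV) Z2"
    and "distr M (count_space UNIV) Z1 = measure_pmf (poisson_pmf (1 / 2))"
    and "distr M (count_space UNIV) Z2 = measure_pmf (poisson_pmf (1 / 2))"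
  shows "converges_in_distribution
    (\<lambda>n. distr (stair_measure n \<alpha> \<beta>) borel
       (\<lambda>S. (real (diagonal_count n k Alpha S), real (diagonal_count n k Beta S))))
    (distr M borel (\<lambda>\<omega>. (real (Z1 \<omega>), real (Z2 \<omega>))))"
proof -
  interpret prob_space M by fact
  note Z = indep_var_rv1[OF assms(5)] indep_var_rv2[OF assms(5)]
  note [measurable] = Z
  interpret pgf_convergence "\<lambda>n. stair_measure n \<alpha> \<beta>" "\<lambda>n. diagonal_count n k Alpha" "\<lambda>n. diagonal_count n k Beta" M Z1 Z2
  proof (rule pgf_convergence.intro)
    fix u v :: real assume u: "0 \<le> u" "u \<le> 1" and v: "0 \<le> v" "v \<le> 1"
    have "indep_var borel ((\<lambda>i. u ^ i) \<circ> Z1) borel ((\<lambda>i. v ^ i) \<circ> Z2)"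
      by (rule indep_var_compose[OF assms(5)]) auto
    then have "indep_var borel (\<lambda>x. u ^ Z1 x) borel (\<lambda>x. v ^ Z2 x)"
      by (simp add: comp_def)
    then have "expectation (\<lambda>x. u ^ Z1 x * v ^ Z2 x) = expectation (\<lambda>x. u ^ Z1 x) * expectation (\<lambda>x. v ^ Z2 x)"
      using u v by (intro indep_var_lebesgue_integral integrable_const_bound[where B = 1]) (auto simp: power_le_one)
    also have "\<dots> = exp ((u - 1) / 2) * exp ((v - 1) / 2)"
      using poisson_pgf[OF Z(1) assms(6) u] poisson_pgf[OF Z(2) assms(7) v] by simp
    finally show "(\<lambda>n. \<integral>S. u ^ diagonal_count n k Alpha S * v ^ diagonal_count n k Beta S \<partial>stair_measure n \<alpha> \<beta>)
        \<longlonglongrightarrow> expectation (\<lambda>x. u ^ Z1 x * v ^ Z2 x)"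
      using stair_prob_pgf_tendsto[OF assms(2,3,1) u v]
      by (simp add: integral_stair_measure[OF assms(2,3)])
  next
    fix n
    show "prob_space (stair_measure n \<alpha> \<beta>)" by (rule prob_space_stair_measure[OF assms(2,3)])
    show "prob_space M" by fact
    show "diagonal_count n k Alpha \<in> measurable (stair_measure n \<alpha> \<beta>) (count_space UNIV)"
      "diagonal_count n k Beta \<in> measurable (stair_measure n \<alpha> \<beta>) (count_space UNIV)"
      by (simp_all add: stair_measure_def)
  qed (rule Z)+
  show ?thesis
    unfolding converges_in_distribution_def
  proof (intro allI impI, elim conjE)
    fix f :: "real \<times> real \<Rightarrow> real"
    assume f: "continuous_on UNIV f" "bounded (range f)"
    have [measurable]: "f \<in> borel_measurable borel"
      using f(1) by (rule borel_measurable_continuous_onI)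
    obtain C where C: "\<And>z. \<bar>f z\<bar> \<le> C"
      using f(2) unfolding bounded_iff by auto
    have "converges (\<lambda>i j. f (real i, real j))"
      by (rule converges_bounded[OF C])
    moreover have "(\<integral>x. f x \<partial>distr (stair_measure n \<alpha> \<beta>) borel
        (\<lambda>S. (real (diagonal_count n k Alpha S), real (diagonal_count n k Beta S)))) =
      (\<integral>S. f (real (diagonal_count n k Alpha S), real (diagonal_count n k Beta S)) \<partial>stair_measure n \<alpha> \<beta>)" for n
      by (intro integral_distr) (auto simp: stair_measure_def)
    moreover have "(\<integral>x. f x \<partial>distr M borel (\<lambda>\<omega>. (real (Z1 \<omega>), real (Z2 \<omega>)))) =
      expectation (\<lambda>\<omega>. f (real (Z1 \<omega>), real (Z2 \<omega>)))"
      by (intro integral_distr borel_measurable_Pair) measurable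
    ultimately show "(\<lambda>n. \<integral>x. f x \<partial>distr (stair_measure n \<alpha> \<beta>) borel
        (\<lambda>S. (real (diagonal_count n k Alpha S), real (diagonal_count n k Beta S)))) \<longlonglongrightarrow>
      (\<integral>x. f x \<partial>distr M borel (\<lambda>\<omega>. (real (Z1 \<omega>), real (Z2 \<omega>))))"
      unfolding converges_def by simp
  qed
qed

end
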